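(* Assume $f=g$, with $f$ and $u_0$ as in the context. Let $u$ be the Kružkov entropy solution of $u_t+f(u)_x=0$ on $\mathbb R\times(0,T)$ with $u(\cdot,0)=u_0$, and, for $\delta>0$, let $u^\delta$ be the front tracking approximation, i.e. the Kružkov entropy solution of $u^\delta_t+f^\delta(u^\delta)_x=0$ with $u^\delta(\cdot,0)=u_0^\delta$ (see context). Then for all $t\in[0,T]$ $$\|u(\cdot,t)-u^\delta(\cdot,t)\|_{L^1(\mathbb R)}\le 2\bigl(Y\,\mathrm{TV}(u_0)\,\mathcal C_1\bigr)^{1/2}\delta+\delta\,\mathrm{TV}(u_0)+\|u_0-u_0^\delta\|_{L^1(\mathbb R)},$$ where $$Y=X+2TL_f,\qquad \mathcal C_1=1+\tfrac18T\|f''\|_\infty .$$ If moreover $u_0^\delta$ is constructed by the cell-average construction (R) of the context, then the estimate holds without the final two terms $\delta\,\mathrm{TV}(u_0)+\|u_0-u_0^\delta\|_{L^1(\mathbb R)}$ on the right side.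
   Context: **Data.** $\underline u<\overline u$ are real, $T>0$, $f\in C^2([\underline u,\overline u])$ with Lipschitz constant $L_f$, and $\|q\|_\infty=\max_{[\underline u,\overline u]}|q|$. $u_0\in L^\infty(\mathbb R)$ has finite total variation $\mathrm{TV}(u_0)$, $u_0(x)\in[\underline u,\overline u]$ for all $x$, and for some $X>0$ and constants $u_L,u_R$, $u_0(x)=u_L$ for $x\le-X$ and $u_0(x)=u_R$ for $x\ge X$. **Front tracking data.** For each $\delta>0$ choose breakpoints $\underline u=\mathsf u_0<\mathsf u_1<\dots<\mathsf u_K=\overline u$ with $\mathsf u_{k+1}-\mathsf u_k\le\delta$; $f^\delta$ is the continuous piecewise linear interpolant of $f$ at these breakpoints. $u_0^\delta$ is piecewise constant with finitely many jumps, takes values in $[\underline u,\overline u]$, satisfies $\mathrm{TV}(u_0^\delta)\le\mathrm{TV}(u_0)$, equals $u_L$ for $x\le -X$ and $u_R$ for $x\ge X$, and $\|u_0^\delta-u_0\|_{L^1(\mathbb R)}=O(\delta)$ as $\delta\to0$. The front tracking algorithm computes $u^\delta$ exactly. Standing assumption: for every $t\in[0,T]$, $u^\delta(\cdot,t)$ is piecewise constant with finitely many discontinuities. **Construction (R).** $u_0^\delta=u_L$ for $x<-X$, $u_0^\delta=u_R$ for $x\ge X$; and for some partition $-X=z_0<z_1<\dots<z_{\mathcal M}=X$ with $z_i-z_{i-1}\le\delta$ and total variation of $u_0$ on $(z_{i-1},z_i)$ at most $\delta$ for each $i=1,\dots,\mathcal M$, $u_0^\delta$ is constant on $[z_{i-1},z_i)$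 with value $\frac1{z_i-z_{i-1}}\int_{z_{i-1}}^{z_i}u_0\,dx$. **Entropy solution.** "Kružkov entropy solution" has its standard meaning: $u\in L^\infty(\mathbb R\times(0,T))$ with values in $[\underline u,\overline u]$ such that for every $c\in[\underline u,\overline u]$ and every $0\le\phi\in C_c^\infty(\mathbb R\times[0,T))$, $\iint(|u-c|\phi_t+\mathrm{sgn}(u-c)(f(u)-f(c))\phi_x)\,dx\,dt+\int_{\mathbb R}|u_0-c|\phi(x,0)\,dx\ge0$ (and analogously for $f^\delta,u_0^\delta$); the representative in $C([0,T];L^1_{\mathrm{loc}}(\mathbb R))$ is used. *)

theory Defs
  imports "HOL-Analysis.Analysis"
begin

text \<open>
  Scalar conservation laws on the line. An element of \<open>L\<^sup>\<infinity>\<close> is represented by an everywhere defined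
  Borel function, and a function of space and time is written \<open>u x t\<close>. Fluxes are total functions
  on \<open>real\<close>, but only their values on the state interval \<open>{ulo..uhi}\<close> are ever used.
\<close>

text \<open>
  Pointwise total variation, as an extended real: the supremum over all finite increasing sequences
  of points of \<open>S\<close>. For a representative whose value at each point lies between its one-sided limits
  it is the total variation of the \<open>L\<^sup>\<infinity>\<close>-class; for other representatives it is larger.
\<close>

definition total_variation_on :: "real set \<Rightarrow> (real \<Rightarrow> real) \<Rightarrow> ennreal" where
  "total_variation_on S g =
     (SUP xs \<in> {xs. sorted xs \<and> set xs \<subseteq> S}.
        \<Sum>i<length xs - 1. ennreal \<bar>g (xs ! Suc i) - g (xs ! i)\<bar>)"

definition L1_norm :: "(real \<Rightarrow> real) \<Rightarrow> ennreal" where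
  "L1_norm g = (\<integral>\<^sup>+x. ennreal \<bar>g x\<bar> \<partial>lborel)"

text \<open>Values at the finitely many exceptional points are arbitrary.\<close>

definition piecewise_constant :: "(real \<Rightarrow> real) \<Rightarrow> bool" where
  "piecewise_constant g \<longleftrightarrow>
     (\<exists>J. finite J \<and> (\<forall>x y. x \<le> y \<longrightarrow> {x..y} \<inter> J = {} \<longrightarrow> g x = g y))"

text \<open>
  The class \<open>C\<^sup>\<infinity>(\<real>\<^sup>2)\<close>: \<open>D i j\<close> is the mixed partial derivative of order \<open>i\<close> in the first and \<open>j\<close> in
  the second variable.
\<close>

definition smooth2 :: "(real \<Rightarrow> real \<Rightarrow> real) \<Rightarrow> bool" where
  "smooth2 \<phi> \<longleftrightarrow>
     (\<exists>D :: nat \<Rightarrow> nat \<Rightarrow> real \<Rightarrow> real \<Rightarrow> real. D 0 0 = \<phi> \<and>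
        (\<forall>i j. continuous_on UNIV (\<lambda>(x, t). D i j x t) \<and>
          (\<forall>x t. ((\<lambda>y. D i j y t) has_real_derivative D (Suc i) j x t) (at x) \<and>
                 ((\<lambda>s. D i j x s) has_real_derivative D i (Suc j) x t) (at t))))"

text \<open>
  Nonnegative elements of \<open>C\<^sub>c\<^sup>\<infinity>(\<real> \<times> [0,T))\<close>, as restrictions to \<open>t \<ge> 0\<close> of smooth functions on
  \<open>\<real>\<^sup>2\<close> with compact support in \<open>\<real> \<times> (-\<infinity>,T)\<close>. In particular \<open>\<phi> x 0\<close> need not vanish.
\<close>

definition test_function :: "real \<Rightarrow> (real \<Rightarrow> real \<Rightarrow> real) \<Rightarrow> bool" where
  "test_function T \<phi> \<longleftrightarrow>
     smooth2 \<phi> \<and>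
     compact (closure {(x, t). \<phi> x t \<noteq> 0}) \<and>
     closure {(x, t). \<phi> x t \<noteq> 0} \<subseteq> UNIV \<times> {..<T} \<and>
     (\<forall>x. \<forall>t\<ge>0. 0 \<le> \<phi> x t)"

text \<open>
  Kruzkov entropy solution of \<open>u\<^sub>t + f(u)\<^sub>x = 0\<close> on \<open>\<real> \<times> (0,T)\<close> with initial datum \<open>u0\<close>, in its
  representative in \<open>C([0,T]; L\<^sup>1\<^sub>l\<^sub>o\<^sub>c(\<real>))\<close>. The last conjunct, that this representative has trace \<open>u0\<close>
  at \<open>t = 0\<close>, is a consequence of the preceding ones.
\<close>

definition kruzkov_entropy_solution ::
  "real \<Rightarrow> real \<Rightarrow> real \<Rightarrow> (real \<Rightarrow> real) \<Rightarrow> (real \<Rightarrow> real) \<Rightarrow> (real \<Rightarrow> real \<Rightarrow> real) \<Rightarrow> bool" where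
  "kruzkov_entropy_solution ulo uhi T f u0 u \<longleftrightarrow>
     (\<lambda>(x, t). u x t) \<in> borel_measurable (restrict_space borel (UNIV \<times> {0..T})) \<and>
     (\<forall>x. \<forall>t\<in>{0..T}. u x t \<in> {ulo..uhi}) \<and>
     (\<forall>c\<in>{ulo..uhi}. \<forall>\<phi>. test_function T \<phi> \<longrightarrow>
        0 \<le> (LINT (x, t):UNIV \<times> {0<..<T}|lborel.
               \<bar>u x t - c\<bar> * deriv (\<lambda>s. \<phi> x s) t +
               sgn (u x t - c) * (f (u x t) - f c) * deriv (\<lambda>y. \<phi> y t) x)
           + (LINT x|lborel. \<bar>u0 x - c\<bar> * \<phi> x 0)) \<and>
     (\<forall>R. \<forall>t\<in>{0..T}.
        ((\<lambda>s. LINT x:{-R..R}|lborel. \<bar>u x s - u x t\<bar>) \<longlongrightarrow> 0) (at t within {0..T})) \<and>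
     (AE x in lborel. u x 0 = u0 x)"

definition breakpoints :: "real \<Rightarrow> real \<Rightarrow> real \<Rightarrow> nat \<Rightarrow> (nat \<Rightarrow> real) \<Rightarrow> bool" where
  "breakpoints ulo uhi \<delta> K w \<longleftrightarrow>
     w 0 = ulo \<and> w K = uhi \<and> (\<forall>k<K. w k < w (Suc k) \<and> w (Suc k) - w k \<le> \<delta>)"

definition linear_interpolant ::
  "(real \<Rightarrow> real) \<Rightarrow> nat \<Rightarrow> (nat \<Rightarrow> real) \<Rightarrow> (real \<Rightarrow> real) \<Rightarrow> bool" where
  "linear_interpolant f K w g \<longleftrightarrow>
     (\<forall>k<K. \<forall>v\<in>{w k..w (Suc k)}.
        g v = f (w k) + (f (w (Suc k)) - f (w k)) / (w (Suc k) - w k) * (v - w k))"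

text \<open>
  Initial datum for front tracking (without the \<open>O(\<delta>)\<close> condition, which concerns the whole family).
  The left state is prescribed only for \<open>x < -X\<close>: the value at the single point \<open>-X\<close> is immaterial,
  and the cell averages below take a different value there.
\<close>

definition front_tracking_datum ::
  "real \<Rightarrow> real \<Rightarrow> real \<Rightarrow> real \<Rightarrow> real \<Rightarrow> (real \<Rightarrow> real) \<Rightarrow> (real \<Rightarrow> real) \<Rightarrow> bool" where
  "front_tracking_datum ulo uhi X uL uR u0 v \<longleftrightarrow>
     piecewise_constant v \<and>
     (\<forall>x. v x \<in> {ulo..uhi}) \<and>
     total_variation_on UNIV v \<le> total_variation_on UNIV u0 \<and>
     (\<forall>x < - X. v x = uL) \<and> (\<forall>x\<ge>X. v x = uR)"

definition cell_average_datum ::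
  "real \<Rightarrow> real \<Rightarrow> real \<Rightarrow> real \<Rightarrow> (real \<Rightarrow> real) \<Rightarrow> (real \<Rightarrow> real) \<Rightarrow> bool" where
  "cell_average_datum X uL uR \<delta> u0 v \<longleftrightarrow>
     (\<forall>x < - X. v x = uL) \<and> (\<forall>x\<ge>X. v x = uR) \<and>
     (\<exists>(M::nat) z. z 0 = -X \<and> z M = X \<and>
        (\<forall>i<M. z i < z (Suc i) \<and> z (Suc i) - z i \<le> \<delta> \<and>
           total_variation_on {z i<..<z (Suc i)} u0 \<le> ennreal \<delta> \<and>
           (\<forall>x\<in>{z i..<z (Suc i)}.
              v x = 1 / (z (Suc i) - z i) * (LINT y:{z i..z (Suc i)}|lborel. u0 y))))"

end

theory Submission
  imports Defs
begin

text \<open>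
  Both entropy solutions are compared with Lax--Friedrichs approximations on a common grid. A Kuznetsov
  type doubling argument, in which one of the two variables is already discrete, shows that an
  approximation started from \<open>v\<close> is within \<open>\<parallel>u(\<cdot>,0) - v\<parallel> + o(1)\<close> of the entropy solution \<open>u\<close> in \<open>L\<^sup>1\<close>;
  in particular the datum may be exchanged without any existence theorem. For the two approximations,
  the discrete primitive \<open>D\<close> of the difference \<open>w\<close> evolves by a monotone scheme for a
  Hamilton--Jacobi equation, so \<open>\<bar>D\<bar> \<le> M + t \<parallel>f - f\<^sup>\<delta>\<parallel>\<^sub>\<infinity>\<close>, where \<open>M\<close> is the initial bound
  (\<open>0\<close> for equal data, \<open>\<delta>\<^sup>2\<close> for cell averages) and \<open>\<parallel>f - f\<^sup>\<delta>\<parallel>\<^sub>\<infinity> \<le> \<delta>\<^sup>2 \<parallel>f''\<parallel>\<^sub>\<infinity> / 8\<close>. Since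
  \<open>w\<close> lives on an interval of length \<open>2 (X + t L\<^sub>f)\<close> and has variation at most \<open>2 TV(u\<^sub>0)\<close>,
  interpolating between the bound for \<open>D\<close> and the bound for the variation of \<open>w\<close> gives
  \<open>\<parallel>w\<parallel> \<le> 2 (\<bar>D\<bar> TV(u\<^sub>0) (X + t L\<^sub>f))\<^sup>1\<^sup>/\<^sup>2\<close>.
\<close>

section \<open>Smooth functions of compact support\<close>

text \<open>The variation bound, the finite speed of propagation and the maximum principle are
  proved for the scheme, where each is an algebraic consequence of the CFL condition; only L1
  distances are carried over to the entropy solutions. The scheme acts on functions on the whole
  line, so every real \<open>x\<close> carries its own grid of spacing \<open>2 * h\<close>. An
  integral over the line is then a sum along a grid, integrated over one cell. The datum of the
  second scheme is free. Starting it from \<open>u0\<close> makes the two data equal and costs the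
  L1 distance of the data. Starting it from the cell averages costs the bound
  \<open>\<delta>\<^sup>2\<close> on the initial primitive, which has the same order as the flux
  error. These two contributions, of the datum and of the flux, are the summands \<open>1\<close>
  and \<open>T * F / 8\<close> of \<open>C1\<close>. The numerical speed \<open>1 / lam\<close> may
  be any positive \<open>s\<close> with \<open>L \<le> s\<close>; the support of the difference then
  grows at speed \<open>s\<close>, which is the origin of the factor \<open>X + s * t\<close> and,
  through it, of \<open>Y\<close>.\<close>

definition smooth1 :: "(real \<Rightarrow> real) \<Rightarrow> bool" where
  "smooth1 g \<longleftrightarrow> (\<exists>D. D 0 = g \<and> (\<forall>i x. (D i has_real_derivative D (Suc i) x) (at x)))"

lemma smooth1I:
  assumes "\<And>x. (F has_real_derivative g x) (at x)" "smooth1 g"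
  shows "smooth1 F"
proof -
  obtain D where D: "D 0 = g" "\<And>i x. (D i has_real_derivative D (Suc i) x) (at x)"
    using assms(2) unfolding smooth1_def by blast
  have "(case_nat F D i has_real_derivative case_nat F D (Suc i) x) (at x)" for i x
    using assms(1) D by (cases i) auto
  then show ?thesis unfolding smooth1_def by (intro exI[of _ "case_nat F D"]) auto
qed

text \<open>Choosing one derivative inside \<open>S\<close> for each member gives an operator that
  can be iterated, so no formula for higher derivatives of a bump is required.\<close>

lemma smooth1_closed_class:
  assumes "\<And>g. g \<in> S \<Longrightarrow> \<exists>g'\<in>S. \<forall>x. (g has_real_derivative g' x) (at x)" "g \<in> S"
  shows "smooth1 g"
proof -
  obtain d where d: "\<And>g. g \<in> S \<Longrightarrow> d g \<in> S" "\<And>g x. g \<in> S \<Longrightarrow> (g has_real_derivative d g x) (at x)"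
    using assms(1) by metis
  have "(d ^^ i) g \<in> S" for i using d assms(2) by (induction i) auto
  then show ?thesis unfolding smooth1_def
    by (intro exI[of _ "\<lambda>i. (d ^^ i) g"]) (auto simp: d)
qed

lemma smooth1_deriv:
  assumes "smooth1 g"
  obtains g' where "smooth1 g'" "\<And>x. (g has_real_derivative g' x) (at x)"
proof -
  obtain D where D: "D 0 = g" "\<And>i x. (D i has_real_derivative D (Suc i) x) (at x)"
    using assms unfolding smooth1_def by blast
  have "smooth1 (D 1)" unfolding smooth1_def by (intro exI[of _ "\<lambda>i. D (Suc i)"]) (auto simp: D)
  moreover have "(g has_real_derivative D 1 x) (at x)" for x using D(2)[of 0 x] D(1) by simp
  ultimately show thesis using that by blast
qed

lemma smooth1_continuous: "smooth1 g \<Longrightarrow> continuous_on S g"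
  by (metis smooth1_deriv DERIV_continuous_on DERIV_subset top_greatest)

lemma smooth1_shift:
  assumes "smooth1 g"
  shows "smooth1 (\<lambda>x. g (x - d))"
proof -
  obtain D where D: "D 0 = g" "\<And>i x. (D i has_real_derivative D (Suc i) x) (at x)"
    using assms unfolding smooth1_def by blast
  have "((\<lambda>x. D i (x - d)) has_real_derivative D (Suc i) (x - d)) (at x)" for i x
    using D(2)[of i "x - d"] DERIV_shift[of "D i" "D (Suc i) (x - d)" x "- d"] by simp
  then show ?thesis unfolding smooth1_def by (intro exI[of _ "\<lambda>i x. D i (x - d)"]) (auto simp: D(1))
qed

lemma smooth1_diff:
  assumes "smooth1 f" "smooth1 g"
  shows "smooth1 (\<lambda>x. f x - g x)"
proof -
  obtain D E where "D 0 = f" "\<And>i x. (D i has_real_derivative D (Suc i) x) (at x)"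
    "E 0 = g" "\<And>i x. (E i has_real_derivative E (Suc i) x) (at x)"
    using assms unfolding smooth1_def by blast
  then show ?thesis unfolding smooth1_def
    by (intro exI[of _ "\<lambda>i x. D i x - E i x"]) (auto intro!: DERIV_diff)
qed

section \<open>Flat exponentials and mollifiers\<close>

definition exp_inv :: "nat \<Rightarrow> real \<Rightarrow> real" where
  "exp_inv k x = (if x > 0 then (1/x)^k * exp (- (1/x)) else 0)"

lemma exp_inv_tendsto_0: "(exp_inv k \<longlongrightarrow> 0) (at_right 0)"
proof -
  have "((\<lambda>y::real. y^k * exp (-y)) \<longlongrightarrow> 0) at_top"
    using tendsto_power_div_exp_0[of k] by (simp add: exp_minus field_simps)
  then have "((\<lambda>x::real. (inverse x)^k * exp (- inverse x)) \<longlongrightarrow> 0) (at_right 0)"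
    by (rule filterlim_compose[OF _ filterlim_inverse_at_top_right])
  moreover have "eventually (\<lambda>x::real. (inverse x)^k * exp (- inverse x) = exp_inv k x) (at_right 0)"
    by (auto simp: eventually_at_filter exp_inv_def inverse_eq_divide)
  ultimately show ?thesis by (rule Lim_transform_eventually)
qed

text \<open>The powers of \<open>1/x\<close> are part of the family because differentiating
  \<open>exp (- (1/x))\<close> produces them; with them the derivative is again a combination of
  members.\<close>

lemma exp_inv_deriv:
  "(exp_inv k has_real_derivative (exp_inv (k+2) x - of_nat k * exp_inv (k+1) x)) (at x)"
proof -
  consider "x > 0" | "x < 0" | "x = 0" by linarith
  then show ?thesis
  proof cases
    case 1
    have "((\<lambda>x. (1/x)^k * exp (- (1/x))) has_real_derivative (exp_inv (k+2) x - of_nat k * exp_inv (k+1) x)) (at x)"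
      using 1 by (auto intro!: derivative_eq_intros simp: exp_inv_def field_simps power2_eq_square)
         (cases k; simp add: field_simps power2_eq_square)
    then show ?thesis
      by (rule has_field_derivative_transform_within[where d=x]) (use 1 in \<open>auto simp: exp_inv_def dist_real_def\<close>)
  next
    case 2
    have "((\<lambda>x. 0) has_real_derivative (exp_inv (k+2) x - of_nat k * exp_inv (k+1) x)) (at x)"
      using 2 by (simp add: exp_inv_def)
    then show ?thesis
      by (rule has_field_derivative_transform_within[where d="-x"]) (use 2 in \<open>auto simp: exp_inv_def dist_real_def\<close>)
  next
    case 3
    \<comment> \<open>To the right of 0 the difference quotient is \<open>exp_inv (k+1)\<close>,
      which tends to 0; to the left it vanishes.\<close>
    have "((\<lambda>h. exp_inv k h / h) \<longlongrightarrow> 0) (at_right 0)"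
      by (rule Lim_transform_eventually[OF exp_inv_tendsto_0[of "Suc k"]])
         (auto simp: eventually_at_filter exp_inv_def)
    moreover have "((\<lambda>h. exp_inv k h / h) \<longlongrightarrow> 0) (at_left 0)"
      by (rule Lim_transform_eventually[OF tendsto_const[of 0]])
         (auto simp: eventually_at_filter exp_inv_def)
    ultimately have "((\<lambda>h. exp_inv k h / h) \<longlongrightarrow> 0) (at 0)"
      by (simp add: filterlim_split_at)
    then show ?thesis using 3 by (simp add: DERIV_def exp_inv_def)
  qed
qed

text \<open>The algebra generated by constants and affine pullbacks of \<open>exp_inv\<close>. It is
  closed under differentiation and contains the bump below, which is therefore smooth.\<close>

inductive_set exp_inv_alg :: "(real \<Rightarrow> real) set" where
  "(\<lambda>x. exp_inv k (a * x + b)) \<in> exp_inv_alg"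
| "(\<lambda>x. c) \<in> exp_inv_alg"
| "f \<in> exp_inv_alg \<Longrightarrow> g \<in> exp_inv_alg \<Longrightarrow> (\<lambda>x. f x + g x) \<in> exp_inv_alg"
| "f \<in> exp_inv_alg \<Longrightarrow> g \<in> exp_inv_alg \<Longrightarrow> (\<lambda>x. f x * g x) \<in> exp_inv_alg"

lemma exp_inv_alg_deriv:
  "g \<in> exp_inv_alg \<Longrightarrow> \<exists>g'\<in>exp_inv_alg. \<forall>x. (g has_real_derivative g' x) (at x)"
proof (induction rule: exp_inv_alg.induct)
  case (1 k a b)
  let ?g = "\<lambda>x. exp_inv (k+2) (a * x + b) * a + (- of_nat k * a) * exp_inv (k+1) (a * x + b)"
  have "?g \<in> exp_inv_alg" by (intro exp_inv_alg.intros)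
  moreover have "((\<lambda>x. exp_inv k (a * x + b)) has_real_derivative ?g x) (at x)" for x
  proof -
    have "((\<lambda>x. a * x + b) has_real_derivative a) (at x)" by (auto intro!: derivative_eq_intros)
    from DERIV_chain2[of "exp_inv k" _ "\<lambda>x. a * x + b", OF exp_inv_deriv this]
    show ?thesis by (simp add: algebra_simps)
  qed
  ultimately show ?case by (intro bexI[of _ ?g] allI)
next
  case (2 c)
  then show ?case by (intro bexI[of _ "\<lambda>x. 0"]) (auto intro: exp_inv_alg.intros)
next
  case (3 f g)
  then obtain f' g' where "f' \<in> exp_inv_alg" "g' \<in> exp_inv_alg" "\<forall>x. (f has_real_derivative f' x) (at x)"
    "\<forall>x. (g has_real_derivative g' x) (at x)" by blast
  then show ?case
    by (intro bexI[of _ "\<lambda>x. f' x + g' x"]) (auto intro!: exp_inv_alg.intros derivative_eq_intros)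
next
  case (4 f g)
  then obtain f' g' where "f' \<in> exp_inv_alg" "g' \<in> exp_inv_alg" "\<forall>x. (f has_real_derivative f' x) (at x)"
    "\<forall>x. (g has_real_derivative g' x) (at x)" by blast
  then show ?case using 4
    by (intro bexI[of _ "\<lambda>x. f' x * g x + g' x * f x"]) (auto intro!: exp_inv_alg.intros derivative_eq_intros)
qed

text \<open>The support lies on one side of 0: \<open>r (x - y)\<close> sees only the
  \<open>x\<close> in \<open>{y..y+e}\<close>, and the primitive of \<open>r\<close> is a smooth
  step that rises from 0 at 0 to 1 at \<open>e\<close>. Both uses occur, the first in space and the
  second in time.\<close>

definition mollifier :: "real \<Rightarrow> (real \<Rightarrow> real) \<Rightarrow> bool" where
  "mollifier e r \<longleftrightarrow> smooth1 r \<and> (\<forall>x. 0 \<le> r x) \<and> (\<forall>x. x \<notin> {0..e} \<longrightarrow> r x = 0) \<and>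
     (r has_integral 1) {0..e}"

lemma mollifier_exists:
  assumes "0 < e"
  obtains r where "mollifier e r"
proof -
  \<comment> \<open>One factor is flat at 0 and the other at \<open>e\<close>. They are written in
    the form \<open>a * x + b\<close> to match the first introduction rule of
    \<open>exp_inv_alg\<close>.\<close>
  define b where "b x = exp_inv 0 (1 * x + 0) * exp_inv 0 ((-1) * x + e)" for x
  have b0: "0 \<le> b x" for x by (simp add: b_def exp_inv_def)
  have balg: "b \<in> exp_inv_alg" unfolding b_def[abs_def] by (intro exp_inv_alg.intros)
  have bsm: "smooth1 b" using smooth1_closed_class[OF exp_inv_alg_deriv balg] .
  have bz: "b x = 0" if "x \<notin> {0..e}" for x using that by (auto simp: b_def exp_inv_def)
  define Z where "Z = integral {0..e} b"
  have int: "b integrable_on {0..e}" by (intro integrable_continuous_interval smooth1_continuous bsm)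
  have "Z \<noteq> 0"
  proof
    assume "Z = 0"
    then have "(b has_integral 0) (cbox 0 e)" using int Z_def by (metis has_integral_integral interval_cbox)
    then have "b (e/2) = 0"
      using has_integral_0_cbox_imp_0[of 0 e b "e/2"] smooth1_continuous[OF bsm] b0 assms by auto
    then show False using assms by (auto simp: b_def exp_inv_def)
  qed
  then have Z: "Z > 0" using integral_nonneg[OF int] b0 unfolding Z_def by force
  define r where "r x = inverse Z * b x" for x
  have "r \<in> exp_inv_alg" unfolding r_def[abs_def] by (intro exp_inv_alg.intros balg)
  then have "smooth1 r" using smooth1_closed_class[OF exp_inv_alg_deriv] by blast
  moreover have "(r has_integral 1) {0..e}"
    using has_integral_mult_right[OF integrable_integral[OF int], of "inverse Z"] Z
    by (simp add: r_def[abs_def] Z_def)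
  ultimately have "mollifier e r" unfolding mollifier_def using b0 Z bz by (auto simp: r_def)
  then show thesis using that by blast
qed

lemma smooth_step:
  assumes "mollifier e r" "0 < e"
  obtains S where "smooth1 S" "\<And>x. (S has_real_derivative r x) (at x)" "mono S"
    "\<And>x. x \<le> 0 \<Longrightarrow> S x = 0" "\<And>x. e \<le> x \<Longrightarrow> S x = 1"
proof -
  have r: "smooth1 r" "\<And>x. 0 \<le> r x" "\<And>x. x \<notin> {0..e} \<Longrightarrow> r x = 0" "(r has_integral 1) {0..e}"
    using assms unfolding mollifier_def by auto
  have cont: "isCont r x" for x
    using smooth1_continuous[OF r(1), of UNIV] by (simp add: continuous_on_eq_continuous_at)
  obtain F where F: "\<And>x. (F has_real_derivative r x) (at x)"
    using einterval_antiderivative[of "-\<infinity>" "\<infinity>" r] cont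
    by (auto simp: has_real_derivative_iff_has_vector_derivative)
  define S where "S x = F x - F 0" for x
  have S: "(S has_real_derivative r x) (at x)" for x
    unfolding S_def[abs_def] by (auto intro!: derivative_eq_intros F)
  have mono: "mono S"
    by (rule monoI, rule DERIV_nonneg_imp_nondecreasing) (use S r(2) in blast)+
  have left: "S x = 0" if "x \<le> 0" for x
  proof (cases "x = 0")
    case False
    then obtain z where "x < z" "z < 0" "S 0 - S x = (0 - x) * r z"
      using MVT2[of x 0 S r] S \<open>x \<le> 0\<close> by (auto simp: less_le)
    then show ?thesis using r(3)[of z] by (simp add: S_def)
  qed (simp add: S_def)
  have "(r has_integral (S e - S 0)) {0..e}"
    by (rule fundamental_theorem_of_calculus)
       (use assms S in \<open>auto simp: has_real_derivative_iff_has_vector_derivative[symmetric] intro: has_field_derivative_at_within\<close>)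
  then have Se: "S e = 1" using r(4) has_integral_unique[of r] left[of 0] by fastforce
  have right: "S x = 1" if "e \<le> x" for x
  proof (cases "x = e")
    case False
    then obtain z where "e < z" "z < x" "S x - S e = (x - e) * r z"
      using MVT2[of e x S r] S \<open>e \<le> x\<close> by (auto simp: less_le)
    then show ?thesis using r(3)[of z] Se by simp
  qed (simp add: Se)
  show thesis using that[OF smooth1I[OF S r(1)] S mono left right] .
qed

text \<open>The mixed derivative of order \<open>(i, j)\<close> is \<open>P i x * Q j t\<close>; for
  this \<open>smooth1\<close> provides the whole sequence of derivatives.\<close>

lemma smooth2_product:
  assumes "smooth1 p" "smooth1 q"
  shows "smooth2 (\<lambda>x t. p x * q t)"
proof -
  obtain P where P: "P 0 = p" "\<And>i x. (P i has_real_derivative P (Suc i) x) (at x)"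
    using assms(1) unfolding smooth1_def by blast
  obtain Q where Q: "Q 0 = q" "\<And>i x. (Q i has_real_derivative Q (Suc i) x) (at x)"
    using assms(2) unfolding smooth1_def by blast
  have cP: "continuous_on UNIV (P i)" for i
    using P(2)[of i] DERIV_isCont continuous_at_imp_continuous_on by blast
  have cQ: "continuous_on UNIV (Q i)" for i
    using Q(2)[of i] DERIV_isCont continuous_at_imp_continuous_on by blast
  have "continuous_on UNIV (\<lambda>(x, t). P i x * Q j t)" for i j
    unfolding case_prod_beta
    by (intro continuous_intros continuous_on_compose2[OF cP] continuous_on_compose2[OF cQ]) auto
  moreover have "((\<lambda>y. P i y * Q j t) has_real_derivative P (Suc i) x * Q j t) (at x)" for i j x t
    by (auto intro!: derivative_eq_intros P(2))
  moreover have "((\<lambda>s. P i x * Q j s) has_real_derivative P i x * Q (Suc j) t) (at t)" for i j x t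
    by (auto intro!: derivative_eq_intros Q(2))
  ultimately show ?thesis unfolding smooth2_def
    by (intro exI[of _ "\<lambda>i j x t. P i x * Q j t"]) (auto simp: P(1) Q(1))
qed

lemma test_function_product:
  assumes "smooth1 p" "smooth1 q" "\<And>x. 0 \<le> p x" "\<And>t. 0 \<le> q t"
    "\<And>x. x \<notin> {a..b} \<Longrightarrow> p x = 0" "\<And>t. t \<notin> {c..d} \<Longrightarrow> q t = 0" "d < T"
  shows "test_function T (\<lambda>x t. p x * q t)"
proof -
  have sub: "closure {(x, t). p x * q t \<noteq> 0} \<subseteq> {a..b} \<times> {c..d}"
    using assms(5,6) by (intro closure_minimal) (fastforce intro: closed_Times)+
  have "compact ({a..b} \<times> {c..d})" by (intro compact_Times) auto
  then have "compact (closure {(x, t). p x * q t \<noteq> 0})"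
    using compact_Int_closed[of "{a..b} \<times> {c..d}" "closure {(x, t). p x * q t \<noteq> 0}"] sub
    by (simp add: Int_absorb1)
  then show ?thesis using sub assms unfolding test_function_def by (auto intro!: smooth2_product)
qed

lemma integrable_bounded_support:
  fixes f :: "'a::euclidean_space \<Rightarrow> real"
  assumes "f \<in> borel_measurable borel" "\<And>x. \<bar>f x\<bar> \<le> C" "\<And>x. x \<notin> cbox a b \<Longrightarrow> f x = 0"
  shows "integrable lborel f"
proof (rule Bochner_Integration.integrable_bound)
  show "integrable lborel (\<lambda>x. C * indicator (cbox a b) x :: real)"
    by (intro integrable_mult_right integrable_real_indicator emeasure_lborel_cbox_finite) auto
  have "0 \<le> C" using assms(2)[of a] by linarith
  then show "AE x in lborel. norm (f x) \<le> norm (C * indicator (cbox a b) x :: real)"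
    using assms(2,3) by (auto simp: indicator_def split: if_splits)
qed (use assms in auto)

lemma integral_bounded_support:
  fixes f :: "real \<Rightarrow> real"
  assumes "f \<in> borel_measurable borel" "\<And>x. \<bar>f x\<bar> \<le> C" "\<And>x. x \<notin> {a..b} \<Longrightarrow> f x = 0" "a \<le> b"
  shows "\<bar>LINT x|lborel. f x\<bar> \<le> C * (b - a)"
proof -
  have C: "0 \<le> C" using assms(2)[of a] by linarith
  have "\<bar>LINT x|lborel. f x\<bar> \<le> (LINT x|lborel. \<bar>f x\<bar>)" by (rule integral_abs_bound)
  also have "\<dots> \<le> (LINT x|lborel. C * indicator {a..b} x)"
  proof (intro integral_mono integrable_abs integrable_bounded_support[of f C a b])
    show "integrable lborel (\<lambda>x. C * indicator {a..b} x)"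
      using integrable_bounded_support[of "\<lambda>x. C * indicator {a..b} x" C a b] C by (auto simp: indicator_def)
  qed (use assms C in \<open>auto simp: indicator_def\<close>)
  also have "\<dots> = C * (b - a)" using assms(4) by simp
  finally show ?thesis .
qed

text \<open>The Kruzkov entropy flux that belongs to the entropy \<open>\<bar>a - b\<bar>\<close>;
  it is symmetric in the two states.\<close>

definition kflux :: "(real \<Rightarrow> real) \<Rightarrow> real \<Rightarrow> real \<Rightarrow> real" where
  "kflux g a b = sgn (a - b) * (g a - g b)"

text \<open>If \<open>a\<close> and \<open>b\<close> lie on the same side of \<open>c\<close>, the
  difference is \<open>g a - g b\<close> up to sign. If \<open>c\<close> separates them, the two
  terms add up, and so do the distances to \<open>c\<close>.\<close>

lemma kflux_Lipschitz:
  assumes "L-lipschitz_on UNIV g"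
  shows "\<bar>kflux g a c - kflux g b c\<bar> \<le> L * \<bar>a - b\<bar>"
proof -
  have g: "\<bar>g x - g y\<bar> \<le> L * \<bar>x - y\<bar>" for x y
    using lipschitz_onD[OF assms, of x y] by (simp add: dist_real_def)
  have opp: "L * \<bar>a - b\<bar> = L * \<bar>a - c\<bar> + L * \<bar>b - c\<bar>" if "a \<le> c \<and> c \<le> b \<or> b \<le> c \<and> c \<le> a"
    using that by (auto simp: algebra_simps abs_if)
  show ?thesis
    using g[of a b] g[of a c] g[of b c] opp unfolding kflux_def
    by (cases a c rule: linorder_cases; cases b c rule: linorder_cases) auto
qed

lemma kflux_le:
  assumes "L-lipschitz_on UNIV g"
  shows "\<bar>kflux g a c\<bar> \<le> L * \<bar>a - c\<bar>"
  using kflux_Lipschitz[OF assms, of a c c] by (simp add: kflux_def)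

lemma kflux_measurable [measurable]:
  assumes [measurable]: "g \<in> borel_measurable borel" "a \<in> borel_measurable M" "b \<in> borel_measurable M"
  shows "(\<lambda>x. kflux g (a x) (b x)) \<in> borel_measurable M"
  unfolding kflux_def by measurable

section \<open>Entropy solutions on time slices\<close>

lemma deriv_zero_outside:
  fixes p :: "real \<Rightarrow> real"
  assumes "\<And>x. (p has_real_derivative p' x) (at x)" "\<And>x. x \<notin> {a..b} \<Longrightarrow> p x = 0" "x \<notin> {a..b}"
  shows "p' x = 0"
proof -
  have "open (- {a..b})" by auto
  then obtain d where d: "d > 0" "ball x d \<subseteq> - {a..b}"
    using assms(3) open_contains_ball by blast
  have "(p has_real_derivative 0) (at x)"
    by (rule has_field_derivative_transform_within[OF DERIV_const[of 0], of d])
       (use d assms(2) in \<open>auto simp: subset_eq dist_commute\<close>)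
  then show ?thesis using assms(1) DERIV_unique by blast
qed

lemma bounded_support_bound:
  fixes f :: "real \<Rightarrow> real"
  assumes "continuous_on UNIV f" "\<And>x. x \<notin> {a..b} \<Longrightarrow> f x = 0"
  obtains C where "0 \<le> C" "\<And>x. \<bar>f x\<bar> \<le> C"
proof -
  have "bounded (f ` {a..b})"
    using assms(1) compact_continuous_image[of "{a..b}" f] compact_imp_bounded continuous_on_subset by blast
  then obtain B where B: "B > 0" "\<And>x. x \<in> {a..b} \<Longrightarrow> \<bar>f x\<bar> \<le> B"
    unfolding bounded_pos by auto
  then have "\<bar>f x\<bar> \<le> B" for x using assms(2)[of x] by (cases "x \<in> {a..b}") auto
  then show thesis using that[of B] B(1) by simp
qed

text \<open>The solution is defined at all real times and the flux is Lipschitz on all of the line,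
  so that no side conditions on the range of states or times arise. The test functions vanish at
  \<open>t = 0\<close>: the initial datum enters later only through \<open>u x 0\<close>.\<close>

locale entropy_evolution =
  fixes lo hi T L :: real and g :: "real \<Rightarrow> real" and u :: "real \<Rightarrow> real \<Rightarrow> real"
  assumes T: "0 < T"
    and g_Lip: "L-lipschitz_on UNIV g"
    and u_meas: "(\<lambda>(x, t). u x t) \<in> borel_measurable borel"
    and u_range: "\<And>x t. u x t \<in> {lo..hi}"
    and u_cont: "\<And>R t. t \<in> {0..T} \<Longrightarrow>
      ((\<lambda>s. LINT x:{-R..R}|lborel. \<bar>u x s - u x t\<bar>) \<longlongrightarrow> 0) (at t within {0..T})"
    and weak: "\<And>c \<phi>. c \<in> {lo..hi} \<Longrightarrow> test_function T \<phi> \<Longrightarrow> (\<And>x. \<phi> x 0 = 0) \<Longrightarrow>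
      0 \<le> (LINT (x, t):UNIV \<times> {0<..<T}|lborel.
        \<bar>u x t - c\<bar> * deriv (\<lambda>s. \<phi> x s) t + kflux g (u x t) c * deriv (\<lambda>y. \<phi> y t) x)"
begin

lemma L_nonneg: "0 \<le> L" using g_Lip by (rule lipschitz_on_nonneg)

lemma g_measurable [measurable]: "g \<in> borel_measurable borel"
  using lipschitz_on_continuous_on[OF g_Lip] by (rule borel_measurable_continuous_onI)

lemma u_measurable [measurable (raw)]:
  assumes [measurable]: "a \<in> borel_measurable M" "b \<in> borel_measurable M"
  shows "(\<lambda>z. u (a z) (b z)) \<in> borel_measurable M"
proof -
  have "(\<lambda>z. (a z, b z)) \<in> measurable M (borel \<Otimes>\<^sub>M borel)" by measurable
  then have "(\<lambda>z. (a z, b z)) \<in> measurable M borel" by (simp add: borel_prod)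
  from measurable_compose[OF this u_meas] show ?thesis by simp
qed

lemma u_bound: "c \<in> {lo..hi} \<Longrightarrow> \<bar>u x t - c\<bar> \<le> hi - lo"
  using u_range[of x t] by auto

lemma kflux_bound: "c \<in> {lo..hi} \<Longrightarrow> \<bar>kflux g (u x t) c\<bar> \<le> L * (hi - lo)"
  using kflux_le[OF g_Lip, of "u x t" c] mult_left_mono[OF u_bound[of c x t] L_nonneg] by linarith

text \<open>By the reverse triangle inequality the increments are at most
  \<open>\<bar>p\<bar>\<close> times the L1 distance of the two slices on an interval that contains
  the support of \<open>p\<close>.\<close>

lemma slice_continuous:
  assumes p: "continuous_on UNIV p" "\<And>x. x \<notin> {a..b} \<Longrightarrow> p x = 0" and c: "c \<in> {lo..hi}"
  shows "continuous_on {0..T} (\<lambda>t. LINT x|lborel. \<bar>u x t - c\<bar> * p x)"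
proof -
  have [measurable]: "p \<in> borel_measurable borel" using p(1) by (rule borel_measurable_continuous_onI)
  obtain C where C: "0 \<le> C" "\<And>x. \<bar>p x\<bar> \<le> C" using bounded_support_bound[OF p] by auto
  define R where "R = max \<bar>a\<bar> \<bar>b\<bar>"
  have R: "x \<in> {-R..R}" if "x \<in> {a..b}" for x using that by (auto simp: R_def)
  have D0: "0 \<le> hi - lo" using c by auto
  have intA: "integrable lborel (\<lambda>x. \<bar>u x t - c\<bar> * p x)" for t
    using c C u_bound[OF c] D0 p(2)
    by (intro integrable_bounded_support[of _ "(hi - lo) * C" a b])
       (auto simp: abs_mult intro!: mult_mono)
  have intU: "integrable lborel (\<lambda>x. C * (indicator {-R..R} x * \<bar>u x s - u x t\<bar>))" for s t
    using u_bound u_range C D0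
    by (intro integrable_mult_right integrable_bounded_support[of _ "hi - lo" "-R" R])
       (auto simp: indicator_def)
  show ?thesis unfolding continuous_on_def
  proof
    fix t assume t: "t \<in> {0..T}"
    have le: "\<bar>(LINT x|lborel. \<bar>u x s - c\<bar> * p x) - (LINT x|lborel. \<bar>u x t - c\<bar> * p x)\<bar>
       \<le> C * (LINT x:{-R..R}|lborel. \<bar>u x s - u x t\<bar>)" for s
    proof -
      have "\<bar>(LINT x|lborel. \<bar>u x s - c\<bar> * p x) - (LINT x|lborel. \<bar>u x t - c\<bar> * p x)\<bar>
         = \<bar>LINT x|lborel. (\<bar>u x s - c\<bar> - \<bar>u x t - c\<bar>) * p x\<bar>"
        using intA by (subst Bochner_Integration.integral_diff[symmetric]) (auto simp: algebra_simps)
      also have "\<dots> \<le> (LINT x|lborel. \<bar>(\<bar>u x s - c\<bar> - \<bar>u x t - c\<bar>) * p x\<bar>)"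
        by (rule integral_abs_bound)
      also have "\<dots> \<le> (LINT x|lborel. C * (indicator {-R..R} x * \<bar>u x s - u x t\<bar>))"
      proof (rule integral_mono[OF _ intU])
        show "integrable lborel (\<lambda>x. \<bar>(\<bar>u x s - c\<bar> - \<bar>u x t - c\<bar>) * p x\<bar>)"
          using Bochner_Integration.integrable_diff[OF intA[of s] intA[of t]] by (auto simp: algebra_simps)
        show "\<bar>(\<bar>u x s - c\<bar> - \<bar>u x t - c\<bar>) * p x\<bar> \<le> C * (indicator {-R..R} x * \<bar>u x s - u x t\<bar>)" for x
          using C(2)[of x] C(1) p(2)[of x] R[of x]
          by (cases "x \<in> {a..b}") (auto simp: abs_mult mult.commute[of C] intro!: mult_mono)
      qed
      finally show ?thesis by (simp add: set_lebesgue_integral_def)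
    qed
    have "((\<lambda>s. C * (LINT x:{-R..R}|lborel. \<bar>u x s - u x t\<bar>)) \<longlongrightarrow> 0) (at t within {0..T})"
      using tendsto_mult_left[OF u_cont[OF t, of R], of C] by simp
    then have "((\<lambda>s. (LINT x|lborel. \<bar>u x s - c\<bar> * p x) - (LINT x|lborel. \<bar>u x t - c\<bar> * p x)) \<longlongrightarrow> 0) (at t within {0..T})"
      by (rule tendsto_0_le[where K=1]) (use le in \<open>auto intro!: always_eventually order_trans[OF le]\<close>)
    then show "((\<lambda>s. LINT x|lborel. \<bar>u x s - c\<bar> * p x) \<longlongrightarrow> (LINT x|lborel. \<bar>u x t - c\<bar> * p x)) (at t within {0..T})"
      using LIM_zero_iff by blast
  qed
qed

text \<open>For a tensor product test function, Fubini turns the entropy inequality into a statement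
  about two functions of time alone. The condition \<open>0 < s\<close> keeps the test function zero
  at time 0.\<close>

lemma weak_product:
  assumes p: "smooth1 p" "\<And>x. 0 \<le> p x" "\<And>x. x \<notin> {a..b} \<Longrightarrow> p x = 0"
      "\<And>x. (p has_real_derivative p' x) (at x)" "continuous_on UNIV p'"
    and q: "smooth1 q" "\<And>x. 0 \<le> q x" "\<And>x. x \<notin> {s..t} \<Longrightarrow> q x = 0"
      "\<And>x. (q has_real_derivative q' x) (at x)" "continuous_on UNIV q'"
    and st: "0 < s" "t < T" and c: "c \<in> {lo..hi}"
  shows "0 \<le> (LINT \<tau>|lborel. (LINT x|lborel. \<bar>u x \<tau> - c\<bar> * p x) * q' \<tau>
                + (LINT x|lborel. kflux g (u x \<tau>) c * p' x) * q \<tau>)"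
proof -
  have [measurable]: "p \<in> borel_measurable borel" "p' \<in> borel_measurable borel"
      "q \<in> borel_measurable borel" "q' \<in> borel_measurable borel"
    using p q smooth1_continuous by (auto intro!: borel_measurable_continuous_onI)
  have p'0: "p' x = 0" if "x \<notin> {a..b}" for x using deriv_zero_outside[OF p(4,3) that] by simp
  have q'0: "q' x = 0" if "x \<notin> {s..t}" for x using deriv_zero_outside[OF q(4,3) that] by simp
  obtain P where P: "0 \<le> P" "\<And>x. \<bar>p x\<bar> \<le> P" using bounded_support_bound[OF smooth1_continuous[OF p(1)] p(3)] by auto
  obtain P' where P': "0 \<le> P'" "\<And>x. \<bar>p' x\<bar> \<le> P'" using bounded_support_bound[OF p(5) p'0] by auto
  obtain Q where Q: "0 \<le> Q" "\<And>x. \<bar>q x\<bar> \<le> Q" using bounded_support_bound[OF smooth1_continuous[OF q(1)] q(3)] by auto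
  obtain Q' where Q': "0 \<le> Q'" "\<And>x. \<bar>q' x\<bar> \<le> Q'" using bounded_support_bound[OF q(5) q'0] by auto
  have D0: "0 \<le> hi - lo" using c by auto
  have KB: "0 \<le> L * (hi - lo)" using D0 L_nonneg by simp
  have test: "test_function T (\<lambda>x t. p x * q t)"
    using test_function_product[OF p(1) q(1) p(2) q(2) p(3) q(3) st(2)] by simp
  have zero: "p x * q 0 = 0" for x using q(3)[of 0] st by simp
  have dq: "deriv (\<lambda>s. p x * q s) \<tau> = p x * q' \<tau>" for x \<tau>
    by (rule DERIV_imp_deriv) (auto intro!: derivative_eq_intros q)
  have dp: "deriv (\<lambda>y. p y * q \<tau>) x = p' x * q \<tau>" for x \<tau>
    by (rule DERIV_imp_deriv) (auto intro!: derivative_eq_intros p)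
  \<comment> \<open>Hence the integral over the strip equals one over the whole plane, with an
    integrand supported in a box.\<close>
  have vanish: "q \<tau> = 0 \<and> q' \<tau> = 0" if "\<not> (0 < \<tau> \<and> \<tau> < T)" for \<tau>
    using that st q(3)[of \<tau>] q'0[of \<tau>] by auto
  define F where "F x \<tau> = \<bar>u x \<tau> - c\<bar> * p x * q' \<tau> + kflux g (u x \<tau>) c * p' x * q \<tau>" for x \<tau>
  have [measurable]: "(\<lambda>(x, \<tau>). F x \<tau>) \<in> borel_measurable (lborel \<Otimes>\<^sub>M lborel)"
    unfolding F_def by measurable
  have "0 \<le> (LINT (x, t):UNIV \<times> {0<..<T}|lborel.
        \<bar>u x t - c\<bar> * (p x * q' t) + kflux g (u x t) c * (p' x * q t))"
    using weak[OF c test zero] by (simp add: dq dp)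
  also have "\<dots> = (LINT z|lborel. (case z of (x, \<tau>) \<Rightarrow> F x \<tau>))"
    unfolding set_lebesgue_integral_def F_def
  proof (intro Bochner_Integration.integral_cong refl)
    fix z :: "real \<times> real"
    obtain x \<tau> where z: "z = (x, \<tau>)" by (cases z)
    show "indicator (UNIV \<times> {0<..<T}) z *\<^sub>R (case z of (x, t) \<Rightarrow>
        \<bar>u x t - c\<bar> * (p x * q' t) + kflux g (u x t) c * (p' x * q t)) =
      (case z of (x, \<tau>) \<Rightarrow> \<bar>u x \<tau> - c\<bar> * p x * q' \<tau> + kflux g (u x \<tau>) c * p' x * q \<tau>)"
      using vanish[of \<tau>] by (cases "0 < \<tau> \<and> \<tau> < T") (auto simp: z indicator_def mult.assoc)
  qed
  also have "\<dots> = (LINT z|(lborel \<Otimes>\<^sub>M lborel). (case z of (x, \<tau>) \<Rightarrow> F x \<tau>))"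
    by (simp add: lborel_prod)
  also have "\<dots> = (LINT \<tau>|lborel. LINT x|lborel. F x \<tau>)"
  proof (rule lborel_pair.integral_snd[symmetric])
    have "integrable lborel (\<lambda>(x, \<tau>). F x \<tau>)"
    proof (rule integrable_bounded_support[of _ "(hi - lo) * P * Q' + (L * (hi - lo)) * P' * Q" "(a, s)" "(b, t)"])
      show "(\<lambda>(x, \<tau>). F x \<tau>) \<in> borel_measurable borel"
        using \<open>(\<lambda>(x, \<tau>). F x \<tau>) \<in> borel_measurable (lborel \<Otimes>\<^sub>M lborel)\<close> by (simp add: lborel_prod)
      show "\<bar>case z of (x, \<tau>) \<Rightarrow> F x \<tau>\<bar> \<le> (hi - lo) * P * Q' + L * (hi - lo) * P' * Q" for z
      proof (cases z)
        case (Pair x \<tau>)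
        have "\<bar>F x \<tau>\<bar> \<le> \<bar>u x \<tau> - c\<bar> * \<bar>p x\<bar> * \<bar>q' \<tau>\<bar> + \<bar>kflux g (u x \<tau>) c\<bar> * \<bar>p' x\<bar> * \<bar>q \<tau>\<bar>"
          unfolding F_def using abs_triangle_ineq[of "\<bar>u x \<tau> - c\<bar> * p x * q' \<tau>" "kflux g (u x \<tau>) c * p' x * q \<tau>"] by (simp add: abs_mult)
        also have "\<dots> \<le> (hi - lo) * P * Q' + L * (hi - lo) * P' * Q"
          by (intro add_mono mult_mono u_bound[OF c] kflux_bound[OF c] P P' Q Q' mult_nonneg_nonneg D0 KB) auto
        finally show ?thesis using Pair by simp
      qed
      show "(case z of (x, \<tau>) \<Rightarrow> F x \<tau>) = 0" if "z \<notin> cbox (a, s) (b, t)" for z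
      proof (cases z)
        case (Pair x \<tau>)
        then have "x \<notin> {a..b} \<or> \<tau> \<notin> {s..t}" using that by (auto simp: cbox_Pair_eq)
        then show ?thesis using p(3)[of x] p'0[of x] q(3)[of \<tau>] q'0[of \<tau>] by (auto simp: F_def Pair)
      qed
    qed
    then show "integrable (lborel \<Otimes>\<^sub>M lborel) (\<lambda>(x, \<tau>). F x \<tau>)" by (simp add: lborel_prod)
  qed
  also have "\<dots> = (LINT \<tau>|lborel. (LINT x|lborel. \<bar>u x \<tau> - c\<bar> * p x) * q' \<tau>
                + (LINT x|lborel. kflux g (u x \<tau>) c * p' x) * q \<tau>)"
  proof (intro Bochner_Integration.integral_cong refl)
    fix \<tau>
    have i1: "integrable lborel (\<lambda>x. \<bar>u x \<tau> - c\<bar> * p x)"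
      using P u_bound[OF c] D0 p(3)
      by (intro integrable_bounded_support[of _ "(hi - lo) * P" a b]) (auto simp: abs_mult intro!: mult_mono)
    have i2: "integrable lborel (\<lambda>x. kflux g (u x \<tau>) c * p' x)"
      using P' kflux_bound[OF c] KB p'0
      by (intro integrable_bounded_support[of _ "L * (hi - lo) * P'" a b]) (auto simp: abs_mult intro!: mult_mono)
    show "(LINT x|lborel. F x \<tau>) = (LINT x|lborel. \<bar>u x \<tau> - c\<bar> * p x) * q' \<tau>
                + (LINT x|lborel. kflux g (u x \<tau>) c * p' x) * q \<tau>"
      unfolding F_def using i1 i2
      by (subst Bochner_Integration.integral_add) (auto intro!: integrable_mult_left)
  qed
  finally show ?thesis .
qed

end

section \<open>Integration of the entropy inequality over a time interval\<close>

lemma integrable_indicator_interval: "integrable lborel (\<lambda>x::real. K * indicator {a..b} x :: real)"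
  by (rule integrable_bounded_support[of _ "\<bar>K\<bar>" a b]) (auto simp: indicator_def)

lemma mollifier_continuous: "mollifier e r \<Longrightarrow> continuous_on UNIV r"
  by (simp add: mollifier_def smooth1_continuous)

lemma mollifier_integral:
  assumes "mollifier e r"
  shows "integrable lborel r" "(LINT x|lborel. r (x - d)) = 1" "(LINT x|lborel. r (d - x)) = 1"
    "integrable lborel (\<lambda>x. r (x - d))" "integrable lborel (\<lambda>x. r (d - x))"
proof -
  have r: "\<And>x. x \<notin> {0..e} \<Longrightarrow> r x = 0" "(r has_integral 1) {0..e}"
    using assms unfolding mollifier_def by auto
  obtain C where C: "0 \<le> C" "\<And>x. \<bar>r x\<bar> \<le> C"
    using bounded_support_bound[OF mollifier_continuous[OF assms] r(1)] by auto
  show int: "integrable lborel r"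
    by (rule integrable_bounded_support[of _ C 0 e])
       (use C r mollifier_continuous[OF assms] in \<open>auto intro: borel_measurable_continuous_onI\<close>)
  have "(r has_integral 1) UNIV"
    by (rule has_integral_on_superset[OF r(2)]) (use r(1) in auto)
  then have one: "(LINT x|lborel. r x) = 1"
    using integral_lborel[OF int] integral_unique by metis
  show "(LINT x|lborel. r (x - d)) = 1" "integrable lborel (\<lambda>x. r (x - d))"
    using one lborel_integral_real_affine[of 1 r "-d"] lborel_integrable_real_affine[OF int, of 1 "-d"] by auto
  show "(LINT x|lborel. r (d - x)) = 1" "integrable lborel (\<lambda>x. r (d - x))"
    using one lborel_integral_real_affine[of "-1" r d] lborel_integrable_real_affine[OF int, of "-1" d] by auto
qed

context entropy_evolution
begin

lemma kflux_slice:
  assumes p': "continuous_on UNIV p'" "\<And>x. x \<notin> {a..b} \<Longrightarrow> p' x = 0" and c: "c \<in> {lo..hi}"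
  obtains K where "0 \<le> K" "\<And>t. \<bar>LINT x|lborel. kflux g (u x t) c * p' x\<bar> \<le> K"
    "(\<lambda>t. LINT x|lborel. kflux g (u x t) c * p' x) \<in> borel_measurable borel"
proof -
  have [measurable]: "p' \<in> borel_measurable borel" using p'(1) by (rule borel_measurable_continuous_onI)
  obtain C where C: "0 \<le> C" "\<And>x. \<bar>p' x\<bar> \<le> C" using bounded_support_bound[OF p'] by auto
  have D0: "0 \<le> L * (hi - lo)" using c L_nonneg by auto
  have "\<bar>LINT x|lborel. kflux g (u x t) c * p' x\<bar> \<le> (L * (hi - lo) * C) * (max a b - a)" for t
  proof (rule integral_bounded_support)
    show "kflux g (u x t) c * p' x = 0" if "x \<notin> {a..max a b}" for x using p'(2)[of x] that by (auto simp: max_def split: if_splits)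
  qed (use C kflux_bound[OF c] D0 in \<open>auto simp: abs_mult intro!: mult_mono\<close>)
  moreover have "(\<lambda>t. LINT x|lborel. kflux g (u x t) c * p' x) \<in> borel_measurable borel"
    by measurable
  ultimately show thesis using that[of "(L * (hi - lo) * C) * (max a b - a)"] C(1) D0 by auto
qed

text \<open>The test function in time is a smooth approximation of the indicator of
  \<open>{s..t}\<close>. Its derivative is a difference of two mollifiers, concentrated near
  \<open>s\<close> and near \<open>t\<close>, so continuity in time of the entropy integral yields
  the boundary terms in the limit.\<close>

lemma time_slice:
  assumes p: "smooth1 p" "\<And>x. 0 \<le> p x" "\<And>x. x \<notin> {a..b} \<Longrightarrow> p x = 0"
      "\<And>x. (p has_real_derivative p' x) (at x)" "continuous_on UNIV p'"
    and c: "c \<in> {lo..hi}" and st: "0 \<le> s" "s \<le> t" "t \<le> T"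
  shows "(LINT x|lborel. \<bar>u x t - c\<bar> * p x) \<le> (LINT x|lborel. \<bar>u x s - c\<bar> * p x)
      + (LINT \<tau>:{s..t}|lborel. LINT x|lborel. kflux g (u x \<tau>) c * p' x)"
proof (cases "s = t")
  case True
  have "AE \<tau> in lborel. indicator {t..t} \<tau> * (LINT x|lborel. kflux g (u x \<tau>) c * p' x) = 0"
    using AE_lborel_singleton[of t] by eventually_elim (auto simp: indicator_def)
  then have "(LINT \<tau>:{t..t}|lborel. LINT x|lborel. kflux g (u x \<tau>) c * p' x) = 0"
    unfolding set_lebesgue_integral_def by (simp add: integral_eq_zero_AE)
  then show ?thesis using True by simp
next
  case False
  then have "s < t" using st by simp
  define A where "A \<tau> = (LINT x|lborel. \<bar>u x \<tau> - c\<bar> * p x)" for \<tau>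
  define B where "B \<tau> = (LINT x|lborel. kflux g (u x \<tau>) c * p' x)" for \<tau>
  have p'0: "p' x = 0" if "x \<notin> {a..b}" for x using deriv_zero_outside[OF p(4,3) that] by simp
  have "\<exists>K\<ge>0. (\<forall>\<tau>. \<bar>B \<tau>\<bar> \<le> K) \<and> B \<in> borel_measurable borel"
    unfolding B_def[abs_def] by (rule kflux_slice[OF p(5) p'0 c], assumption) blast
  then obtain K where K: "0 \<le> K" "\<And>\<tau>. \<bar>B \<tau>\<bar> \<le> K" and Bm [measurable]: "B \<in> borel_measurable borel"
    by blast
  have [measurable]: "p \<in> borel_measurable borel"
    using smooth1_continuous[OF p(1)] by (rule borel_measurable_continuous_onI)
  have Am [measurable]: "A \<in> borel_measurable borel" unfolding A_def[abs_def] by measurable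
  have Acont: "continuous_on {0..T} A"
    unfolding A_def[abs_def] by (rule slice_continuous[OF smooth1_continuous[OF p(1)] p(3) c])
  have "A t \<le> A s + (LINT \<tau>:{s..t}|lborel. B \<tau>)"
  proof (rule field_le_epsilon)
    fix \<kappa> :: real assume "0 < \<kappa>"
    then have k3: "\<kappa>/3 > 0" by simp
    obtain d1 where d1: "d1 > 0" "\<And>\<tau>. \<tau> \<in> {0..T} \<Longrightarrow> \<bar>\<tau> - s\<bar> < d1 \<Longrightarrow> \<bar>A \<tau> - A s\<bar> < \<kappa>/3"
      using Acont st k3 unfolding continuous_on_iff dist_real_def by (metis atLeastAtMost_iff order_trans)
    obtain d2 where d2: "d2 > 0" "\<And>\<tau>. \<tau> \<in> {0..T} \<Longrightarrow> \<bar>\<tau> - t\<bar> < d2 \<Longrightarrow> \<bar>A \<tau> - A t\<bar> < \<kappa>/3"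
      using Acont st k3 unfolding continuous_on_iff dist_real_def by (metis atLeastAtMost_iff order_trans)
    \<comment> \<open>The ramps stay within \<open>2 * e\<close> of the end points, hence
      \<open>d1/3\<close> and \<open>d2/3\<close>; \<open>(t-s)/4\<close> separates the two ramps;
      the last entry bounds the flux lost on a set of length \<open>4 * e\<close> by
      \<open>\<kappa>/3\<close>, with \<open>K+1\<close> covering the case
      \<open>K = 0\<close>.\<close>
    define e where "e = Min {d1/3, d2/3, (t-s)/4, \<kappa>/(12*(K+1))}"
    have emin: "e \<le> y" if "y \<in> {d1/3, d2/3, (t-s)/4, \<kappa>/(12*(K+1))}" for y
      unfolding e_def by (rule Min_le) (use that in auto)
    have "0 < e" unfolding e_def using d1(1) d2(1) \<open>s < t\<close> \<open>0 < \<kappa>\<close> K(1) by simp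
    then have e: "0 < e" "e \<le> d1/3" "e \<le> d2/3" "e \<le> (t-s)/4" "e \<le> \<kappa>/(12*(K+1))"
      by (blast intro: emin)+
    have eK: "4 * e * K \<le> \<kappa>/3"
    proof -
      have "e * K \<le> e * (K+1)" using e(1) by simp
      also have "\<dots> \<le> \<kappa>/12" using e(5) K(1) by (simp add: field_simps)
      finally show ?thesis by simp
    qed
    obtain r where r: "mollifier e r" using mollifier_exists[OF e(1)] .
    have rD: "smooth1 r" "\<And>x. 0 \<le> r x" "\<And>x. x \<notin> {0..e} \<Longrightarrow> r x = 0"
      using r unfolding mollifier_def by auto
    obtain S where S: "smooth1 S" "\<And>x. (S has_real_derivative r x) (at x)" "mono S"
      "\<And>x. x \<le> 0 \<Longrightarrow> S x = 0" "\<And>x. e \<le> x \<Longrightarrow> S x = 1"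
      using smooth_step[OF r e(1)] by metis
    have S01: "0 \<le> S x \<and> S x \<le> 1" for x
      using monoD[OF S(3), of 0 x] monoD[OF S(3), of x e] S(4)[of x] S(5)[of x] S(4)[of 0] S(5)[of e]
      by (cases "x \<le> 0"; cases "e \<le> x") auto
    \<comment> \<open>It rises on \<open>{s+e..s+2*e}\<close> and falls on
      \<open>{t-2*e..t-e}\<close>. The inset by \<open>e\<close> keeps the support inside the open
      interval from 0 to \<open>T\<close>, even if \<open>s = 0\<close> or
      \<open>t = T\<close>.\<close>
    define q where "q \<tau> = S (\<tau> - (s+e)) - S (\<tau> - (t-2*e))" for \<tau>
    define q' where "q' \<tau> = r (\<tau> - (s+e)) - r (\<tau> - (t-2*e))" for \<tau>
    have shift: "((\<lambda>\<tau>. S (\<tau> - d)) has_real_derivative r (\<tau> - d)) (at \<tau>)" for \<tau> d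
      using S(2)[of "\<tau> - d"] DERIV_shift[of S "r (\<tau> - d)" \<tau> "- d"] by simp
    have q1: "(q has_real_derivative q' \<tau>) (at \<tau>)" for \<tau>
      unfolding q_def[abs_def] q'_def by (intro DERIV_diff shift)
    have q2: "smooth1 q" unfolding q_def[abs_def] by (intro smooth1_diff smooth1_shift S(1))
    have rcont: "continuous_on UNIV r" by (rule smooth1_continuous[OF rD(1)])
    have q'c: "continuous_on UNIV q'" unfolding q'_def[abs_def]
      by (intro continuous_intros continuous_on_compose2[OF rcont]) auto
    have q0: "0 \<le> q \<tau>" "q \<tau> \<le> 1" for \<tau>
      using monoD[OF S(3), of "\<tau> - (t-2*e)" "\<tau> - (s+e)"] e(1,4) S01[of "\<tau> - (s+e)"] S01[of "\<tau> - (t-2*e)"] unfolding q_def by auto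
    have qz: "q \<tau> = 0" if "\<tau> \<notin> {s+e..t-e}" for \<tau>
      using that S(4)[of "\<tau> - (s+e)"] S(4)[of "\<tau> - (t-2*e)"] S(5)[of "\<tau> - (s+e)"] S(5)[of "\<tau> - (t-2*e)"] e(1,4)
      unfolding q_def by (cases "\<tau> < s + e") auto
    have q1': "q \<tau> = 1" if "\<tau> \<in> {s+2*e..t-2*e}" for \<tau>
      using that S(5)[of "\<tau> - (s+e)"] S(4)[of "\<tau> - (t-2*e)"] unfolding q_def by auto
    have [measurable]: "r \<in> borel_measurable borel" "q \<in> borel_measurable borel" "q' \<in> borel_measurable borel"
      using rcont q'c smooth1_continuous[OF q2] by (auto intro!: borel_measurable_continuous_onI)
    have weak: "0 \<le> (LINT \<tau>|lborel. A \<tau> * q' \<tau> + B \<tau> * q \<tau>)"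
      unfolding A_def B_def
      by (rule weak_product[OF p q2 q0(1) qz q1 q'c _ _ c]) (use st e(1) in auto)
    obtain R where R: "0 \<le> R" "\<And>x. \<bar>r x\<bar> \<le> R" using bounded_support_bound[OF rcont rD(3)] by auto
    \<comment> \<open>The shifted mollifier is a weight of mass one on \<open>{d..d+e}\<close>, so
      the average of \<open>A\<close> is as close to \<open>m\<close> as the values of
      \<open>A\<close> there.\<close>
    have Ar: "integrable lborel (\<lambda>\<tau>. A \<tau> * r (\<tau> - d))"
      and Ar1: "(\<And>\<tau>. \<tau> \<in> {d..d+e} \<Longrightarrow> \<bar>A \<tau> - m\<bar> \<le> \<kappa>/3) \<Longrightarrow> \<bar>(LINT \<tau>|lborel. A \<tau> * r (\<tau> - d)) - m\<bar> \<le> \<kappa>/3"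
      if "0 \<le> d" "d + e \<le> T" for d m
    proof -
      have "bounded (A ` {0..T})"
        using Acont compact_continuous_image[of "{0..T}" A] compact_imp_bounded by blast
      then obtain N where N: "N > 0" "\<And>x. x \<in> {0..T} \<Longrightarrow> \<bar>A x\<bar> \<le> N"
        unfolding bounded_pos by auto
      show i: "integrable lborel (\<lambda>\<tau>. A \<tau> * r (\<tau> - d))"
      proof (rule integrable_bounded_support[of _ "N * R" d "d+e"])
        show "\<bar>A \<tau> * r (\<tau> - d)\<bar> \<le> N * R" for \<tau>
        proof (cases "\<tau> \<in> {d..d+e}")
          case True
          then show ?thesis using N(2)[of \<tau>] R(2)[of "\<tau> - d"] N(1) that
            unfolding abs_mult by (intro mult_mono) auto
        next
          case False
          then have "r (\<tau> - d) = 0" by (intro rD(3)) auto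
          then show ?thesis using N(1) R(1) by simp
        qed
      qed (use rD(3) in \<open>auto simp: algebra_simps\<close>)
      assume m: "\<And>\<tau>. \<tau> \<in> {d..d+e} \<Longrightarrow> \<bar>A \<tau> - m\<bar> \<le> \<kappa>/3"
      have "(LINT \<tau>|lborel. A \<tau> * r (\<tau> - d)) - m = (LINT \<tau>|lborel. A \<tau> * r (\<tau> - d) - m * r (\<tau> - d))"
        using i mollifier_integral[OF r] by (subst Bochner_Integration.integral_diff) auto
      also have "\<bar>\<dots>\<bar> \<le> (LINT \<tau>|lborel. \<bar>A \<tau> * r (\<tau> - d) - m * r (\<tau> - d)\<bar>)"
        by (rule integral_abs_bound)
      also have "\<dots> \<le> (LINT \<tau>|lborel. \<kappa>/3 * r (\<tau> - d))"
      proof (intro integral_mono)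
        show "\<bar>A \<tau> * r (\<tau> - d) - m * r (\<tau> - d)\<bar> \<le> \<kappa>/3 * r (\<tau> - d)" for \<tau>
        proof (cases "\<tau> \<in> {d..d+e}")
          case True
          have "\<bar>A \<tau> * r (\<tau> - d) - m * r (\<tau> - d)\<bar> = \<bar>A \<tau> - m\<bar> * r (\<tau> - d)"
            by (simp add: left_diff_distrib[symmetric] abs_mult rD(2))
          also have "\<dots> \<le> \<kappa>/3 * r (\<tau> - d)" by (rule mult_right_mono[OF m[OF True] rD(2)])
          finally show ?thesis .
        next
          case False
          then have "r (\<tau> - d) = 0" by (intro rD(3)) auto
          then show ?thesis by simp
        qed
      qed (use i mollifier_integral[OF r] in auto)
      also have "\<dots> = \<kappa>/3" using mollifier_integral[OF r] by simp
      finally show "\<bar>(LINT \<tau>|lborel. A \<tau> * r (\<tau> - d)) - m\<bar> \<le> \<kappa>/3" .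
    qed
    have ds: "0 \<le> s+e" "s+e+e \<le> T" and dt: "0 \<le> t-2*e" "t-2*e+e \<le> T" using st e by auto
    have L1: "(LINT \<tau>|lborel. A \<tau> * r (\<tau> - (s+e))) \<le> A s + \<kappa>/3"
    proof -
      have "\<bar>A \<tau> - A s\<bar> \<le> \<kappa>/3" if "\<tau> \<in> {s+e..s+e+e}" for \<tau>
        using d1(2)[of \<tau>] that e st by auto
      from Ar1[OF ds this] show ?thesis by linarith
    qed
    have L2: "A t - \<kappa>/3 \<le> (LINT \<tau>|lborel. A \<tau> * r (\<tau> - (t-2*e)))"
    proof -
      have "\<bar>A \<tau> - A t\<bar> \<le> \<kappa>/3" if "\<tau> \<in> {t-2*e..t-2*e+e}" for \<tau>
        using d2(2)[of \<tau>] that e st by auto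
      from Ar1[OF dt this] show ?thesis by linarith
    qed
    have Bq: "integrable lborel (\<lambda>\<tau>. B \<tau> * q \<tau>)"
    proof (rule integrable_bounded_support[of _ K s t])
      show "\<bar>B \<tau> * q \<tau>\<bar> \<le> K" for \<tau>
        using mult_mono[OF K(2)[of \<tau>] q0(2)[of \<tau>]] q0(1)[of \<tau>] K(1) by (simp add: abs_mult)
    qed (use qz e in auto)
    have Bi: "integrable lborel (\<lambda>\<tau>. indicator {s..t} \<tau> * B \<tau>)"
      by (rule integrable_bounded_support[of _ K s t]) (use K in \<open>auto simp: indicator_def\<close>)
    have L3: "(LINT \<tau>|lborel. B \<tau> * q \<tau>) \<le> (LINT \<tau>:{s..t}|lborel. B \<tau>) + 4 * e * K"
    proof -
      have "(LINT \<tau>|lborel. B \<tau> * q \<tau>) \<le> (LINT \<tau>|lborel. indicator {s..t} \<tau> * B \<tau> + K * indicator {s..s+2*e} \<tau> + K * indicator {t-2*e..t} \<tau>)"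
      proof (rule integral_mono[OF Bq])
        show "integrable lborel (\<lambda>\<tau>. indicator {s..t} \<tau> * B \<tau> + K * indicator {s..s+2*e} \<tau> + K * indicator {t-2*e..t} \<tau>)"
          by (intro Bochner_Integration.integrable_add Bi integrable_indicator_interval)
        fix \<tau>
        show "B \<tau> * q \<tau> \<le> indicator {s..t} \<tau> * B \<tau> + K * indicator {s..s+2*e} \<tau> + K * indicator {t-2*e..t} \<tau>"
        proof (cases "\<tau> \<in> {s..s+2*e} \<union> {t-2*e..t}")
          case True
          have "B \<tau> * (q \<tau> - 1) \<le> \<bar>B \<tau>\<bar> * \<bar>q \<tau> - 1\<bar>" by (metis abs_ge_self abs_mult)
          also have "\<dots> \<le> K * 1" using K q0[of \<tau>] by (intro mult_mono) auto
          finally have "B \<tau> * q \<tau> \<le> B \<tau> + K" by (simp add: algebra_simps)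
          then show ?thesis using True K(1) e \<open>s < t\<close> by (auto simp: indicator_def)
        next
          case False
          then show ?thesis using K(1) q1'[of \<tau>] qz[of \<tau>] e(1) by (auto simp: indicator_def)
        qed
      qed
      also have "\<dots> = (LINT \<tau>:{s..t}|lborel. B \<tau>) + K * (2*e) + K * (2*e)"
        unfolding set_lebesgue_integral_def using Bi e(1)
        by (subst Bochner_Integration.integral_add; (subst Bochner_Integration.integral_add)?) auto
      finally show ?thesis by (simp add: algebra_simps)
    qed
    have "(LINT \<tau>|lborel. A \<tau> * q' \<tau> + B \<tau> * q \<tau>) = (LINT \<tau>|lborel. A \<tau> * q' \<tau>) + (LINT \<tau>|lborel. B \<tau> * q \<tau>)"
      using Ar[OF ds] Ar[OF dt] Bq by (intro Bochner_Integration.integral_add) (auto simp: q'_def algebra_simps)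
    also have "(LINT \<tau>|lborel. A \<tau> * q' \<tau>) = (LINT \<tau>|lborel. A \<tau> * r (\<tau> - (s+e))) - (LINT \<tau>|lborel. A \<tau> * r (\<tau> - (t-2*e)))"
      unfolding q'_def right_diff_distrib by (intro Bochner_Integration.integral_diff Ar ds dt)
    finally show "A t \<le> A s + (LINT \<tau>:{s..t}|lborel. B \<tau>) + \<kappa>"
      using weak L1 L2 L3 eK by linarith
  qed
  then show ?thesis unfolding A_def B_def .
qed

end

section \<open>The Lax--Friedrichs scheme\<close>

text \<open>This is the updated value computed from the left and right neighbours, not a numerical
  flux. The parameter \<open>lam\<close> is the ratio of the time step to \<open>h\<close>.\<close>

definition lxf_flux :: "real \<Rightarrow> (real \<Rightarrow> real) \<Rightarrow> real \<Rightarrow> real \<Rightarrow> real" where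
  "lxf_flux lam g a b = (a + b) / 2 - lam / 2 * (g b - g a)"

text \<open>Acting on functions on the line rather than on grid values, the step commutes with
  translations and needs no projection of the datum. A level on the points
  \<open>x + 2 * h * j\<close> is computed from the interlaced points shifted by
  \<open>h\<close>.\<close>

definition lxf_step :: "real \<Rightarrow> real \<Rightarrow> (real \<Rightarrow> real) \<Rightarrow> (real \<Rightarrow> real) \<Rightarrow> (real \<Rightarrow> real)" where
  "lxf_step lam h g v x = lxf_flux lam g (v (x - h)) (v (x + h))"

definition lxf :: "real \<Rightarrow> real \<Rightarrow> (real \<Rightarrow> real) \<Rightarrow> (real \<Rightarrow> real) \<Rightarrow> nat \<Rightarrow> (real \<Rightarrow> real)" where
  "lxf lam h g v n = (lxf_step lam h g ^^ n) v"

lemma lxf_0 [simp]: "lxf lam h g v 0 = v"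
  by (simp add: lxf_def)

lemma lxf_Suc [simp]: "lxf lam h g v (Suc n) x = lxf_flux lam g (lxf lam h g v n (x - h)) (lxf lam h g v n (x + h))"
  by (simp add: lxf_def lxf_step_def)

lemma lxf_flux_const [simp]: "lxf_flux lam g c c = c"
  by (simp add: lxf_flux_def)

locale cfl =
  fixes lam L :: real and g :: "real \<Rightarrow> real"
  assumes lam_pos: "0 < lam" and CFL: "lam * L \<le> 1" and g_Lip: "L-lipschitz_on UNIV g"
begin

lemma lam_g: "lam * \<bar>g a - g b\<bar> \<le> \<bar>a - b\<bar>"
proof -
  have "\<bar>g a - g b\<bar> \<le> L * \<bar>a - b\<bar>"
    using lipschitz_onD[OF g_Lip, of a b] by (simp add: dist_real_def)
  then have "lam * \<bar>g a - g b\<bar> \<le> lam * L * \<bar>a - b\<bar>" using lam_pos by simp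
  also have "\<dots> \<le> 1 * \<bar>a - b\<bar>" by (intro mult_right_mono CFL) auto
  finally show ?thesis by simp
qed

text \<open>The CFL condition makes the maps \<open>x + lam * g x\<close> and
  \<open>x - lam * g x\<close> nondecreasing, so each difference has the sign of
  \<open>a - b\<close>.\<close>

lemma abs_plus_lam: "\<bar>(a - b) + lam * (g a - g b)\<bar> = \<bar>a - b\<bar> + lam * kflux g a b"
  and abs_minus_lam: "\<bar>(a - b) - lam * (g a - g b)\<bar> = \<bar>a - b\<bar> - lam * kflux g a b"
proof -
  have *: "\<bar>lam * (g a - g b)\<bar> \<le> \<bar>a - b\<bar>" using lam_g[of a b] lam_pos by (simp add: abs_mult)
  show "\<bar>(a - b) + lam * (g a - g b)\<bar> = \<bar>a - b\<bar> + lam * kflux g a b"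
    "\<bar>(a - b) - lam * (g a - g b)\<bar> = \<bar>a - b\<bar> - lam * kflux g a b"
    using * by (cases a b rule: linorder_cases; simp add: kflux_def abs_if algebra_simps split: if_splits)+
qed

lemma lam_kflux: "\<bar>lam * kflux g a b\<bar> \<le> \<bar>a - b\<bar>"
  using abs_plus_lam[of a b] abs_minus_lam[of a b] by linarith

text \<open>The update is the sum of a nondecreasing function of \<open>a\<close> and one of
  \<open>b\<close>, and \<open>abs_plus_lam\<close> and \<open>abs_minus_lam\<close> evaluate each
  increment exactly. If one pair of states is constant, this is the discrete entropy inequality;
  integrated or summed, it gives contraction in L1 and the variation bound.\<close>

lemma lxf_flux_contract:
  "\<bar>lxf_flux lam g a b - lxf_flux lam g a' b'\<bar>
    \<le> (\<bar>a - a'\<bar> + lam * kflux g a a') / 2 + (\<bar>b - b'\<bar> - lam * kflux g b b') / 2"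
proof -
  have "lxf_flux lam g a b - lxf_flux lam g a' b'
      = ((a - a') + lam * (g a - g a')) / 2 + ((b - b') - lam * (g b - g b')) / 2"
    by (simp add: lxf_flux_def field_simps)
  moreover have "\<bar>x / 2 + y / 2\<bar> \<le> p / 2 + q / 2" if "\<bar>x\<bar> = p" "\<bar>y\<bar> = q" for x y p q :: real
    using that by (auto simp: abs_if split: if_splits)
  ultimately show ?thesis using abs_plus_lam[of a a'] abs_minus_lam[of b b'] by metis
qed

lemma lxf_flux_range:
  assumes "a \<in> {lo..hi}" "b \<in> {lo..hi}"
  shows "lxf_flux lam g a b \<in> {lo..hi}"
proof -
  define d where "d = lam * (g b - g a)"
  have "\<bar>d\<bar> \<le> \<bar>b - a\<bar>" using lam_g[of b a] lam_pos by (simp add: abs_mult d_def)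
  moreover have "lxf_flux lam g a b = (a + b) / 2 - d / 2" by (simp add: lxf_flux_def d_def)
  moreover have "lo \<le> (a + b) / 2 - d / 2" "(a + b) / 2 - d / 2 \<le> hi"
    using assms \<open>\<bar>d\<bar> \<le> \<bar>b - a\<bar>\<close> unfolding atLeastAtMost_iff
      by (simp_all add: field_simps) linarith+
  ultimately show ?thesis by simp
qed

abbreviation "V h v n \<equiv> lxf lam h g v n"

lemma lxf_range: "(\<And>x. v x \<in> {lo..hi}) \<Longrightarrow> V h v n x \<in> {lo..hi}"
  by (induction n arbitrary: x) (simp_all only: lxf_0 lxf_Suc lxf_flux_range)

lemma g_measurable [measurable]: "g \<in> borel_measurable borel"
  using lipschitz_on_continuous_on[OF g_Lip] by (rule borel_measurable_continuous_onI)

lemma lxf_measurable [measurable]: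
  assumes [measurable]: "v \<in> borel_measurable borel"
  shows "V h v n \<in> borel_measurable borel"
proof (induction n)
  case (Suc n)
  note [measurable] = Suc
  have "(\<lambda>x. lxf_flux lam g (V h v n (x - h)) (V h v n (x + h))) \<in> borel_measurable borel"
    unfolding lxf_flux_def by measurable
  then show ?case by (simp add: lxf_Suc[abs_def] cong: measurable_cong)
qed simp

lemma lxf_far:
  assumes "\<And>x. x < -X \<Longrightarrow> v x = uL" "\<And>x. X \<le> x \<Longrightarrow> v x = uR" "0 < h"
  shows "x < - X - n * h \<Longrightarrow> V h v n x = uL" "X + n * h \<le> x \<Longrightarrow> V h v n x = uR"
proof (induction n arbitrary: x)
  case (Suc n)
  {
    case 1 then show ?case using Suc(1)[of "x - h"] Suc(1)[of "x + h"] assms(3) by (simp add: algebra_simps)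
  next
    case 2 then show ?case using Suc(2)[of "x - h"] Suc(2)[of "x + h"] assms(3) by (simp add: algebra_simps)
  }
qed (use assms in auto)

text \<open>In the sum of the bounds from \<open>lxf_flux_contract\<close> the flux parts
  \<open>r j\<close> of neighbouring terms cancel, and the two end terms left over have a favourable
  sign because \<open>\<bar>r j\<bar> \<le> a j\<close>. The bound is assumed for every origin
  \<open>x0\<close> since each step moves the grid by \<open>h\<close>.\<close>

lemma lxf_grid_TV:
  assumes "\<And>x0 K. (\<Sum>j<K. \<bar>v (x0 + 2 * h * real (Suc j)) - v (x0 + 2 * h * real j)\<bar>) \<le> B"
  shows "(\<Sum>j<K. \<bar>V h v n (x0 + 2 * h * real (Suc j)) - V h v n (x0 + 2 * h * real j)\<bar>) \<le> B"
proof (induction n arbitrary: x0 K)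
  case 0 then show ?case using assms by simp
next
  case (Suc n)
  define w where "w j = V h v n (x0 - h + 2 * h * real j)" for j
  define a where "a j = \<bar>w (Suc j) - w j\<bar>" for j
  define r where "r j = lam * kflux g (w (Suc j)) (w j)" for j
  have ra: "\<bar>r j\<bar> \<le> a j" for j unfolding r_def a_def by (rule lam_kflux)
  have step: "\<bar>V h v (Suc n) (x0 + 2 * h * real (Suc j)) - V h v (Suc n) (x0 + 2 * h * real j)\<bar>
     \<le> (a j + r j) / 2 + (a (Suc j) - r (Suc j)) / 2" for j
  proof -
    have eq: "V h v (Suc n) (x0 + 2 * h * real i) = lxf_flux lam g (w i) (w (Suc i))" for i
      unfolding w_def by (simp add: algebra_simps)
    show ?thesis unfolding eq a_def r_def by (rule lxf_flux_contract)
  qed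
  have tele: "(\<Sum>j<K. (a j + r j) / 2 + (a (Suc j) - r (Suc j)) / 2) = (\<Sum>j<Suc K. a j) - (a 0 - r 0) / 2 - (a K + r K) / 2"
    by (induction K) (auto simp: field_simps)
  have "(\<Sum>j<K. \<bar>V h v (Suc n) (x0 + 2 * h * real (Suc j)) - V h v (Suc n) (x0 + 2 * h * real j)\<bar>)
     \<le> (\<Sum>j<K. (a j + r j) / 2 + (a (Suc j) - r (Suc j)) / 2)" by (intro sum_mono step)
  also have "\<dots> \<le> (\<Sum>j<Suc K. a j)" unfolding tele using ra[of 0] ra[of K] by (simp add: field_simps)
  also have "\<dots> \<le> B" unfolding a_def w_def by (rule Suc)
  finally show ?case .
qed

lemma lxf_translate: "lxf lam h g (\<lambda>x. v (x + z)) n x = V h v n (x + z)"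
  by (induction n arbitrary: x) (auto simp: algebra_simps)

text \<open>The contribution \<open>P\<close> arrives from the left neighbour and \<open>Q\<close>
  from the right one. Translation invariance of the integral removes both shifts, and
  \<open>P + Q\<close> is the old difference.\<close>

lemma lxf_L1_contract:
  assumes [measurable]: "v \<in> borel_measurable borel" "v' \<in> borel_measurable borel"
  shows "(\<integral>\<^sup>+x. ennreal \<bar>V h v n x - V h v' n x\<bar> \<partial>lborel) \<le> (\<integral>\<^sup>+x. ennreal \<bar>v x - v' x\<bar> \<partial>lborel)"
proof (induction n)
  case (Suc n)
  define a where "a = V h v n"
  define b where "b = V h v' n"
  have [measurable]: "a \<in> borel_measurable borel" "b \<in> borel_measurable borel"
    unfolding a_def b_def by (auto intro: lxf_measurable assms)
  define P where "P x = (\<bar>a x - b x\<bar> + lam * kflux g (a x) (b x)) / 2" for x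
  define Q where "Q x = (\<bar>a x - b x\<bar> - lam * kflux g (a x) (b x)) / 2" for x
  have [measurable]: "P \<in> borel_measurable borel" "Q \<in> borel_measurable borel"
    unfolding P_def[abs_def] Q_def[abs_def] by measurable
  have P0: "0 \<le> P x" and Q0: "0 \<le> Q x" for x using lam_kflux[of "a x" "b x"] by (auto simp: P_def Q_def abs_le_iff)
  have "(\<integral>\<^sup>+x. ennreal \<bar>V h v (Suc n) x - V h v' (Suc n) x\<bar> \<partial>lborel)
     \<le> (\<integral>\<^sup>+x. ennreal (P (x - h)) + ennreal (Q (x + h)) \<partial>lborel)"
  proof (intro nn_integral_mono)
    fix x
    show "ennreal \<bar>V h v (Suc n) x - V h v' (Suc n) x\<bar> \<le> ennreal (P (x - h)) + ennreal (Q (x + h))"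
      using lxf_flux_contract[of "a (x-h)" "a (x+h)" "b (x-h)" "b (x+h)"] P0 Q0
      by (simp add: ennreal_plus[symmetric] P_def Q_def a_def b_def del: ennreal_plus)
  qed
  also have "\<dots> = (\<integral>\<^sup>+x. ennreal (P (x - h)) \<partial>lborel) + (\<integral>\<^sup>+x. ennreal (Q (x + h)) \<partial>lborel)"
    by (intro nn_integral_add) auto
  also have "\<dots> = (\<integral>\<^sup>+x. ennreal (P x) \<partial>lborel) + (\<integral>\<^sup>+x. ennreal (Q x) \<partial>lborel)"
    using nn_integral_real_affine[of "\<lambda>x. ennreal (P x)" 1 "-h"] nn_integral_real_affine[of "\<lambda>x. ennreal (Q x)" 1 h]
    by (simp add: add.commute)
  also have "\<dots> = (\<integral>\<^sup>+x. ennreal (P x) + ennreal (Q x) \<partial>lborel)"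
    by (intro nn_integral_add[symmetric]) auto
  also have "\<dots> = (\<integral>\<^sup>+x. ennreal \<bar>a x - b x\<bar> \<partial>lborel)"
    using P0 Q0 by (intro nn_integral_cong) (simp add: ennreal_plus[symmetric] P_def Q_def field_simps del: ennreal_plus)
  finally show ?case using Suc unfolding a_def b_def by simp
qed simp

end

section \<open>Convergence of the scheme to the entropy solution\<close>

text \<open>The two remainders correspond to the averaging and to the centred flux difference of the
  scheme. Being quadratic in \<open>h\<close>, they remain small after a number of steps of order
  \<open>1/h\<close>.\<close>

lemma mollifier_Taylor:
  assumes "mollifier e r"
  obtains r' B1 B2 where "\<And>x. (r has_real_derivative r' x) (at x)" "continuous_on UNIV r'"
    "0 \<le> B1" "\<And>x. \<bar>r' x\<bar> \<le> B1" "0 \<le> B2"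
    "\<And>z h. \<bar>(r (z - h) + r (z + h)) / 2 - r z\<bar> \<le> B2 * h\<^sup>2"
    "\<And>z h. \<bar>(r (z + h) - r (z - h)) / 2 - h * r' z\<bar> \<le> B2 * h\<^sup>2"
proof -
  have r: "smooth1 r" "\<And>x. x \<notin> {0..e} \<Longrightarrow> r x = 0" using assms unfolding mollifier_def by auto
  obtain r' where r': "smooth1 r'" "\<And>x. (r has_real_derivative r' x) (at x)"
    using smooth1_deriv[OF r(1)] by blast
  obtain r'' where r'': "smooth1 r''" "\<And>x. (r' has_real_derivative r'' x) (at x)"
    using smooth1_deriv[OF r'(1)] by blast
  have r'0: "r' x = 0" if "x \<notin> {0..e}" for x using deriv_zero_outside[OF r'(2) r(2) that] .
  have r''0: "r'' x = 0" if "x \<notin> {0..e}" for x using deriv_zero_outside[OF r''(2) r'0 that] .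
  obtain B1 where B1: "0 \<le> B1" "\<And>x. \<bar>r' x\<bar> \<le> B1"
    using bounded_support_bound[OF smooth1_continuous[OF r'(1)] r'0] by auto
  obtain B2 where B2: "0 \<le> B2" "\<And>x. \<bar>r'' x\<bar> \<le> B2"
    using bounded_support_bound[OF smooth1_continuous[OF r''(1)] r''0] by auto
  have lip: "\<bar>r' x - r' y\<bar> \<le> B2 * \<bar>x - y\<bar>" for x y
    using field_differentiable_bound[of UNIV r' r'' B2 x y] r''(2) B2 by (auto simp: has_field_derivative_at_within)
  have T: "\<bar>r (z + h) - r z - h * r' z\<bar> \<le> B2 * h\<^sup>2" for z h
  proof -
    obtain \<xi> where \<xi>: "\<bar>\<xi> - z\<bar> \<le> \<bar>h\<bar>" "r (z + h) - r z = h * r' \<xi>"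
    proof (cases h "0::real" rule: linorder_cases)
      case less
      then obtain \<xi> where "z + h < \<xi>" "\<xi> < z" "r z - r (z + h) = (z - (z + h)) * r' \<xi>"
        using MVT2[of "z + h" z r r'] r'(2) by auto
      then show thesis using that[of \<xi>] by (auto simp: algebra_simps)
    next
      case greater
      then obtain \<xi> where "z < \<xi>" "\<xi> < z + h" "r (z + h) - r z = (z + h - z) * r' \<xi>"
        using MVT2[of z "z + h" r r'] r'(2) by auto
      then show thesis using that[of \<xi>] by auto
    qed (use that[of z] in auto)
    have "\<bar>r (z + h) - r z - h * r' z\<bar> = \<bar>h\<bar> * \<bar>r' \<xi> - r' z\<bar>"
      by (simp add: \<xi>(2) right_diff_distrib[symmetric] abs_mult)
    also have "\<dots> \<le> \<bar>h\<bar> * (B2 * \<bar>\<xi> - z\<bar>)" by (intro mult_left_mono lip) auto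
    also have "\<dots> \<le> \<bar>h\<bar> * (B2 * \<bar>h\<bar>)" by (intro mult_left_mono \<xi> B2) auto
    also have "\<dots> = B2 * h\<^sup>2" by (simp add: power2_eq_square algebra_simps)
    finally show ?thesis .
  qed
  have "\<bar>(r (z - h) + r (z + h)) / 2 - r z\<bar> \<le> B2 * h\<^sup>2"
    "\<bar>(r (z + h) - r (z - h)) / 2 - h * r' z\<bar> \<le> B2 * h\<^sup>2" for z h
  proof -
    have m: "\<bar>r (z - h) - r z + h * r' z\<bar> \<le> B2 * h\<^sup>2" using T[of z "-h"] by simp
    have eqs: "(r (z - h) + r (z + h)) / 2 - r z = (r (z - h) - r z + h * r' z) / 2 + (r (z + h) - r z - h * r' z) / 2"
      "(r (z + h) - r (z - h)) / 2 - h * r' z = (r (z + h) - r z - h * r' z) / 2 - (r (z - h) - r z + h * r' z) / 2"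
      by (simp_all add: field_simps)
    have avg: "\<bar>x / 2 + y / 2\<bar> \<le> B \<and> \<bar>y / 2 - x / 2\<bar> \<le> B" if "\<bar>x\<bar> \<le> B" "\<bar>y\<bar> \<le> B" for x y B :: real
      using that by linarith
    show "\<bar>(r (z - h) + r (z + h)) / 2 - r z\<bar> \<le> B2 * h\<^sup>2"
      "\<bar>(r (z + h) - r (z - h)) / 2 - h * r' z\<bar> \<le> B2 * h\<^sup>2"
      unfolding eqs using avg[OF m T[of z h]] by blast+
  qed
  then show thesis using that[OF r'(2) smooth1_continuous[OF r'(1)] B1 B2(1)] by blast
qed

lemma integrable_bounded_interval:
  fixes f :: "real \<Rightarrow> real"
  assumes "f \<in> borel_measurable borel" "\<And>x. \<bar>f x\<bar> \<le> C"
  shows "integrable lborel (\<lambda>x. indicator {a..b} x * f x)"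
proof (rule integrable_bounded_support[of _ C a b])
  show "\<bar>indicator {a..b} x * f x\<bar> \<le> C" for x
    using assms(2)[of x] by (auto simp: indicator_def)
qed (use assms in auto)

locale scheme_solution = entropy_evolution lo hi T L g u + cfl: cfl lam L g
  for lo hi T L g u lam +
  fixes e :: real and r r' :: "real \<Rightarrow> real" and B1 B2 :: real
  assumes e: "0 < e" and moll: "mollifier e r"
    and r': "\<And>x. (r has_real_derivative r' x) (at x)" "continuous_on UNIV r'"
    and B1: "0 \<le> B1" "\<And>x. \<bar>r' x\<bar> \<le> B1" and B2: "0 \<le> B2"
      "\<And>z h. \<bar>(r (z - h) + r (z + h)) / 2 - r z\<bar> \<le> B2 * h\<^sup>2"
      "\<And>z h. \<bar>(r (z + h) - r (z - h)) / 2 - h * r' z\<bar> \<le> B2 * h\<^sup>2"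
begin

lemma r_nonneg: "0 \<le> r x" and r_zero: "x \<notin> {0..e} \<Longrightarrow> r x = 0" and r_smooth: "smooth1 r"
  using moll unfolding mollifier_def by auto

lemma r'_zero: "x \<notin> {0..e} \<Longrightarrow> r' x = 0"
  using deriv_zero_outside[OF r'(1) r_zero] .

lemma r_meas [measurable]: "r \<in> borel_measurable borel" "r' \<in> borel_measurable borel"
  using r'(2) mollifier_continuous[OF moll] by (auto intro: borel_measurable_continuous_onI)

lemma integrable_slice:
  assumes "f \<in> borel_measurable borel" "\<And>x. \<bar>f x\<bar> \<le> C"
  shows "integrable lborel (\<lambda>x. f x * r (x - y))" "integrable lborel (\<lambda>x. f x * r' (x - y))"
proof -
  obtain R where R: "0 \<le> R" "\<And>x. \<bar>r x\<bar> \<le> R"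
    using bounded_support_bound[OF mollifier_continuous[OF moll] r_zero] by auto
  have C: "0 \<le> C" using assms(2)[of 0] by linarith
  note [measurable] = assms(1)
  show "integrable lborel (\<lambda>x. f x * r (x - y))"
    by (rule integrable_bounded_support[of _ "C * R" y "y + e"])
       (use assms(2) R C in \<open>auto simp: abs_mult intro!: mult_mono r_zero\<close>)
  show "integrable lborel (\<lambda>x. f x * r' (x - y))"
    by (rule integrable_bounded_support[of _ "C * B1" y "y + e"])
       (use assms(2) B1 C in \<open>auto simp: abs_mult intro!: mult_mono r'_zero\<close>)
qed

lemma lam_kflux_bound: "c \<in> {lo..hi} \<Longrightarrow> \<bar>lam * kflux g (u x t) c\<bar> \<le> hi - lo"
  using cfl.lam_kflux[of "u x t" c] u_bound[of c x t] by linarith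

text \<open>A state \<open>c\<close> at \<open>y\<close> contributes to the new points
  \<open>y + h\<close> and \<open>y - h\<close>. Expanding the kernel about \<open>x - y\<close>
  turns these contributions into the entropy term at \<open>y\<close> minus the flux term tested
  with \<open>r'\<close>.\<close>

lemma space_step:
  assumes c: "c \<in> {lo..hi}" and h: "0 < h" "h \<le> 1"
  shows "(LINT x|lborel. (\<bar>u x t - c\<bar> + lam * kflux g (u x t) c) / 2 * r (x - (y + h)))
       + (LINT x|lborel. (\<bar>u x t - c\<bar> - lam * kflux g (u x t) c) / 2 * r (x - (y - h)))
     \<le> (LINT x|lborel. \<bar>u x t - c\<bar> * r (x - y)) - lam * h * (LINT x|lborel. kflux g (u x t) c * r' (x - y))
       + 2 * (hi - lo) * B2 * h\<^sup>2 * (e + 2)"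
proof -
  define A where "A x = \<bar>u x t - c\<bar>" for x
  define q where "q x = lam * kflux g (u x t) c" for x
  have [measurable]: "A \<in> borel_measurable borel" "q \<in> borel_measurable borel"
    unfolding A_def[abs_def] q_def[abs_def] by measurable
  have D0: "0 \<le> hi - lo" using c by auto
  have A: "\<bar>A x\<bar> \<le> hi - lo" for x using u_bound[OF c] by (simp add: A_def)
  have q: "\<bar>q x\<bar> \<le> hi - lo" for x unfolding q_def by (rule lam_kflux_bound[OF c])
  have pq: "\<bar>(A x + q x) / 2\<bar> \<le> hi - lo" "\<bar>(A x - q x) / 2\<bar> \<le> hi - lo" for x
    using A[of x] q[of x] by (auto simp: abs_le_iff field_simps)
  have i1: "integrable lborel (\<lambda>x. (A x + q x) / 2 * r (x - (y + h)))"
    by (rule integrable_slice[OF _ pq(1)]) measurable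
  have i2: "integrable lborel (\<lambda>x. (A x - q x) / 2 * r (x - (y - h)))"
    by (rule integrable_slice[OF _ pq(2)]) measurable
  have i3: "integrable lborel (\<lambda>x. A x * r (x - y))" by (rule integrable_slice[OF _ A]) measurable
  have i4: "integrable lborel (\<lambda>x. q x * r' (x - y))" by (rule integrable_slice[OF _ q]) measurable
  have i4': "integrable lborel (\<lambda>x. h * (q x * r' (x - y)))" by (intro integrable_mult_right i4)
  \<comment> \<open>The Taylor remainder: in terms of \<open>z = x - y\<close> it is
    \<open>A x\<close> times the error of the average minus \<open>q x\<close> times the error of
    the centred difference.\<close>
  define F where "F x = (A x + q x) / 2 * r (x - (y + h)) + (A x - q x) / 2 * r (x - (y - h))
      - A x * r (x - y) + h * (q x * r' (x - y))" for x
  have eq: "(LINT x|lborel. F x) = (LINT x|lborel. (A x + q x) / 2 * r (x - (y + h)))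
     + (LINT x|lborel. (A x - q x) / 2 * r (x - (y - h))) - (LINT x|lborel. A x * r (x - y))
     + h * (LINT x|lborel. q x * r' (x - y))"
    unfolding F_def using i1 i2 i3 i4 i4'
    by (simp add: Bochner_Integration.integral_add Bochner_Integration.integral_diff
        Bochner_Integration.integrable_add Bochner_Integration.integrable_diff)
  \<comment> \<open>Since \<open>h \<le> 1\<close>, all the kernels are supported in an interval of
    length \<open>e + 2\<close>.\<close>
  have "\<bar>LINT x|lborel. F x\<bar> \<le> 2 * (hi - lo) * B2 * h\<^sup>2 * (y + e + 1 - (y - 1))"
  proof (rule integral_bounded_support)
    show "F \<in> borel_measurable borel" unfolding F_def[abs_def] by measurable
    show "F x = 0" if "x \<notin> {y - 1..y + e + 1}" for x
    proof -
      have "r (x - (y + h)) = 0" "r (x - (y - h)) = 0" "r (x - y) = 0" "r' (x - y) = 0"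
        using that h by (auto intro!: r_zero r'_zero)
      then show ?thesis by (simp add: F_def)
    qed
    show "\<bar>F x\<bar> \<le> 2 * (hi - lo) * B2 * h\<^sup>2" for x
    proof -
      define z where "z = x - y"
      have "F x = A x * ((r (z - h) + r (z + h)) / 2 - r z) - q x * ((r (z + h) - r (z - h)) / 2 - h * r' z)"
        by (simp add: F_def z_def field_simps)
      also have "\<bar>\<dots>\<bar> \<le> \<bar>A x\<bar> * \<bar>(r (z - h) + r (z + h)) / 2 - r z\<bar> + \<bar>q x\<bar> * \<bar>(r (z + h) - r (z - h)) / 2 - h * r' z\<bar>"
        unfolding abs_mult[symmetric] by (rule abs_triangle_ineq4)
      also have "\<dots> \<le> (hi - lo) * (B2 * h\<^sup>2) + (hi - lo) * (B2 * h\<^sup>2)"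
        by (intro add_mono mult_mono A q B2 D0) auto
      finally show ?thesis by (simp add: algebra_simps)
    qed
  qed (use e in auto)
  then have "(LINT x|lborel. F x) \<le> 2 * (hi - lo) * B2 * h\<^sup>2 * (e + 2)" by (simp add: abs_le_iff)
  moreover have "(LINT x|lborel. q x * r' (x - y)) = lam * (LINT x|lborel. kflux g (u x t) c * r' (x - y))"
    by (simp add: q_def mult.assoc)
  ultimately show ?thesis using eq unfolding A_def q_def by (simp add: algebra_simps)
qed

text \<open>This is \<open>time_slice\<close> over one time step with the flux frozen at the final
  time, where \<open>space_step\<close> evaluates it. The Lipschitz bound on \<open>kflux\<close>
  makes freezing cost at most \<open>k * (L * B1 * \<omega>)\<close>.\<close>

lemma time_step:
  assumes c: "c \<in> {lo..hi}" and st: "0 \<le> s" "0 \<le> k" "s + k \<le> T"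
    and \<omega>: "\<And>\<tau>. \<tau> \<in> {s..s+k} \<Longrightarrow> (LINT x:{-R..R}|lborel. \<bar>u x \<tau> - u x (s+k)\<bar>) \<le> \<omega>"
    and y: "- R \<le> y" "y + e \<le> R"
  shows "(LINT x|lborel. \<bar>u x (s+k) - c\<bar> * r (x - y)) - k * (LINT x|lborel. kflux g (u x (s+k)) c * r' (x - y))
     \<le> (LINT x|lborel. \<bar>u x s - c\<bar> * r (x - y)) + k * (L * B1 * \<omega>)"
proof -
  define B where "B \<tau> = (LINT x|lborel. kflux g (u x \<tau>) c * r' (x - y))" for \<tau>
  have [measurable]: "B \<in> borel_measurable borel" unfolding B_def[abs_def] by measurable
  have sm: "smooth1 (\<lambda>x. r (x - y))" by (rule smooth1_shift[OF r_smooth])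
  have ts: "(LINT x|lborel. \<bar>u x (s+k) - c\<bar> * r (x - y)) \<le> (LINT x|lborel. \<bar>u x s - c\<bar> * r (x - y)) + (LINT \<tau>:{s..s+k}|lborel. B \<tau>)"
    unfolding B_def
  proof (rule time_slice[OF sm _ _ _ _ c])
    show "((\<lambda>x. r (x - y)) has_real_derivative r' (x - y)) (at x)" for x
      using r'(1)[of "x - y"] DERIV_shift[of r "r' (x - y)" x "- y"] by simp
    show "continuous_on UNIV (\<lambda>x. r' (x - y))"
      by (intro continuous_on_compose2[OF r'(2)] continuous_intros) auto
    show "r (x - y) = 0" if "x \<notin> {y..y+e}" for x using that by (intro r_zero) auto
  qed (use st r_nonneg in auto)
  have kb: "\<bar>kflux g (u x \<tau>) c\<bar> \<le> L * (hi - lo)" for x \<tau> by (rule kflux_bound[OF c])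
  have iu: "integrable lborel (\<lambda>x. indicator {-R..R} x * \<bar>u x \<tau> - u x (s+k)\<bar>)" for \<tau>
    by (rule integrable_bounded_interval[where C="hi - lo"]) (use u_bound u_range in auto)
  have Bdiff: "B \<tau> \<le> B (s+k) + L * B1 * \<omega>" if \<tau>: "\<tau> \<in> {s..s+k}" for \<tau>
  proof -
    have i: "integrable lborel (\<lambda>x. kflux g (u x \<tau>) c * r' (x - y))" for \<tau>
      by (rule integrable_slice[OF _ kb]) measurable
    have "B \<tau> - B (s+k) = (LINT x|lborel. kflux g (u x \<tau>) c * r' (x - y) - kflux g (u x (s+k)) c * r' (x - y))"
      unfolding B_def using i by (intro Bochner_Integration.integral_diff[symmetric])
    also have "\<dots> \<le> (LINT x|lborel. L * B1 * (indicator {-R..R} x * \<bar>u x \<tau> - u x (s+k)\<bar>))"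
    proof (intro integral_mono Bochner_Integration.integrable_diff i integrable_mult_right iu)
      fix x
      show "kflux g (u x \<tau>) c * r' (x - y) - kflux g (u x (s+k)) c * r' (x - y)
         \<le> L * B1 * (indicator {-R..R} x * \<bar>u x \<tau> - u x (s+k)\<bar>)"
      proof (cases "x - y \<in> {0..e}")
        case True
        have "kflux g (u x \<tau>) c * r' (x - y) - kflux g (u x (s+k)) c * r' (x - y)
          = (kflux g (u x \<tau>) c - kflux g (u x (s+k)) c) * r' (x - y)" by (simp add: algebra_simps)
        also have "\<dots> \<le> \<bar>kflux g (u x \<tau>) c - kflux g (u x (s+k)) c\<bar> * \<bar>r' (x - y)\<bar>"
          by (metis abs_ge_self abs_mult)
        also have "\<dots> \<le> (L * \<bar>u x \<tau> - u x (s+k)\<bar>) * B1"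
          by (intro mult_mono kflux_Lipschitz[OF g_Lip] B1 mult_nonneg_nonneg L_nonneg) auto
        also have "\<dots> = L * B1 * (indicator {-R..R} x * \<bar>u x \<tau> - u x (s+k)\<bar>)"
          using True y by (auto simp: indicator_def)
        finally show ?thesis .
      next
        case False
        then show ?thesis using r'_zero[of "x - y"] L_nonneg B1(1) by (auto simp: indicator_def)
      qed
    qed
    also have "\<dots> = L * B1 * (LINT x:{-R..R}|lborel. \<bar>u x \<tau> - u x (s+k)\<bar>)"
      by (simp add: set_lebesgue_integral_def)
    also have "\<dots> \<le> L * B1 * \<omega>" using \<omega>[OF \<tau>] L_nonneg B1(1) by (intro mult_left_mono) auto
    finally show ?thesis by simp
  qed
  obtain K where K: "\<And>\<tau>. \<bar>B \<tau>\<bar> \<le> K"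
  proof -
    have "\<bar>B \<tau>\<bar> \<le> L * (hi - lo) * B1 * (y + e - y)" for \<tau>
      unfolding B_def
    proof (rule integral_bounded_support)
      show "kflux g (u x \<tau>) c * r' (x - y) = 0" if "x \<notin> {y..y+e}" for x
        using r'_zero[of "x - y"] that by auto
      show "\<bar>kflux g (u x \<tau>) c * r' (x - y)\<bar> \<le> L * (hi - lo) * B1" for x
        unfolding abs_mult using c L_nonneg by (intro mult_mono kb B1) auto
    qed (use e in auto)
    then show thesis using that by blast
  qed
  have "(LINT \<tau>:{s..s+k}|lborel. B \<tau>) \<le> (LINT \<tau>|lborel. (B (s+k) + L * B1 * \<omega>) * indicator {s..s+k} \<tau>)"
    unfolding set_lebesgue_integral_def real_scaleR_def
  proof (rule integral_mono[OF integrable_bounded_interval])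
    show "integrable lborel (\<lambda>\<tau>. (B (s+k) + L * B1 * \<omega>) * indicator {s..s+k} \<tau>)"
      using integrable_bounded_interval[of "\<lambda>_. B (s+k) + L * B1 * \<omega>" "\<bar>B (s+k) + L * B1 * \<omega>\<bar>" s "s+k"] by (simp add: mult.commute)
  qed (use K Bdiff in \<open>auto simp: indicator_def\<close>)
  also have "\<dots> = k * B (s+k) + k * (L * B1 * \<omega>)" using st by (simp add: algebra_simps)
  finally show ?thesis using ts unfolding B_def by linarith
qed

end

section \<open>Smearing in space and its effect on L1 distances\<close>

lemma mollifier_nn_integral:
  assumes "mollifier e r"
  shows "(\<integral>\<^sup>+y. ennreal (r (x - y)) \<partial>lborel) = 1" "(\<integral>\<^sup>+z. ennreal (r z) \<partial>lborel) = 1"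
proof -
  have r: "\<And>x. 0 \<le> r x" using assms unfolding mollifier_def by auto
  show "(\<integral>\<^sup>+y. ennreal (r (x - y)) \<partial>lborel) = 1"
    using mollifier_integral(3,5)[OF assms, of x] r by (simp add: nn_integral_eq_integral)
  show "(\<integral>\<^sup>+z. ennreal (r z) \<partial>lborel) = 1"
    using mollifier_integral(2,4)[OF assms, of 0] r by (simp add: nn_integral_eq_integral)
qed

text \<open>Bounded variation expressed through translations in L1. In this form the scheme
  preserves it, by translation invariance and L1 contraction.\<close>

definition L1_modulus :: "real \<Rightarrow> (real \<Rightarrow> real) \<Rightarrow> bool" where
  "L1_modulus B v \<longleftrightarrow> (\<forall>z. (\<integral>\<^sup>+x. ennreal \<bar>v (x + z) - v x\<bar> \<partial>lborel) \<le> ennreal (B * \<bar>z\<bar>))"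

lemma (in cfl) lxf_L1_modulus:
  assumes [measurable]: "v \<in> borel_measurable borel" and "L1_modulus B v"
  shows "L1_modulus B (V h v n)"
  unfolding L1_modulus_def
proof
  fix z
  have "(\<integral>\<^sup>+x. ennreal \<bar>V h v n (x + z) - V h v n x\<bar> \<partial>lborel)
     \<le> (\<integral>\<^sup>+x. ennreal \<bar>v (x + z) - v x\<bar> \<partial>lborel)"
    using lxf_L1_contract[of "\<lambda>x. v (x + z)" v h n] by (simp add: lxf_translate)
  also have "\<dots> \<le> ennreal (B * \<bar>z\<bar>)" using assms(2) unfolding L1_modulus_def by blast
  finally show "(\<integral>\<^sup>+x. ennreal \<bar>V h v n (x + z) - V h v n x\<bar> \<partial>lborel) \<le> ennreal (B * \<bar>z\<bar>)" .
qed

context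
  fixes e :: real and r v :: "real \<Rightarrow> real" and B :: real
  assumes moll: "mollifier e r" and e: "0 < e" and mod: "L1_modulus B v" and B: "0 \<le> B"
    and v_meas [measurable]: "v \<in> borel_measurable borel"
begin

private lemma r: "0 \<le> r x" "x \<notin> {0..e} \<Longrightarrow> r x = 0" "r \<in> borel_measurable borel"
  using moll mollifier_continuous[OF moll] unfolding mollifier_def by (auto intro: borel_measurable_continuous_onI)

text \<open>With \<open>x = y + z\<close> the kernel depends on \<open>z\<close> alone; for each
  \<open>z\<close> in \<open>{0..e}\<close> the inner integral is an L1 translation, and the kernel
  has mass one.\<close>

lemma smear_modulus:
  "(\<integral>\<^sup>+y. \<integral>\<^sup>+x. ennreal (\<bar>v x - v y\<bar> * r (x - y)) \<partial>lborel \<partial>lborel) \<le> ennreal (e * B)"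
proof -
  note [measurable] = r(3)
  have "(\<integral>\<^sup>+y. \<integral>\<^sup>+x. ennreal (\<bar>v x - v y\<bar> * r (x - y)) \<partial>lborel \<partial>lborel)
     = (\<integral>\<^sup>+y. \<integral>\<^sup>+z. ennreal (\<bar>v (y + z) - v y\<bar> * r z) \<partial>lborel \<partial>lborel)"
  proof (rule nn_integral_cong)
    fix y
    show "(\<integral>\<^sup>+x. ennreal (\<bar>v x - v y\<bar> * r (x - y)) \<partial>lborel) = (\<integral>\<^sup>+z. ennreal (\<bar>v (y + z) - v y\<bar> * r z) \<partial>lborel)"
      by (subst nn_integral_real_affine[of _ 1 y]) auto
  qed
  also have "\<dots> = (\<integral>\<^sup>+z. \<integral>\<^sup>+y. ennreal (\<bar>v (y + z) - v y\<bar> * r z) \<partial>lborel \<partial>lborel)"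
    by (rule lborel_pair.Fubini'[symmetric]) measurable
  also have "\<dots> = (\<integral>\<^sup>+z. (\<integral>\<^sup>+y. ennreal \<bar>v (y + z) - v y\<bar> \<partial>lborel) * ennreal (r z) \<partial>lborel)"
    by (intro nn_integral_cong) (simp add: ennreal_mult r(1) nn_integral_multc)
  also have "\<dots> \<le> (\<integral>\<^sup>+z. ennreal (e * B) * ennreal (r z) \<partial>lborel)"
  proof (intro nn_integral_mono)
    fix z
    show "(\<integral>\<^sup>+y. ennreal \<bar>v (y + z) - v y\<bar> \<partial>lborel) * ennreal (r z) \<le> ennreal (e * B) * ennreal (r z)"
    proof (cases "z \<in> {0..e}")
      case True
      have "(\<integral>\<^sup>+y. ennreal \<bar>v (y + z) - v y\<bar> \<partial>lborel) \<le> ennreal (B * \<bar>z\<bar>)"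
        using mod unfolding L1_modulus_def by blast
      also have "\<dots> \<le> ennreal (e * B)" using True B by (intro ennreal_leI) (simp add: mult.commute[of e] mult_left_mono)
      finally show ?thesis by (rule mult_right_mono) simp
    next
      case False then show ?thesis by (simp add: r(2))
    qed
  qed
  also have "\<dots> = ennreal (e * B)"
    using mollifier_nn_integral(2)[OF moll] by (simp add: nn_integral_cmult)
  finally show ?thesis .
qed

text \<open>Replacing \<open>v y\<close> by \<open>v x\<close> costs \<open>smear_modulus\<close>;
  integrating the kernel over \<open>y\<close> then leaves the plain L1 distance.
  \<open>smear_ge\<close> is the converse bound.\<close>

lemma smear_le:
  assumes [measurable]: "w \<in> borel_measurable borel"
  shows "(\<integral>\<^sup>+y. \<integral>\<^sup>+x. ennreal (\<bar>w x - v y\<bar> * r (x - y)) \<partial>lborel \<partial>lborel)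
    \<le> (\<integral>\<^sup>+x. ennreal \<bar>w x - v x\<bar> \<partial>lborel) + ennreal (e * B)"
proof -
  note [measurable] = r(3)
  have "(\<integral>\<^sup>+y. \<integral>\<^sup>+x. ennreal (\<bar>w x - v y\<bar> * r (x - y)) \<partial>lborel \<partial>lborel)
     \<le> (\<integral>\<^sup>+y. \<integral>\<^sup>+x. ennreal (\<bar>w x - v x\<bar> * r (x - y)) + ennreal (\<bar>v x - v y\<bar> * r (x - y)) \<partial>lborel \<partial>lborel)"
  proof (intro nn_integral_mono)
    fix x y
    have "\<bar>w x - v y\<bar> * r (x - y) \<le> \<bar>w x - v x\<bar> * r (x - y) + \<bar>v x - v y\<bar> * r (x - y)"
      using mult_right_mono[OF _ r(1), of "\<bar>w x - v y\<bar>" "\<bar>w x - v x\<bar> + \<bar>v x - v y\<bar>" "x - y"] by (simp add: algebra_simps)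
    then show "ennreal (\<bar>w x - v y\<bar> * r (x - y)) \<le> ennreal (\<bar>w x - v x\<bar> * r (x - y)) + ennreal (\<bar>v x - v y\<bar> * r (x - y))"
      using r(1) by (simp add: ennreal_plus[symmetric] del: ennreal_plus)
  qed
  also have "\<dots> = (\<integral>\<^sup>+y. \<integral>\<^sup>+x. ennreal (\<bar>w x - v x\<bar> * r (x - y)) \<partial>lborel \<partial>lborel)
      + (\<integral>\<^sup>+y. \<integral>\<^sup>+x. ennreal (\<bar>v x - v y\<bar> * r (x - y)) \<partial>lborel \<partial>lborel)"
    by (simp add: nn_integral_add)
  also have "(\<integral>\<^sup>+y. \<integral>\<^sup>+x. ennreal (\<bar>w x - v x\<bar> * r (x - y)) \<partial>lborel \<partial>lborel)
     = (\<integral>\<^sup>+x. \<integral>\<^sup>+y. ennreal (\<bar>w x - v x\<bar> * r (x - y)) \<partial>lborel \<partial>lborel)"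
    by (rule lborel_pair.Fubini') measurable
  also have "\<dots> = (\<integral>\<^sup>+x. ennreal \<bar>w x - v x\<bar> \<partial>lborel)"
    using mollifier_nn_integral(1)[OF moll] by (simp add: ennreal_mult r(1) nn_integral_cmult)
  finally show ?thesis using smear_modulus by (metis (no_types, lifting) add_left_mono order_trans)
qed

text \<open>The window on the left is smaller by \<open>e\<close> on each side: if \<open>x\<close>
  lies in it and \<open>x - y\<close> in \<open>{0..e}\<close>, then \<open>y\<close> lies in the
  larger window.\<close>

lemma smear_ge:
  assumes [measurable]: "w \<in> borel_measurable borel"
  shows "(\<integral>\<^sup>+x. ennreal \<bar>w x - v x\<bar> * indicator {-(\<rho> - e)..\<rho> - e} x \<partial>lborel)
    \<le> (\<integral>\<^sup>+y. (\<integral>\<^sup>+x. ennreal (\<bar>w x - v y\<bar> * r (x - y)) \<partial>lborel) * indicator {-\<rho>..\<rho>} y \<partial>lborel) + ennreal (e * B)"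
proof -
  let ?J = "indicator {-(\<rho> - e)..\<rho> - e} :: real \<Rightarrow> ennreal" and ?I = "indicator {-\<rho>..\<rho>} :: real \<Rightarrow> ennreal"
  note [measurable] = r(3)
  have "(\<integral>\<^sup>+x. ennreal \<bar>w x - v x\<bar> * ?J x \<partial>lborel)
     = (\<integral>\<^sup>+x. \<integral>\<^sup>+y. ennreal \<bar>w x - v x\<bar> * ?J x * ennreal (r (x - y)) \<partial>lborel \<partial>lborel)"
    using mollifier_nn_integral(1)[OF moll] by (simp add: nn_integral_cmult)
  also have "\<dots> = (\<integral>\<^sup>+y. \<integral>\<^sup>+x. ennreal \<bar>w x - v x\<bar> * ?J x * ennreal (r (x - y)) \<partial>lborel \<partial>lborel)"
    by (rule lborel_pair.Fubini') measurable
  also have "\<dots> \<le> (\<integral>\<^sup>+y. \<integral>\<^sup>+x. ennreal (\<bar>w x - v y\<bar> * r (x - y)) * ?I y + ennreal (\<bar>v x - v y\<bar> * r (x - y)) \<partial>lborel \<partial>lborel)"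
  proof (intro nn_integral_mono)
    fix x y
    show "ennreal \<bar>w x - v x\<bar> * ?J x * ennreal (r (x - y))
       \<le> ennreal (\<bar>w x - v y\<bar> * r (x - y)) * ?I y + ennreal (\<bar>v x - v y\<bar> * r (x - y))"
    proof (cases "x \<in> {-(\<rho> - e)..\<rho> - e} \<and> x - y \<in> {0..e}")
      case True
      then have y: "y \<in> {-\<rho>..\<rho>}" by auto
      have "\<bar>w x - v x\<bar> * r (x - y) \<le> \<bar>w x - v y\<bar> * r (x - y) + \<bar>v x - v y\<bar> * r (x - y)"
        using mult_right_mono[OF _ r(1), of "\<bar>w x - v x\<bar>" "\<bar>w x - v y\<bar> + \<bar>v x - v y\<bar>" "x - y"] by (simp add: algebra_simps)
      then show ?thesis using True y r(1)
        by (simp add: ennreal_plus[symmetric] ennreal_mult[symmetric] del: ennreal_plus)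
    next
      case False
      then have zero: "?J x * ennreal (r (x - y)) = 0"
        using r(2)[of "x - y"] by (auto simp: indicator_def)
      show ?thesis unfolding mult.assoc zero by simp
    qed
  qed
  also have "\<dots> = (\<integral>\<^sup>+y. (\<integral>\<^sup>+x. ennreal (\<bar>w x - v y\<bar> * r (x - y)) \<partial>lborel) * ?I y \<partial>lborel)
      + (\<integral>\<^sup>+y. \<integral>\<^sup>+x. ennreal (\<bar>v x - v y\<bar> * r (x - y)) \<partial>lborel \<partial>lborel)"
    by (simp add: nn_integral_add nn_integral_multc)
  finally show ?thesis using smear_modulus by (metis (no_types, lifting) add_left_mono order_trans)
qed

end

section \<open>The doubled functional along the scheme\<close>

context scheme_solution
begin

text \<open>The inner integral of the doubling argument: \<open>v y\<close> is the Kruzkov constant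
  for \<open>u\<close>, and integration over \<open>y\<close> gives the doubled functional.\<close>

definition slice :: "real \<Rightarrow> (real \<Rightarrow> real) \<Rightarrow> real \<Rightarrow> real" where
  "slice t v y = (LINT x|lborel. \<bar>u x t - v y\<bar> * r (x - y))"

lemma slice_measurable [measurable]:
  assumes [measurable]: "v \<in> borel_measurable borel"
  shows "slice t v \<in> borel_measurable borel"
  unfolding slice_def[abs_def] by measurable

lemma slice_nonneg: "0 \<le> slice t v y"
  unfolding slice_def by (intro Bochner_Integration.integral_nonneg) (simp add: r_nonneg)

lemma slice_eq_nn:
  assumes [measurable]: "v \<in> borel_measurable borel" and "\<And>y. v y \<in> {lo..hi}"
  shows "ennreal (slice t v y) = (\<integral>\<^sup>+x. ennreal (\<bar>u x t - v y\<bar> * r (x - y)) \<partial>lborel)"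
  unfolding slice_def
proof (rule nn_integral_eq_integral[symmetric])
  show "integrable lborel (\<lambda>x. \<bar>u x t - v y\<bar> * r (x - y))"
  proof (rule integrable_slice)
    show "\<bar>\<bar>u x t - v y\<bar>\<bar> \<le> hi - lo" for x using u_bound assms(2) by simp
  qed measurable
qed (simp add: r_nonneg)

text \<open>The first summand is the Taylor remainder of \<open>space_step\<close>, the second the
  cost in \<open>time_step\<close> of freezing the flux over a step of length
  \<open>lam * h\<close>.\<close>

definition step_error :: "real \<Rightarrow> real \<Rightarrow> real" where
  "step_error h \<omega> = 2 * (hi - lo) * B2 * h\<^sup>2 * (e + 2) + lam * h * (L * B1 * \<omega>)"

lemma step_error_nonneg:
  assumes "lo \<le> hi" "0 < h" "0 \<le> \<omega>"
  shows "0 \<le> step_error h \<omega>"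
  unfolding step_error_def using assms e B1(1) B2(1) L_nonneg cfl.lam_pos by simp

text \<open>The discrete entropy inequality in \<open>y\<close> is combined with the entropy
  inequality of \<open>u\<close> in \<open>x\<close>. The window loses \<open>h\<close> on each side
  because a new value depends on the two neighbours at distance \<open>h\<close>.\<close>

lemma step_smear:
  assumes [measurable]: "v \<in> borel_measurable borel" and v: "\<And>y. v y \<in> {lo..hi}"
    and h: "0 < h" "h \<le> 1" and s: "0 \<le> s" "s + lam * h \<le> T"
    and \<omega>: "\<And>\<tau>. \<tau> \<in> {s..s + lam * h} \<Longrightarrow> (LINT x:{-R..R}|lborel. \<bar>u x \<tau> - u x (s + lam * h)\<bar>) \<le> \<omega>" "0 \<le> \<omega>"
    and \<rho>: "0 \<le> \<rho>" "\<rho> + e \<le> R"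
  shows "(\<integral>\<^sup>+y. ennreal (slice (s + lam * h) (lxf_step lam h g v) y) * indicator {-(\<rho> - h)..\<rho> - h} y \<partial>lborel)
    \<le> (\<integral>\<^sup>+y. ennreal (slice s v y) * indicator {-\<rho>..\<rho>} y \<partial>lborel) + ennreal (2 * \<rho> * step_error h \<omega>)"
proof -
  let ?I = "indicator {-\<rho>..\<rho>} :: real \<Rightarrow> ennreal"
  define t where "t = s + lam * h"
  define A where "A x y = \<bar>u x t - v y\<bar>" for x y
  define q where "q x y = lam * kflux g (u x t) (v y)" for x y
  \<comment> \<open>\<open>P y\<close> and \<open>Q y\<close> are the shares that the old value at
    \<open>y\<close> hands on to the new points \<open>y + h\<close> and
    \<open>y - h\<close>.\<close>
  define P where "P y = (LINT x|lborel. (A x y + q x y) / 2 * r (x - (y + h)))" for y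
  define Q where "Q y = (LINT x|lborel. (A x y - q x y) / 2 * r (x - (y - h)))" for y
  have D0: "lo \<le> hi" using v[of 0] by auto
  have Aq: "\<bar>q x y\<bar> \<le> A x y" for x y unfolding q_def A_def by (rule cfl.lam_kflux)
  have A: "0 \<le> A x y" "A x y \<le> hi - lo" for x y using u_bound[OF v] by (auto simp: A_def)
  have [measurable]: "P \<in> borel_measurable borel" "Q \<in> borel_measurable borel"
    unfolding P_def[abs_def] Q_def[abs_def] A_def q_def by measurable
  have "0 \<le> (A x y + q x y) / 2" "0 \<le> (A x y - q x y) / 2" for x y
    using Aq[of x y] by (simp_all add: abs_le_iff)
  then have P0: "0 \<le> P y" and Q0: "0 \<le> Q y" for y
    unfolding P_def Q_def by (simp_all only: Bochner_Integration.integral_nonneg mult_nonneg_nonneg r_nonneg)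
  have bd: "\<bar>(A x y + q x y) / 2\<bar> \<le> hi - lo" "\<bar>(A x y - q x y) / 2\<bar> \<le> hi - lo" for x y
    using A[of x y] Aq[of x y] by (auto simp: abs_le_iff field_simps)
  have Iy: "slice t (lxf_step lam h g v) y \<le> P (y - h) + Q (y + h)" for y
  proof -
    have i1: "integrable lborel (\<lambda>x. (A x (y - h) + q x (y - h)) / 2 * r (x - y))"
      by (rule integrable_slice[OF _ bd(1)]) (unfold A_def q_def, measurable)
    have i2: "integrable lborel (\<lambda>x. (A x (y + h) - q x (y + h)) / 2 * r (x - y))"
      by (rule integrable_slice[OF _ bd(2)]) (unfold A_def q_def, measurable)
    have w: "lxf_step lam h g v y \<in> {lo..hi}" unfolding lxf_step_def by (intro cfl.lxf_flux_range v)
    have "slice t (lxf_step lam h g v) y \<le> (LINT x|lborel. (A x (y - h) + q x (y - h)) / 2 * r (x - y) + (A x (y + h) - q x (y + h)) / 2 * r (x - y))"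
      unfolding slice_def
    proof (intro integral_mono Bochner_Integration.integrable_add i1 i2)
      show "integrable lborel (\<lambda>x. \<bar>u x t - lxf_step lam h g v y\<bar> * r (x - y))"
        by (rule integrable_slice[where C="hi - lo"]) (use u_bound[OF w] in auto)
      fix x
      \<comment> \<open>The constant state \<open>u x t\<close> is a fixed point of the update, so
        it may be compared with \<open>v\<close> at both neighbours.\<close>
      have "\<bar>u x t - lxf_step lam h g v y\<bar> \<le> (A x (y - h) + q x (y - h)) / 2 + (A x (y + h) - q x (y + h)) / 2"
        using cfl.lxf_flux_contract[of "u x t" "u x t" "v (y - h)" "v (y + h)"]
        unfolding A_def q_def lxf_step_def lxf_flux_const .
      then show "\<bar>u x t - lxf_step lam h g v y\<bar> * r (x - y)
          \<le> (A x (y - h) + q x (y - h)) / 2 * r (x - y) + (A x (y + h) - q x (y + h)) / 2 * r (x - y)"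
        using mult_right_mono[OF _ r_nonneg] by (metis distrib_right)
    qed
    also have "\<dots> = P (y - h) + Q (y + h)"
      unfolding P_def Q_def using i1 i2 by (subst Bochner_Integration.integral_add) auto
    finally show ?thesis .
  qed
  \<comment> \<open>Up to the remainder, the right side of \<open>space_step\<close> is the left
    side of \<open>time_step\<close> with \<open>c = v y\<close> and
    \<open>k = lam * h\<close>.\<close>
  have PQ: "P y + Q y \<le> slice s v y + step_error h \<omega>" if y: "y \<in> {-\<rho>..\<rho>}" for y
  proof -
    have "P y + Q y \<le> slice t v y - lam * h * (LINT x|lborel. kflux g (u x t) (v y) * r' (x - y))
       + 2 * (hi - lo) * B2 * h\<^sup>2 * (e + 2)"
      unfolding P_def Q_def A_def q_def slice_def by (rule space_step[OF v h])
    moreover have "slice t v y - lam * h * (LINT x|lborel. kflux g (u x t) (v y) * r' (x - y))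
       \<le> slice s v y + lam * h * (L * B1 * \<omega>)"
      unfolding slice_def t_def
      by (rule time_step[OF v s(1) _ s(2) \<omega>(1)]) (use y \<rho> h e cfl.lam_pos in auto)
    ultimately show ?thesis unfolding step_error_def by linarith
  qed
  have "(\<integral>\<^sup>+y. ennreal (slice t (lxf_step lam h g v) y) * indicator {-(\<rho> - h)..\<rho> - h} y \<partial>lborel)
     \<le> (\<integral>\<^sup>+y. ennreal (P (y - h)) * ?I (y - h) + ennreal (Q (y + h)) * ?I (y + h) \<partial>lborel)"
  proof (intro nn_integral_mono)
    fix y
    show "ennreal (slice t (lxf_step lam h g v) y) * indicator {-(\<rho> - h)..\<rho> - h} y
      \<le> ennreal (P (y - h)) * ?I (y - h) + ennreal (Q (y + h)) * ?I (y + h)"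
    proof (cases "y \<in> {-(\<rho> - h)..\<rho> - h}")
      case True
      then have "y - h \<in> {-\<rho>..\<rho>}" "y + h \<in> {-\<rho>..\<rho>}" using h by auto
      then show ?thesis using True Iy[of y] P0 Q0
        by (simp add: ennreal_plus[symmetric] del: ennreal_plus)
    qed simp
  qed
  also have "\<dots> = (\<integral>\<^sup>+y. ennreal (P (y - h)) * ?I (y - h) \<partial>lborel)
      + (\<integral>\<^sup>+y. ennreal (Q (y + h)) * ?I (y + h) \<partial>lborel)"
    by (rule nn_integral_add) measurable
  also have "\<dots> = (\<integral>\<^sup>+y. ennreal (P y) * ?I y \<partial>lborel) + (\<integral>\<^sup>+y. ennreal (Q y) * ?I y \<partial>lborel)"
    using nn_integral_real_affine[of "\<lambda>y. ennreal (P y) * ?I y" 1 "-h"]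
      nn_integral_real_affine[of "\<lambda>y. ennreal (Q y) * ?I y" 1 h]
    by (simp add: add.commute)
  also have "\<dots> = (\<integral>\<^sup>+y. ennreal (P y) * ?I y + ennreal (Q y) * ?I y \<partial>lborel)"
    by (rule nn_integral_add[symmetric]) measurable
  also have "\<dots> \<le> (\<integral>\<^sup>+y. ennreal (slice s v y) * ?I y + ennreal (step_error h \<omega>) * ?I y \<partial>lborel)"
  proof (intro nn_integral_mono)
    fix y
    show "ennreal (P y) * ?I y + ennreal (Q y) * ?I y
       \<le> ennreal (slice s v y) * ?I y + ennreal (step_error h \<omega>) * ?I y"
      using PQ[of y] P0 Q0 slice_nonneg[of s v y] step_error_nonneg[OF D0 h(1) \<omega>(2)]
      by (cases "y \<in> {-\<rho>..\<rho>}") (simp_all add: ennreal_plus[symmetric] del: ennreal_plus)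
  qed
  also have "\<dots> = (\<integral>\<^sup>+y. ennreal (slice s v y) * ?I y \<partial>lborel) + (\<integral>\<^sup>+y. ennreal (step_error h \<omega>) * ?I y \<partial>lborel)"
    by (rule nn_integral_add) measurable
  also have "(\<integral>\<^sup>+y. ennreal (step_error h \<omega>) * ?I y \<partial>lborel) = ennreal (2 * \<rho> * step_error h \<omega>)"
    using \<rho> step_error_nonneg[OF D0 h(1) \<omega>(2)]
    by (subst nn_integral_cmult_indicator) (auto simp: ennreal_mult[symmetric] mult.commute)
  finally show ?thesis unfolding t_def .
qed

lemma lxf_Suc_eq: "lxf lam h g v (Suc n) = lxf_step lam h g (lxf lam h g v n)"
  by (simp add: lxf_def)

text \<open>The windows shrink to radius \<open>\<rho> - n * h\<close>, but each step is charged for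
  the full length \<open>2 * \<rho>\<close>. A single \<open>\<omega>\<close> serves all
  steps.\<close>

lemma smear_iterate:
  assumes [measurable]: "v \<in> borel_measurable borel" and v: "\<And>y. v y \<in> {lo..hi}"
    and h: "0 < h" "h \<le> 1"
    and \<omega>: "\<And>\<tau> \<sigma>. \<tau> \<in> {0..T} \<Longrightarrow> \<sigma> \<in> {0..T} \<Longrightarrow> \<bar>\<tau> - \<sigma>\<bar> \<le> lam * h \<Longrightarrow>
       (LINT x:{-R..R}|lborel. \<bar>u x \<tau> - u x \<sigma>\<bar>) \<le> \<omega>" "0 \<le> \<omega>"
    and \<rho>: "\<rho> + e \<le> R"
  shows "n * (lam * h) \<le> T \<Longrightarrow> n * h \<le> \<rho> \<Longrightarrow>
    (\<integral>\<^sup>+y. ennreal (slice (n * (lam * h)) (cfl.V h v n) y) * indicator {-(\<rho> - n * h)..\<rho> - n * h} y \<partial>lborel)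
    \<le> (\<integral>\<^sup>+y. ennreal (slice 0 v y) * indicator {-\<rho>..\<rho>} y \<partial>lborel) + ennreal (n * (2 * \<rho> * step_error h \<omega>))"
proof (induction n)
  case (Suc n)
  have k: "0 < lam * h" using cfl.lam_pos h by simp
  have D0: "lo \<le> hi" using v[of 0] by auto
  have nT: "n * (lam * h) + lam * h \<le> T" and n\<rho>: "n * h + h \<le> \<rho>"
    using Suc.prems by (auto simp: algebra_simps)
  have nn: "0 \<le> real n * (lam * h)" "0 \<le> real n * h" using k h by simp_all
  have \<rho>0: "0 \<le> \<rho>" using n\<rho> nn h by linarith
  have se: "0 \<le> step_error h \<omega>" by (rule step_error_nonneg[OF D0 h(1) \<omega>(2)])
  have "(\<integral>\<^sup>+y. ennreal (slice (n * (lam * h) + lam * h) (lxf_step lam h g (cfl.V h v n)) y) * indicator {-(\<rho> - n * h - h)..\<rho> - n * h - h} y \<partial>lborel)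
    \<le> (\<integral>\<^sup>+y. ennreal (slice (n * (lam * h)) (cfl.V h v n) y) * indicator {-(\<rho> - n * h)..\<rho> - n * h} y \<partial>lborel)
      + ennreal (2 * (\<rho> - n * h) * step_error h \<omega>)"
  proof (rule step_smear[OF _ _ h nn(1) nT _ \<omega>(2)])
    show "cfl.V h v n \<in> borel_measurable borel" by (rule cfl.lxf_measurable) (rule assms)
    show "cfl.V h v n y \<in> {lo..hi}" for y by (rule cfl.lxf_range) (rule v)
    show "(LINT x:{-R..R}|lborel. \<bar>u x \<tau> - u x (n * (lam * h) + lam * h)\<bar>) \<le> \<omega>"
      if "\<tau> \<in> {n * (lam * h)..n * (lam * h) + lam * h}" for \<tau>
    proof (rule \<omega>(1))
      show "\<tau> \<in> {0..T}" "real n * (lam * h) + lam * h \<in> {0..T}" "\<bar>\<tau> - (real n * (lam * h) + lam * h)\<bar> \<le> lam * h"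
        using that nn(1) nT k unfolding atLeastAtMost_iff by linarith+
    qed
    show "\<rho> - real n * h + e \<le> R" using \<rho> nn(2) by linarith
    show "0 \<le> \<rho> - real n * h" using n\<rho> h by linarith
  qed
  also have "\<dots> \<le> ((\<integral>\<^sup>+y. ennreal (slice 0 v y) * indicator {-\<rho>..\<rho>} y \<partial>lborel) + ennreal (n * (2 * \<rho> * step_error h \<omega>)))
      + ennreal (2 * \<rho> * step_error h \<omega>)"
  proof (intro add_mono Suc.IH ennreal_leI mult_right_mono se)
    show "real n * (lam * h) \<le> T" using nT k by linarith
    show "real n * h \<le> \<rho>" using n\<rho> h by linarith
  qed (use nn in auto)
  also have "\<dots> = (\<integral>\<^sup>+y. ennreal (slice 0 v y) * indicator {-\<rho>..\<rho>} y \<partial>lborel) + ennreal (Suc n * (2 * \<rho> * step_error h \<omega>))"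
    using \<rho>0 se by (simp add: add.assoc ennreal_plus[symmetric] algebra_simps del: ennreal_plus)
  finally show ?case by (simp add: lxf_Suc_eq algebra_simps)
qed simp

end

section \<open>Convergence of the scheme on bounded windows\<close>

context entropy_evolution
begin

text \<open>Heine-Cantor for the L1 seminorm on \<open>{-R..R}\<close>: a Lebesgue number of a cover
  of \<open>{0..T}\<close> puts two nearby times into one ball, and the triangle inequality goes
  through its centre.\<close>

lemma uniformly_continuous_L1:
  assumes "0 < \<eta>"
  obtains d where "0 < d" "\<And>\<tau> \<sigma>. \<tau> \<in> {0..T} \<Longrightarrow> \<sigma> \<in> {0..T} \<Longrightarrow> \<bar>\<tau> - \<sigma>\<bar> \<le> d \<Longrightarrow>
    (LINT x:{-R..R}|lborel. \<bar>u x \<tau> - u x \<sigma>\<bar>) \<le> \<eta>"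
proof -
  define m where "m s t = (LINT x:{-R..R}|lborel. \<bar>u x s - u x t\<bar>)" for s t
  have i: "integrable lborel (\<lambda>x. indicator {-R..R} x * \<bar>u x s - u x t\<bar>)" for s t
    by (rule integrable_bounded_interval[where C="hi - lo"]) (use u_bound u_range in auto)
  have tri: "m s t \<le> m s l + m t l" for s t l
  proof -
    have "m s t \<le> (LINT x|lborel. indicator {-R..R} x * \<bar>u x s - u x l\<bar> + indicator {-R..R} x * \<bar>u x t - u x l\<bar>)"
      unfolding m_def set_lebesgue_integral_def real_scaleR_def
      by (intro integral_mono Bochner_Integration.integrable_add i) (auto simp: indicator_def)
    also have "\<dots> = m s l + m t l"
      unfolding m_def set_lebesgue_integral_def real_scaleR_def by (intro Bochner_Integration.integral_add i)
    finally show ?thesis .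
  qed
  have "\<exists>d>0. \<forall>s\<in>{0..T}. dist s l < d \<longrightarrow> m s l < \<eta>/2" if "l \<in> {0..T}" for l
  proof -
    have "eventually (\<lambda>s. m s l < \<eta>/2) (at l within {0..T})"
      using order_tendstoD(2)[OF u_cont[OF that], of "\<eta>/2"] assms unfolding m_def by simp
    then obtain d where d: "d > 0" "\<And>s. s \<in> {0..T} \<Longrightarrow> s \<noteq> l \<Longrightarrow> dist s l < d \<Longrightarrow> m s l < \<eta>/2"
      unfolding eventually_at by blast
    moreover have "m l l < \<eta>/2" unfolding m_def using assms by simp
    ultimately show ?thesis by metis
  qed
  then obtain d where d: "\<And>l. l \<in> {0..T} \<Longrightarrow> d l > 0"
      "\<And>l s. l \<in> {0..T} \<Longrightarrow> s \<in> {0..T} \<Longrightarrow> dist s l < d l \<Longrightarrow> m s l < \<eta>/2"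
    by metis
  obtain e where e: "e > 0" "\<And>x. x \<in> {0..T} \<Longrightarrow> \<exists>G\<in>(\<lambda>l. ball l (d l)) ` {0..T}. ball x e \<subseteq> G"
  proof (rule Heine_Borel_lemma[of "{0..T}" "(\<lambda>l. ball l (d l)) ` {0..T}"])
    show "{0..T} \<subseteq> \<Union> ((\<lambda>l. ball l (d l)) ` {0..T})" using d(1) by fastforce
  qed auto
  show thesis
  proof (rule that[of "e/2"])
    fix \<tau> \<sigma> assume ts: "\<tau> \<in> {0..T}" "\<sigma> \<in> {0..T}" "\<bar>\<tau> - \<sigma>\<bar> \<le> e/2"
    obtain l where l: "l \<in> {0..T}" "ball \<tau> e \<subseteq> ball l (d l)" using e(2)[OF ts(1)] by auto
    have "\<tau> \<in> ball l (d l)" "\<sigma> \<in> ball l (d l)" using l(2) ts(3) e(1) by (auto simp: subset_eq dist_real_def)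
    then have "m \<tau> l < \<eta>/2" "m \<sigma> l < \<eta>/2" using d(2)[OF l(1)] ts by (auto simp: dist_commute)
    then show "(LINT x:{-R..R}|lborel. \<bar>u x \<tau> - u x \<sigma>\<bar>) \<le> \<eta>"
      using tri[of \<tau> \<sigma> l] unfolding m_def by linarith
  qed (use e in auto)
qed

text \<open>The parameters are fixed in the order \<open>e\<close>, \<open>\<omega>\<close>,
  \<open>h\<close>. The constants \<open>B1\<close> and \<open>B2\<close> depend on the mollifier
  and may be large when \<open>e\<close> is small, but they are known before \<open>\<omega>\<close>
  and \<open>h\<close> are chosen.\<close>

theorem lxf_converges:
  assumes cfl: "cfl lam L g" and v_meas [measurable]: "v \<in> borel_measurable borel" and v: "\<And>y. v y \<in> {lo..hi}"
    and B: "L1_modulus B v" "0 \<le> B" and t: "t \<in> {0..T}" and \<kappa>: "0 < \<kappa>"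
  obtains h0 where "0 < h0" "\<And>h n. 0 < h \<Longrightarrow> h < h0 \<Longrightarrow> real n * (lam * h) = t \<Longrightarrow>
    (\<integral>\<^sup>+x. ennreal \<bar>u x t - lxf lam h g v n x\<bar> * indicator {-\<rho>..\<rho>} x \<partial>lborel)
      \<le> (\<integral>\<^sup>+x. ennreal \<bar>u x 0 - v x\<bar> \<partial>lborel) + ennreal \<kappa>"
proof -
  let ?I = "\<integral>\<^sup>+x. ennreal \<bar>u x 0 - v x\<bar> \<partial>lborel"
  interpret cfl: cfl lam L g by (rule cfl)
  \<comment> \<open>Smearing is paid for at time 0 and at time \<open>t\<close>, each time with
    \<open>e * B \<le> \<kappa>/4\<close>.\<close>
  define e where "e = \<kappa> / (4 * (B + 1))"
  have e: "0 < e" using \<kappa> B by (simp add: e_def)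
  have eB: "e * B \<le> \<kappa>/4"
  proof -
    have "e * B \<le> e * (B + 1)" using e by simp
    also have "\<dots> = \<kappa>/4" using B by (simp add: e_def field_simps)
    finally show ?thesis .
  qed
  obtain r where r: "mollifier e r" using mollifier_exists[OF e] .
  obtain r' B1 B2 where r': "\<And>x. (r has_real_derivative r' x) (at x)" "continuous_on UNIV r'"
    "0 \<le> B1" "\<And>x. \<bar>r' x\<bar> \<le> B1" "0 \<le> B2"
    "\<And>z h. \<bar>(r (z - h) + r (z + h)) / 2 - r z\<bar> \<le> B2 * h\<^sup>2"
    "\<And>z h. \<bar>(r (z + h) - r (z - h)) / 2 - h * r' z\<bar> \<le> B2 * h\<^sup>2"
    using mollifier_Taylor[OF r] by blast
  interpret scheme_solution lo hi T L g u lam e r r' B1 B2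
    by unfold_locales (fact e r r')+
  \<comment> \<open>\<open>d\<close> is the distance \<open>n * h\<close> by which the windows
    shrink in all, so starting from \<open>\<rho>0\<close> leaves \<open>\<rho>1\<close>, which
    still exceeds the target by the margin \<open>e\<close> of \<open>smear_ge\<close>.\<close>
  define d where "d = t / lam"
  define \<rho>1 where "\<rho>1 = max \<rho> 0 + e"
  define \<rho>0 where "\<rho>0 = \<rho>1 + d"
  define C where "C = 2 * (hi - lo) * B2 * (e + 2)"
  have lam: "0 < lam" by (rule cfl.lam_pos)
  have D0: "lo \<le> hi" using v[of 0] by auto
  have d0: "0 \<le> d" using t lam by (simp add: d_def)
  have \<rho>1: "0 \<le> \<rho>1" using e by (simp add: \<rho>1_def)
  have \<rho>0: "0 \<le> \<rho>0" using \<rho>1 d0 by (simp add: \<rho>0_def)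
  have C: "0 \<le> C" using D0 B2(1) e by (simp add: C_def)
  have tLB: "0 \<le> 2 * \<rho>0 * (t * (L * B1))" using \<rho>0 t L_nonneg B1(1) by simp
  have Cd: "0 \<le> 2 * \<rho>0 * (C * d)" using \<rho>0 C d0 by simp
  \<comment> \<open>Chosen so that freezing the flux costs at most \<open>\<kappa>/4\<close> over
    all steps; their total duration is \<open>t\<close>.\<close>
  define \<omega> where "\<omega> = \<kappa> / (4 * (2 * \<rho>0 * (t * (L * B1)) + 1))"
  have quot: "0 < \<kappa> / (4 * (y + 1))" if "0 \<le> y" for y
    using that \<kappa> by (intro divide_pos_pos) auto
  have \<omega>: "0 < \<omega>" unfolding \<omega>_def by (rule quot[OF tLB])
  have \<omega>': "2 * \<rho>0 * (t * (L * B1)) * \<omega> \<le> \<kappa>/4"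
  proof -
    have "2 * \<rho>0 * (t * (L * B1)) * \<omega> \<le> (2 * \<rho>0 * (t * (L * B1)) + 1) * \<omega>" using \<omega> by simp
    also have "\<dots> = \<kappa>/4" using tLB by (simp add: \<omega>_def field_simps)
    finally show ?thesis .
  qed
  obtain dd where dd: "0 < dd" "\<And>\<tau> \<sigma>. \<tau> \<in> {0..T} \<Longrightarrow> \<sigma> \<in> {0..T} \<Longrightarrow> \<bar>\<tau> - \<sigma>\<bar> \<le> dd \<Longrightarrow>
    (LINT x:{-(\<rho>0 + e)..\<rho>0 + e}|lborel. \<bar>u x \<tau> - u x \<sigma>\<bar>) \<le> \<omega>"
    using uniformly_continuous_L1[OF \<omega>] by blast
  \<comment> \<open>The entry \<open>dd / lam\<close> makes one time step short enough for
    \<open>\<omega>\<close>. The last entry bounds the accumulated Taylor error, linear in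
    \<open>h\<close> because \<open>n * h = d\<close>, by \<open>\<kappa>/4\<close>.\<close>
  define h0 where "h0 = min 1 (min (dd / lam) (\<kappa> / (4 * (2 * \<rho>0 * (C * d) + 1))))"
  have "0 < \<kappa> / (4 * (2 * \<rho>0 * (C * d) + 1))" by (rule quot[OF Cd])
  then have h0: "0 < h0" using dd(1) lam by (simp add: h0_def)
  show thesis
  proof (rule that[OF h0])
    fix h :: real and n :: nat
    assume h: "0 < h" "h < h0" and n: "real n * (lam * h) = t"
    have h1: "h \<le> 1" "h \<le> dd / lam" "h \<le> \<kappa> / (4 * (2 * \<rho>0 * (C * d) + 1))"
      using h(2) unfolding h0_def by linarith+
    have lh: "lam * h \<le> dd" using h1(2) lam by (simp add: field_simps)
    have nh: "real n * h = d" using n lam by (simp add: d_def field_simps)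
    have hC: "2 * \<rho>0 * (C * d) * h \<le> \<kappa>/4"
    proof -
      have "2 * \<rho>0 * (C * d) * h \<le> (2 * \<rho>0 * (C * d) + 1) * h" using h by simp
      also have "\<dots> \<le> (2 * \<rho>0 * (C * d) + 1) * (\<kappa> / (4 * (2 * \<rho>0 * (C * d) + 1)))"
        using Cd by (intro mult_left_mono h1) auto
      also have "\<dots> = \<kappa>/4" using Cd by (simp add: field_simps)
      finally show ?thesis .
    qed
    define w where "w = lxf lam h g v n"
    have w_meas: "w \<in> borel_measurable borel" unfolding w_def by (rule cfl.lxf_measurable) (rule v_meas)
    have w: "w y \<in> {lo..hi}" for y unfolding w_def by (rule cfl.lxf_range) (rule v)
    have wB: "L1_modulus B w" unfolding w_def by (rule cfl.lxf_L1_modulus[OF v_meas B(1)])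
    have err: "real n * (2 * \<rho>0 * step_error h \<omega>) \<le> \<kappa>/2"
    proof -
      have "real n * (2 * \<rho>0 * step_error h \<omega>) = 2 * \<rho>0 * (C * (real n * h)) * h + 2 * \<rho>0 * ((real n * (lam * h)) * (L * B1)) * \<omega>"
        unfolding step_error_def C_def by (simp add: algebra_simps power2_eq_square)
      then show ?thesis using hC \<omega>' unfolding nh n by linarith
    qed
    have "(\<integral>\<^sup>+x. ennreal \<bar>u x t - w x\<bar> * indicator {-\<rho>..\<rho>} x \<partial>lborel)
       \<le> (\<integral>\<^sup>+x. ennreal \<bar>u x t - w x\<bar> * indicator {-(\<rho>1 - e)..\<rho>1 - e} x \<partial>lborel)"
      by (intro nn_integral_mono mult_left_mono) (auto simp: indicator_def \<rho>1_def)
    also have "\<dots> \<le> (\<integral>\<^sup>+y. (\<integral>\<^sup>+x. ennreal (\<bar>u x t - w y\<bar> * r (x - y)) \<partial>lborel) * indicator {-\<rho>1..\<rho>1} y \<partial>lborel) + ennreal (e * B)"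
      by (rule smear_ge[OF r e wB B(2) w_meas]) measurable
    also have "(\<integral>\<^sup>+y. (\<integral>\<^sup>+x. ennreal (\<bar>u x t - w y\<bar> * r (x - y)) \<partial>lborel) * indicator {-\<rho>1..\<rho>1} y \<partial>lborel)
       = (\<integral>\<^sup>+y. ennreal (slice (real n * (lam * h)) (lxf lam h g v n) y) * indicator {-(\<rho>0 - real n * h)..\<rho>0 - real n * h} y \<partial>lborel)"
      unfolding n nh by (simp add: slice_eq_nn[OF w_meas w] w_def[symmetric] \<rho>0_def)
    also have "\<dots> \<le> (\<integral>\<^sup>+y. ennreal (slice 0 v y) * indicator {-\<rho>0..\<rho>0} y \<partial>lborel) + ennreal (real n * (2 * \<rho>0 * step_error h \<omega>))"
    proof (rule smear_iterate[OF v_meas v h(1) h1(1)])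
      show "(LINT x:{-(\<rho>0 + e)..\<rho>0 + e}|lborel. \<bar>u x \<tau> - u x \<sigma>\<bar>) \<le> \<omega>"
        if "\<tau> \<in> {0..T}" "\<sigma> \<in> {0..T}" "\<bar>\<tau> - \<sigma>\<bar> \<le> lam * h" for \<tau> \<sigma>
        using dd(2)[OF that(1,2)] that(3) lh by linarith
      show "real n * (lam * h) \<le> T" using n t by simp
      show "real n * h \<le> \<rho>0" using nh \<rho>1 by (simp add: \<rho>0_def)
    qed (use \<omega> in auto)
    also have "\<dots> \<le> (\<integral>\<^sup>+y. ennreal (slice 0 v y) * indicator {-\<rho>0..\<rho>0} y \<partial>lborel) + ennreal (\<kappa>/2)"
      by (intro add_left_mono ennreal_leI err)
    also have "(\<integral>\<^sup>+y. ennreal (slice 0 v y) * indicator {-\<rho>0..\<rho>0} y \<partial>lborel)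
       \<le> (\<integral>\<^sup>+y. \<integral>\<^sup>+x. ennreal (\<bar>u x 0 - v y\<bar> * r (x - y)) \<partial>lborel \<partial>lborel)"
    proof (rule nn_integral_mono)
      show "ennreal (slice 0 v y) * indicator {-\<rho>0..\<rho>0} y \<le> (\<integral>\<^sup>+x. ennreal (\<bar>u x 0 - v y\<bar> * r (x - y)) \<partial>lborel)" for y
        by (simp add: slice_eq_nn[OF v_meas v] indicator_def)
    qed
    also have "\<dots> \<le> ?I + ennreal (e * B)"
      by (rule smear_le[OF r e B v_meas]) measurable
    also have "?I + ennreal (e * B) + ennreal (\<kappa>/2) + ennreal (e * B)
       = ?I + ennreal (e * B + \<kappa>/2 + e * B)"
      using e B \<kappa> by (simp add: add.assoc ennreal_plus[symmetric] del: ennreal_plus)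
    also have "\<dots> \<le> ?I + ennreal \<kappa>"
      using eB by (intro add_left_mono ennreal_leI) linarith
    finally show "(\<integral>\<^sup>+x. ennreal \<bar>u x t - lxf lam h g v n x\<bar> * indicator {-\<rho>..\<rho>} x \<partial>lborel)
      \<le> ?I + ennreal \<kappa>"
      unfolding w_def by (simp add: add_right_mono)
  qed
qed

end

section \<open>Comparison of two scheme solutions\<close>

text \<open>Cutting an interval into \<open>K\<close> cells of length \<open>p\<close> and
  translating all of them onto the first transfers bounds on grid sums to bounds on
  integrals.\<close>

lemma nn_integral_grid:
  fixes f :: "real \<Rightarrow> ennreal"
  assumes [measurable]: "f \<in> borel_measurable borel" and p: "0 < p"
  shows "(\<integral>\<^sup>+x. f x * indicator {a..<a + real K * p} x \<partial>lborel)
     = (\<integral>\<^sup>+x. (\<Sum>j<K. f (x + p * real j)) * indicator {a..<a + p} x \<partial>lborel)"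
proof (induction K)
  case (Suc K)
  define b where "b = a + real K * p"
  have b: "a \<le> b" "a + real (Suc K) * p = b + p" using p by (simp_all add: b_def algebra_simps)
  have "(\<integral>\<^sup>+x. f x * indicator {a..<a + real (Suc K) * p} x \<partial>lborel)
     = (\<integral>\<^sup>+x. f x * indicator {a..<b} x + f x * indicator {b..<b + p} x \<partial>lborel)"
    unfolding b(2) using p b(1) by (intro nn_integral_cong) (auto simp: indicator_def)
  also have "\<dots> = (\<integral>\<^sup>+x. f x * indicator {a..<b} x \<partial>lborel) + (\<integral>\<^sup>+x. f x * indicator {b..<b + p} x \<partial>lborel)"
    by (rule nn_integral_add) measurable
  also have "(\<integral>\<^sup>+x. f x * indicator {b..<b + p} x \<partial>lborel)
     = (\<integral>\<^sup>+x. f (x + p * real K) * indicator {a..<a + p} x \<partial>lborel)"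
    by (subst nn_integral_real_affine[of _ 1 "real K * p"])
       (auto intro!: nn_integral_cong simp: b_def indicator_def algebra_simps)
  finally show ?case unfolding b_def Suc
    by (subst (asm) nn_integral_add[symmetric]) (auto simp: distrib_right)
qed simp

text \<open>Folded onto a cell of length \<open>z\<close>, the integrand becomes a sum of
  consecutive increments on a grid of spacing \<open>z\<close>, which is at most \<open>B\<close>. A
  negative shift reduces to a positive one by translation.\<close>

lemma L1_modulusI:
  assumes [measurable]: "v \<in> borel_measurable borel"
    and TV: "\<And>x0 p K. 0 < p \<Longrightarrow> (\<Sum>j<K. \<bar>v (x0 + p * real (Suc j)) - v (x0 + p * real j)\<bar>) \<le> B"
    and far: "\<And>x. x < -X \<Longrightarrow> v x = uL" "\<And>x. X \<le> x \<Longrightarrow> v x = uR"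
  shows "L1_modulus B v"
proof -
  have B: "0 \<le> B" using TV[of 1 0 0] by simp
  have pos: "(\<integral>\<^sup>+x. ennreal \<bar>v (x + z) - v x\<bar> \<partial>lborel) \<le> ennreal (B * z)" if z: "0 < z" for z
  proof -
    \<comment> \<open>The \<open>K\<close> cells starting at \<open>a\<close> cover every
      \<open>x\<close> with \<open>v (x + z) \<noteq> v x\<close>.\<close>
    define a where "a = - \<bar>X\<bar> - z - 1"
    define K where "K = nat \<lceil>(2 * \<bar>X\<bar> + z + 2) / z\<rceil>"
    have "(2 * \<bar>X\<bar> + z + 2) / z \<le> real K" unfolding K_def by (rule real_nat_ceiling_ge)
    then have K: "2 * \<bar>X\<bar> + z + 2 \<le> real K * z" using z by (simp add: field_simps)
    have "(\<integral>\<^sup>+x. ennreal \<bar>v (x + z) - v x\<bar> \<partial>lborel)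
       = (\<integral>\<^sup>+x. ennreal \<bar>v (x + z) - v x\<bar> * indicator {a..<a + real K * z} x \<partial>lborel)"
    proof (intro nn_integral_cong)
      fix x
      show "ennreal \<bar>v (x + z) - v x\<bar> = ennreal \<bar>v (x + z) - v x\<bar> * indicator {a..<a + real K * z} x"
      proof (cases "x \<in> {a..<a + real K * z}")
        case False
        then have "x < - \<bar>X\<bar> - z \<or> \<bar>X\<bar> \<le> x" using K z by (auto simp: a_def)
        then have "v (x + z) = v x"
        proof
          assume "x < - \<bar>X\<bar> - z"
          then have "x < - X" "x + z < -X" using z by auto
          then show ?thesis using far(1) by simp
        next
          assume "\<bar>X\<bar> \<le> x"
          then have "X \<le> x" "X \<le> x + z" using z by auto
          then show ?thesis using far(2) by simp
        qed
        then show ?thesis by simp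
      qed simp
    qed
    also have "\<dots> = (\<integral>\<^sup>+x. (\<Sum>j<K. ennreal \<bar>v (x + z * real j + z) - v (x + z * real j)\<bar>) * indicator {a..<a + z} x \<partial>lborel)"
      by (rule nn_integral_grid[OF _ z]) measurable
    also have "\<dots> \<le> (\<integral>\<^sup>+x. ennreal B * indicator {a..<a + z} x \<partial>lborel)"
    proof (intro nn_integral_mono mult_right_mono)
      fix x
      show "(\<Sum>j<K. ennreal \<bar>v (x + z * real j + z) - v (x + z * real j)\<bar>) \<le> ennreal B"
        using TV[OF z, of x K] by (subst sum_ennreal) (auto simp: algebra_simps intro!: ennreal_leI)
    qed simp
    also have "\<dots> = ennreal (B * z)" using z B by (simp add: nn_integral_cmult_indicator ennreal_mult)
    finally show ?thesis .
  qed
  show ?thesis unfolding L1_modulus_def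
  proof
    fix z :: real
    consider "z = 0" | "0 < z" | "z < 0" by linarith
    then show "(\<integral>\<^sup>+x. ennreal \<bar>v (x + z) - v x\<bar> \<partial>lborel) \<le> ennreal (B * \<bar>z\<bar>)"
    proof cases
      case 3
      have "(\<integral>\<^sup>+x. ennreal \<bar>v (x + z) - v x\<bar> \<partial>lborel) = (\<integral>\<^sup>+x. ennreal \<bar>v (x + (-z)) - v x\<bar> \<partial>lborel)"
        by (subst nn_integral_real_affine[of _ 1 "-z"]) (auto simp: abs_minus_commute intro!: nn_integral_cong)
      then show ?thesis using pos[of "-z"] 3 by simp
    qed (use pos in auto)
  qed
qed

text \<open>The sign of \<open>w\<close> is replaced by its truncation \<open>s\<close> of slope \<open>1/\<eta>\<close>, whose variation is controlled by that of \<open>w\<close>.\<close>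

lemma discrete_interpolation:
  fixes w D :: "nat \<Rightarrow> real"
  assumes D: "\<And>j. D (Suc j) - D j = c * w j" "\<And>j. \<bar>D j\<bar> \<le> M"
    and w: "w 0 = 0" "w K = 0" "(\<Sum>j<K. \<bar>w (Suc j) - w j\<bar>) \<le> B" and \<eta>: "0 < \<eta>" and c: "0 \<le> c"
  shows "c * (\<Sum>j<K. \<bar>w j\<bar>) \<le> M * B / \<eta> + c * real K * \<eta> / 4"
proof -
  define s where "s j = max (-1) (min 1 (w j / \<eta>))" for j
  have M: "0 \<le> M" using D(2)[of 0] by linarith
  have s_diff: "\<bar>s i - s j\<bar> \<le> \<bar>w i - w j\<bar> / \<eta>" for i j
  proof -
    have "\<bar>s i - s j\<bar> \<le> \<bar>w i / \<eta> - w j / \<eta>\<bar>" unfolding s_def by (auto simp: abs_if max_def min_def)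
    also have "\<dots> = \<bar>w i - w j\<bar> / \<eta>" using \<eta> by (simp add: diff_divide_distrib[symmetric])
    finally show ?thesis .
  qed
  \<comment> \<open>For \<open>\<bar>w j\<bar> \<le> \<eta>\<close> the loss is
    \<open>\<bar>w j\<bar> - (w j)\<^sup>2 / \<eta>\<close>, largest at
    \<open>\<bar>w j\<bar> = \<eta> / 2\<close> with value \<open>\<eta> / 4\<close>; beyond
    \<open>\<eta>\<close> the truncation is the sign and nothing is lost.\<close>
  have w_s: "\<bar>w j\<bar> \<le> w j * s j + \<eta> / 4" for j
  proof (cases "\<bar>w j\<bar> \<le> \<eta>")
    case True
    then have "s j = w j / \<eta>" using \<eta> by (auto simp: s_def max_def min_def field_simps abs_le_iff)
    moreover have "\<bar>w j\<bar> * \<eta> \<le> w j * w j + \<eta> * \<eta> / 4"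
      using zero_le_power2[of "\<bar>w j\<bar> - \<eta> / 2"] by (simp add: power2_eq_square algebra_simps)
    ultimately have "\<bar>w j\<bar> \<le> (w j * w j + \<eta> * \<eta> / 4) / \<eta>" "s j = w j / \<eta>"
      using \<eta> by (simp_all add: pos_le_divide_eq)
    then show ?thesis using \<eta> by (simp add: add_divide_distrib)
  next
    case False
    then have "w j * s j = \<bar>w j\<bar>" using \<eta> by (auto simp: s_def max_def min_def field_simps abs_if)
    then show ?thesis using \<eta> by simp
  qed
  \<comment> \<open>Summation by parts moves the difference from \<open>D\<close> to
    \<open>s\<close>; the end terms vanish because \<open>w\<close>, and with it \<open>s\<close>,
    is zero at \<open>0\<close> and \<open>K\<close>.\<close>
  have Abel: "(\<Sum>j<n. (D (Suc j) - D j) * s j) = D n * s n - D 0 * s 0 - (\<Sum>j<n. D (Suc j) * (s (Suc j) - s j))" for n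
    by (induction n) (auto simp: algebra_simps)
  have s0: "s 0 = 0" "s K = 0" using w by (auto simp: s_def)
  have "c * (\<Sum>j<K. \<bar>w j\<bar>) \<le> c * (\<Sum>j<K. w j * s j + \<eta> / 4)"
    by (intro mult_left_mono sum_mono w_s c)
  also have "\<dots> = (\<Sum>j<K. (D (Suc j) - D j) * s j) + c * real K * \<eta> / 4"
    by (simp add: D(1) sum.distrib sum_distrib_left algebra_simps)
  also have "(\<Sum>j<K. (D (Suc j) - D j) * s j) = (\<Sum>j<K. - D (Suc j) * (s (Suc j) - s j))"
    unfolding Abel s0 by (simp add: sum_negf)
  also have "\<dots> \<le> (\<Sum>j<K. M * (\<bar>w (Suc j) - w j\<bar> / \<eta>))"
  proof (intro sum_mono)
    fix j
    have "- D (Suc j) * (s (Suc j) - s j) \<le> \<bar>D (Suc j)\<bar> * \<bar>s (Suc j) - s j\<bar>"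
      by (metis abs_ge_self abs_minus_cancel abs_mult)
    also have "\<dots> \<le> M * (\<bar>w (Suc j) - w j\<bar> / \<eta>)" by (intro mult_mono D s_diff M) auto
    finally show "- D (Suc j) * (s (Suc j) - s j) \<le> M * (\<bar>w (Suc j) - w j\<bar> / \<eta>)" .
  qed
  also have "\<dots> = M / \<eta> * (\<Sum>j<K. \<bar>w (Suc j) - w j\<bar>)" by (simp add: sum_distrib_left)
  also have "\<dots> \<le> M / \<eta> * B" using M \<eta> by (intro mult_left_mono w) auto
  finally show ?thesis by simp
qed

text \<open>On the level of primitives the scheme is a monotone scheme for a Hamilton--Jacobi equation,
  so that the primitive of the difference obeys a maximum principle.\<close>

lemma lxf_primitive:
  assumes "cfl lam L f" "cfl lam L g" and h: "0 < h"
    and fg: "\<And>a. a \<in> {lo..hi} \<Longrightarrow> \<bar>f a - g a\<bar> \<le> \<rho>"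
    and v: "\<And>x. v x \<in> {lo..hi}" and v': "\<And>x. v' x \<in> {lo..hi}"
    and D: "\<And>x. D (x + h) - D (x - h) = 2 * h * (v x - v' x)" "\<And>x. \<bar>D x\<bar> \<le> M"
  obtains E where "\<And>x. E (x + h) - E (x - h) = 2 * h * (lxf lam h f v n x - lxf lam h g v' n x)"
    "\<And>x. \<bar>E x\<bar> \<le> M + real n * (lam * h) * \<rho>"
proof -
  interpret F: cfl lam L f by fact
  interpret G: cfl lam L g by fact
  have "\<exists>E. (\<forall>x. E (x + h) - E (x - h) = 2 * h * (lxf lam h f v n x - lxf lam h g v' n x))
      \<and> (\<forall>x. \<bar>E x\<bar> \<le> M + real n * (lam * h) * \<rho>)"
  proof (induction n)
    case 0
    show ?case by (rule exI[of _ D]) (use D in simp)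
  next
    case (Suc n)
    define a where "a = lxf lam h f v n"
    define b where "b = lxf lam h g v' n"
    obtain E where E: "\<And>x. E (x + h) - E (x - h) = 2 * h * (a x - b x)"
      "\<And>x. \<bar>E x\<bar> \<le> M + real n * (lam * h) * \<rho>" using Suc unfolding a_def b_def by blast
    \<comment> \<open>The primitive of the updated difference. Its increment over
      \<open>2 * h\<close> reproduces the two updates because the averages telescope.\<close>
    define E' where "E' x = (E (x - h) + E (x + h)) / 2 - lam * h * (f (a x) - g (b x))" for x
    have "E' (x + h) - E' (x - h) = 2 * h * (lxf_flux lam f (a (x - h)) (a (x + h)) - lxf_flux lam g (b (x - h)) (b (x + h)))" for x
    proof -
      have e1: "E (x + h + h) - E (x + h - h) = 2 * h * (a (x + h) - b (x + h))" using E(1)[of "x + h"] .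
      have e2: "E (x - h + h) - E (x - h - h) = 2 * h * (a (x - h) - b (x - h))" using E(1)[of "x - h"] .
      have "E' (x + h) - E' (x - h) = (E (x + h + h) - E (x + h - h)) / 2 + (E (x - h + h) - E (x - h - h)) / 2
          - lam * h * (f (a (x + h)) - g (b (x + h))) + lam * h * (f (a (x - h)) - g (b (x - h)))"
        unfolding E'_def by (simp add: field_simps)
      then show ?thesis unfolding e1 e2 lxf_flux_def by (simp add: field_simps)
    qed
    moreover have "\<bar>E' x\<bar> \<le> M + real (Suc n) * (lam * h) * \<rho>" for x
    proof -
      have lh: "0 < lam * h" using h F.lam_pos by simp
      have bx: "b x \<in> {lo..hi}" unfolding b_def by (rule G.lxf_range) (rule v')
      have "lam * h * \<bar>f (a x) - g (b x)\<bar> \<le> h * (lam * \<bar>f (a x) - f (b x)\<bar>) + lam * h * \<bar>f (b x) - g (b x)\<bar>"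
      proof -
        have "\<bar>f (a x) - g (b x)\<bar> \<le> \<bar>f (a x) - f (b x)\<bar> + \<bar>f (b x) - g (b x)\<bar>" by linarith
        from mult_left_mono[OF this, of "lam * h"] lh show ?thesis by (simp add: algebra_simps)
      qed
      also have "\<dots> \<le> h * \<bar>a x - b x\<bar> + lam * h * \<rho>"
        using h lh by (intro add_mono mult_left_mono F.lam_g fg bx) auto
      also have "h * \<bar>a x - b x\<bar> = \<bar>E (x + h) - E (x - h)\<bar> / 2"
        unfolding E(1) using h by (simp add: abs_mult)
      finally have "\<bar>lam * h * (f (a x) - g (b x))\<bar> \<le> \<bar>E (x + h) - E (x - h)\<bar> / 2 + lam * h * \<rho>"
        unfolding abs_mult[of "lam * h"] abs_of_pos[OF lh] .
      \<comment> \<open>The maximum principle: the mean of \<open>y\<close> and \<open>z\<close>,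
        displaced by half their distance, is still between them, so only \<open>p\<close> is lost.
        The CFL condition keeps the displacement that small.\<close>
      moreover have "\<bar>(y + z) / 2 - d\<bar> \<le> N + p" if "\<bar>d\<bar> \<le> \<bar>z - y\<bar> / 2 + p" "\<bar>y\<bar> \<le> N" "\<bar>z\<bar> \<le> N" for y z d N p :: real
        using that by (auto simp: abs_if field_simps split: if_splits)
      ultimately have "\<bar>E' x\<bar> \<le> (M + real n * (lam * h) * \<rho>) + lam * h * \<rho>"
        unfolding E'_def using E(2) by blast
      then show ?thesis by (simp add: algebra_simps)
    qed
    ultimately show ?case unfolding lxf_Suc a_def b_def by blast
  qed
  then show thesis using that by blast
qed

text \<open>\<open>discrete_interpolation\<close> is applied on every grid of spacing
  \<open>2 * h\<close> that meets one cell, and the result is integrated over that cell. The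
  variation bound is \<open>2 * B\<close> because the difference involves two scheme
  solutions.\<close>

lemma lxf_difference:
  assumes "cfl lam L f" "cfl lam L g" and h: "0 < h"
    and fg: "\<And>a. a \<in> {lo..hi} \<Longrightarrow> \<bar>f a - g a\<bar> \<le> \<rho>"
    and v: "\<And>x. v x \<in> {lo..hi}" and v': "\<And>x. v' x \<in> {lo..hi}"
    and meas [measurable]: "v \<in> borel_measurable borel" "v' \<in> borel_measurable borel"
    and D: "\<And>x. D (x + h) - D (x - h) = 2 * h * (v x - v' x)" "\<And>x. \<bar>D x\<bar> \<le> M"
    and far: "\<And>x. x < -X \<Longrightarrow> v x = uL" "\<And>x. X \<le> x \<Longrightarrow> v x = uR"
      "\<And>x. x < -X \<Longrightarrow> v' x = uL" "\<And>x. X \<le> x \<Longrightarrow> v' x = uR" and X: "0 \<le> X"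
    and TV: "\<And>x0 p K. 0 < p \<Longrightarrow> (\<Sum>j<K. \<bar>v (x0 + p * real (Suc j)) - v (x0 + p * real j)\<bar>) \<le> B"
      "\<And>x0 p K. 0 < p \<Longrightarrow> (\<Sum>j<K. \<bar>v' (x0 + p * real (Suc j)) - v' (x0 + p * real j)\<bar>) \<le> B"
    and \<eta>: "0 < \<eta>"
  shows "(\<integral>\<^sup>+x. ennreal \<bar>lxf lam h f v n x - lxf lam h g v' n x\<bar> \<partial>lborel)
    \<le> ennreal ((M + real n * (lam * h) * \<rho>) * (2 * B) / \<eta> + (2 * (X + real n * h) + 6 * h) * \<eta> / 4)"
proof -
  interpret F: cfl lam L f by fact
  interpret G: cfl lam L g by fact
  define w where "w x = lxf lam h f v n x - lxf lam h g v' n x" for x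
  have [measurable]: "w \<in> borel_measurable borel"
    unfolding w_def[abs_def] by (intro borel_measurable_diff F.lxf_measurable G.lxf_measurable meas)
  obtain E where E: "\<And>x. E (x + h) - E (x - h) = 2 * h * w x" "\<And>x. \<bar>E x\<bar> \<le> M + real n * (lam * h) * \<rho>"
    unfolding w_def using lxf_primitive[where n=n, OF assms(1,2) h fg v v' D] by blast
  define M' where "M' = M + real n * (lam * h) * \<rho>"
  have M': "0 \<le> M'" using E(2)[of 0] unfolding M'_def by linarith
  have B: "0 \<le> B" using TV(1)[of 1 0 0] by simp
  define Y where "Y = X + real n * h"
  have Y: "0 \<le> Y" using X h by (simp add: Y_def)
  have w0: "w x = 0" if "x < - Y \<or> Y \<le> x" for x
    using that
  proof
    assume "x < - Y"
    then have x: "x < - X - real n * h" by (simp add: Y_def)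
    show ?thesis using F.lxf_far(1)[OF far(1,2) h x] G.lxf_far(1)[OF far(3,4) h x] by (simp add: w_def)
  next
    assume "Y \<le> x"
    then have x: "X + real n * h \<le> x" by (simp add: Y_def)
    show ?thesis using F.lxf_far(2)[OF far(1,2) h x] G.lxf_far(2)[OF far(3,4) h x] by (simp add: w_def)
  qed
  \<comment> \<open>Every grid that starts in the first cell begins to the left of
    \<open>- Y\<close> and ends to the right of \<open>Y\<close>, where \<open>w\<close> vanishes.
    Margins and rounding make up the \<open>6 * h\<close>.\<close>
  define a where "a = - Y - 2 * h"
  define K where "K = nat \<lceil>(2 * Y + 4 * h) / (2 * h)\<rceil>"
  have K: "2 * Y + 4 * h \<le> real K * (2 * h)" "real K * (2 * h) \<le> 2 * Y + 6 * h"
  proof -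
    have pos: "0 \<le> (2 * Y + 4 * h) / (2 * h)" using Y h by simp
    have "(2 * Y + 4 * h) / (2 * h) \<le> real K" unfolding K_def by (rule real_nat_ceiling_ge)
    then show "2 * Y + 4 * h \<le> real K * (2 * h)" using h by (simp add: field_simps)
    have "real K \<le> (2 * Y + 4 * h) / (2 * h) + 1" unfolding K_def using pos by linarith
    then show "real K * (2 * h) \<le> 2 * Y + 6 * h" using h by (simp add: field_simps)
  qed
  have p: "0 < 2 * h" using h by simp
  define Z where "Z = M' * (2 * B) / \<eta> + 2 * h * real K * \<eta> / 4"
  have grid: "(2 * h) * (\<Sum>j<K. \<bar>w (x + 2 * h * real j)\<bar>) \<le> Z" if x: "x \<in> {a..<a + 2 * h}" for x
    unfolding Z_def
  proof (rule discrete_interpolation)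
    \<comment> \<open>The primitive is sampled at points interlaced with those of \<open>w\<close>,
      at distance \<open>h\<close> to the left.\<close>
    show "E (x + 2 * h * real (Suc j) - h) - E (x + 2 * h * real j - h) = 2 * h * w (x + 2 * h * real j)" for j
      using E(1)[of "x + 2 * h * real j"] by (simp add: algebra_simps)
    show "\<bar>E (x + 2 * h * real j - h)\<bar> \<le> M'" for j using E(2) unfolding M'_def by blast
    show "w (x + 2 * h * real 0) = 0" using x by (intro w0) (simp add: a_def)
    show "w (x + 2 * h * real K) = 0"
      using x K(1) h by (intro w0) (simp add: a_def algebra_simps)
    have "(\<Sum>j<K. \<bar>w (x + 2 * h * real (Suc j)) - w (x + 2 * h * real j)\<bar>)
       \<le> (\<Sum>j<K. \<bar>lxf lam h f v n (x + 2 * h * real (Suc j)) - lxf lam h f v n (x + 2 * h * real j)\<bar>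
           + \<bar>lxf lam h g v' n (x + 2 * h * real (Suc j)) - lxf lam h g v' n (x + 2 * h * real j)\<bar>)"
      unfolding w_def by (intro sum_mono) linarith
    also have "\<dots> \<le> B + B" unfolding sum.distrib
      by (intro add_mono F.lxf_grid_TV G.lxf_grid_TV TV p)
    finally show "(\<Sum>j<K. \<bar>w (x + 2 * h * real (Suc j)) - w (x + 2 * h * real j)\<bar>) \<le> 2 * B" by simp
  qed (use \<eta> h in auto)
  have Z: "0 \<le> Z" unfolding Z_def using M' B \<eta> h by simp
  have "(\<integral>\<^sup>+x. ennreal \<bar>w x\<bar> \<partial>lborel) = (\<integral>\<^sup>+x. ennreal \<bar>w x\<bar> * indicator {a..<a + real K * (2 * h)} x \<partial>lborel)"
  proof (intro nn_integral_cong)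
    fix x
    show "ennreal \<bar>w x\<bar> = ennreal \<bar>w x\<bar> * indicator {a..<a + real K * (2 * h)} x"
      using w0[of x] K(1) h by (cases "x \<in> {a..<a + real K * (2 * h)}") (auto simp: a_def)
  qed
  also have "\<dots> = (\<integral>\<^sup>+x. (\<Sum>j<K. ennreal \<bar>w (x + 2 * h * real j)\<bar>) * indicator {a..<a + 2 * h} x \<partial>lborel)"
    by (rule nn_integral_grid[OF _ p]) measurable
  also have "\<dots> \<le> (\<integral>\<^sup>+x. ennreal (Z / (2 * h)) * indicator {a..<a + 2 * h} x \<partial>lborel)"
  proof (rule nn_integral_mono)
    fix x
    show "(\<Sum>j<K. ennreal \<bar>w (x + 2 * h * real j)\<bar>) * indicator {a..<a + 2 * h} x
        \<le> ennreal (Z / (2 * h)) * indicator {a..<a + 2 * h} x"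
    proof (cases "x \<in> {a..<a + 2 * h}")
      case True
      have "(\<Sum>j<K. ennreal \<bar>w (x + 2 * h * real j)\<bar>) = ennreal (\<Sum>j<K. \<bar>w (x + 2 * h * real j)\<bar>)"
        by (rule sum_ennreal) simp
      also have "\<dots> \<le> ennreal (Z / (2 * h))" using grid[OF True] h by (intro ennreal_leI) (simp add: field_simps)
      finally show ?thesis by (rule mult_right_mono) simp
    qed simp
  qed
  also have "\<dots> = ennreal Z" using h Z by (simp add: nn_integral_cmult_indicator ennreal_mult[symmetric])
  also have "\<dots> \<le> ennreal (M' * (2 * B) / \<eta> + (2 * Y + 6 * h) * \<eta> / 4)"
    unfolding Z_def using K(2) \<eta> by (intro ennreal_leI add_left_mono divide_right_mono mult_right_mono) (auto simp: mult.commute)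
  finally show ?thesis unfolding w_def M'_def Y_def .
qed

section \<open>Variation along monotone sequences and the initial primitive\<close>

lemma total_variation_sum:
  assumes "total_variation_on S v \<le> ennreal B" "0 \<le> B" "mono p" "\<And>i. p i \<in> S"
  shows "(\<Sum>i<n. \<bar>v (p (Suc i)) - v (p i)\<bar>) \<le> B"
proof -
  define xs where "xs = map p [0..<Suc n]"
  have "sorted xs" unfolding xs_def sorted_wrt_map
    by (rule sorted_wrt_mono_rel[OF _ sorted_upt]) (use assms(3) in \<open>auto dest: monoD\<close>)
  then have xs: "xs \<in> {xs. sorted xs \<and> set xs \<subseteq> S}" using assms(4) by (auto simp: xs_def)
  have nth: "xs ! i = p i" if "i \<le> n" for i
  proof -
    have "i < length [0..<Suc n]" "[0..<Suc n] ! i = i" using that by (simp_all del: upt_Suc)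
    then show ?thesis unfolding xs_def by (simp only: nth_map)
  qed
  have len: "length xs - 1 = n" by (simp add: xs_def)
  have "ennreal (\<Sum>i<n. \<bar>v (p (Suc i)) - v (p i)\<bar>) = (\<Sum>i<n. ennreal \<bar>v (p (Suc i)) - v (p i)\<bar>)"
    by (rule sum_ennreal[symmetric]) simp
  also have "\<dots> = (\<Sum>i<length xs - 1. ennreal \<bar>v (xs ! Suc i) - v (xs ! i)\<bar>)"
    unfolding len by (intro sum.cong refl) (simp add: nth)
  also have "\<dots> \<le> total_variation_on S v"
    unfolding total_variation_on_def by (rule SUP_upper[OF xs])
  also have "\<dots> \<le> ennreal B" by (rule assms(1))
  finally show ?thesis by (simp only: ennreal_le_iff[OF assms(2)])
qed

text \<open>A real bound on the pointwise variation, stated with monotone sequences in place of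
  sorted lists, so that equidistant grids and interleaved pairs can be inserted directly.\<close>

definition bounded_variation :: "real \<Rightarrow> (real \<Rightarrow> real) \<Rightarrow> bool" where
  "bounded_variation B v \<longleftrightarrow> (\<forall>p n. mono p \<longrightarrow> (\<Sum>i<n. \<bar>v (p (Suc i)) - v (p i)\<bar>) \<le> B)"

lemma bounded_variation_grid:
  assumes "bounded_variation B v" "0 < p"
  shows "(\<Sum>j<K. \<bar>v (x0 + p * real (Suc j)) - v (x0 + p * real j)\<bar>) \<le> B"
proof -
  have "mono (\<lambda>j. x0 + p * real j)" using assms(2) by (intro monoI) simp
  then show ?thesis using assms(1) unfolding bounded_variation_def by blast
qed

lemma bounded_variation_pairs:
  assumes "bounded_variation B v" "\<bar>x - y\<bar> \<le> p"
  shows "(\<Sum>j<K. \<bar>v (x + p * real j) - v (y + p * real j)\<bar>) \<le> B"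
proof -
  \<comment> \<open>The points of the translated pairs are interleaved in increasing order, which is
    possible because \<open>\<bar>x - y\<bar> \<le> p\<close>; every other increment is a difference
    within a pair.\<close>
  define q where "q i = (if even i then min x y else max x y) + p * real (i div 2)" for i
  have p: "0 \<le> p" using assms(2) by linarith
  have "mono q" unfolding mono_iff_le_Suc
  proof
    fix i
    show "q i \<le> q (Suc i)"
    proof (cases "even i")
      case True then show ?thesis by (auto simp: q_def)
    next
      case False
      then have "real (Suc i div 2) = real (i div 2) + 1" by (auto elim!: oddE)
      then show ?thesis using False assms(2) unfolding q_def by (auto simp: algebra_simps min_def max_def abs_if split: if_splits)
    qed
  qed
  then have "(\<Sum>i<2*K. \<bar>v (q (Suc i)) - v (q i)\<bar>) \<le> B" using assms(1) unfolding bounded_variation_def by blast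
  moreover have "(\<Sum>j<K. \<bar>v (x + p * real j) - v (y + p * real j)\<bar>) \<le> (\<Sum>i<2*K. \<bar>v (q (Suc i)) - v (q i)\<bar>)"
  proof (induction K)
    case (Suc K)
    have "\<bar>v (x + p * real K) - v (y + p * real K)\<bar> = \<bar>v (q (Suc (2*K))) - v (q (2*K))\<bar>"
      by (auto simp: q_def min_def max_def)
    then show ?case using Suc by simp
  qed simp
  ultimately show ?thesis by linarith
qed

lemma integral_grid:
  fixes f :: "real \<Rightarrow> real"
  assumes f: "integrable lborel f" and p: "0 < p"
  shows "integrable lborel (\<lambda>x. (\<Sum>j<K. f (x + p * real j)) * indicator {a..<a + p} x)"
    "(LINT x|lborel. f x * indicator {a..<a + real K * p} x)
     = (LINT x|lborel. (\<Sum>j<K. f (x + p * real j)) * indicator {a..<a + p} x)"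
proof -
  have shift: "integrable lborel (\<lambda>x. f (x + d))" for d
    using lborel_integrable_real_affine[OF f, of 1 d] by (simp add: add.commute)
  have ind: "integrable lborel (\<lambda>x. h x * indicator {b..<c} x :: real)" if "integrable lborel h" for h and b c :: real
    using integrable_real_mult_indicator[OF _ that, of "{b..<c}"] by simp
  show int: "integrable lborel (\<lambda>x. (\<Sum>j<K. f (x + p * real j)) * indicator {a..<a + p} x)" for K
    by (intro ind Bochner_Integration.integrable_sum shift)
  show "(LINT x|lborel. f x * indicator {a..<a + real K * p} x)
     = (LINT x|lborel. (\<Sum>j<K. f (x + p * real j)) * indicator {a..<a + p} x)"
  proof (induction K)
    case (Suc K)
    define b where "b = a + real K * p"
    have b: "a \<le> b" "a + real (Suc K) * p = b + p" using p by (simp_all add: b_def algebra_simps)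
    have "(LINT x|lborel. f x * indicator {a..<a + real (Suc K) * p} x)
       = (LINT x|lborel. f x * indicator {a..<b} x + f x * indicator {b..<b + p} x)"
      unfolding b(2) using p b(1) by (intro Bochner_Integration.integral_cong) (auto simp: indicator_def)
    also have "\<dots> = (LINT x|lborel. f x * indicator {a..<b} x) + (LINT x|lborel. f x * indicator {b..<b + p} x)"
      by (intro Bochner_Integration.integral_add ind f)
    also have "(LINT x|lborel. f x * indicator {b..<b + p} x) = (LINT x|lborel. f (x + p * real K) * indicator {a..<a + p} x)"
      by (subst lborel_integral_real_affine[of 1 _ "real K * p"])
         (auto intro!: Bochner_Integration.integral_cong simp: b_def indicator_def algebra_simps)
    also have "(LINT x|lborel. f x * indicator {a..<b} x) = (LINT x|lborel. (\<Sum>j<K. f (x + p * real j)) * indicator {a..<a + p} x)"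
      unfolding b_def by (rule Suc)
    finally show ?case
      using int[of K] ind[OF shift[of "p * real K"], of a "a + p"]
      by (subst (asm) Bochner_Integration.integral_add[symmetric]) (auto simp: distrib_right)
  qed simp
qed

text \<open>The discrete primitive is a Riemann sum of the continuous one. Sampling points and
  integration points can be paired at distance at most \<open>2 * h\<close>, so along each grid the
  two sums differ by at most \<open>2 * B\<close>; integrating over a cell gives
  \<open>4 * h * B\<close>.\<close>

lemma initial_primitive:
  assumes meas [measurable]: "v \<in> borel_measurable borel" "v' \<in> borel_measurable borel"
    and bv: "bounded_variation B v" "bounded_variation B v'"
    and bd: "\<And>x. \<bar>v x - v' x\<bar> \<le> C"
    and far: "\<And>x. x \<notin> {-X..X} \<Longrightarrow> v x = v' x"
    and M: "\<And>x. \<bar>LINT y|lborel. (v y - v' y) * indicator {..<x} y\<bar> \<le> M" and h: "0 < h"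
  obtains D where "\<And>x. D (x + h) - D (x - h) = 2 * h * (v x - v' x)" "\<And>x. \<bar>D x\<bar> \<le> M + 4 * h * B"
proof -
  define w where "w x = v x - v' x" for x
  have [measurable]: "w \<in> borel_measurable borel" unfolding w_def[abs_def] by measurable
  have w0: "w x = 0" if "x \<notin> {-X..X}" for x using far[OF that] by (simp add: w_def)
  have w_int: "integrable lborel w"
    by (rule integrable_bounded_support[of _ C "-X" X]) (use bd w0 in \<open>auto simp: w_def\<close>)
  \<comment> \<open>The sum runs over sampling points at odd multiples of \<open>h\<close> to the
    left of \<open>x\<close>; it is finite because \<open>w\<close> vanishes to the left of
    \<open>- X\<close>.\<close>
  define D where "D x = (\<Sum>i. 2 * h * w (x - (2 * real i + 1) * h))" for x
  have zero: "w (x - (2 * real i + 1) * h) = 0" if "nat \<lceil>(x + X) / (2 * h)\<rceil> \<le> i" for x i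
  proof -
    have "(x + X) / (2 * h) \<le> real i" using that by linarith
    then have "x + X \<le> real i * (2 * h)" using h by (simp add: field_simps)
    then have "x - (2 * real i + 1) * h < - X" using h by (simp add: algebra_simps)
    then show ?thesis by (intro w0) auto
  qed
  have summ: "summable (\<lambda>i. 2 * h * w (x - (2 * real i + 1) * h))" for x
  proof (rule summable_finite[of "{..<nat \<lceil>(x + X) / (2 * h)\<rceil>}"])
    show "2 * h * w (x - (2 * real i + 1) * h) = 0" if "i \<notin> {..<nat \<lceil>(x + X) / (2 * h)\<rceil>}" for i
      using zero[of x i] that unfolding lessThan_iff not_less by simp
  qed simp
  have "D (x + h) - D (x - h) = 2 * h * w x" for x
  proof -
    have "D (x + h) = 2 * h * w (x + h - (2 * real 0 + 1) * h) + (\<Sum>i. 2 * h * w (x + h - (2 * real (Suc i) + 1) * h))"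
      unfolding D_def using suminf_split_head[OF summ[of "x + h"]] by linarith
    also have "(\<lambda>i. 2 * h * w (x + h - (2 * real (Suc i) + 1) * h)) = (\<lambda>i. 2 * h * w (x - h - (2 * real i + 1) * h))"
      by (intro ext) (simp add: algebra_simps)
    finally show ?thesis unfolding D_def by simp
  qed
  moreover have "\<bar>D x\<bar> \<le> M + 4 * h * B" for x
  proof -
    \<comment> \<open>The extra cell makes \<open>a < - X\<close> strict, so that the integral of
      \<open>w\<close> up to \<open>x\<close> may start at \<open>a\<close>.\<close>
    define N where "N = nat \<lceil>(x + X) / (2 * h)\<rceil> + 1"
    define a where "a = x - real N * (2 * h)"
    have aN: "a + real N * (2 * h) = x" by (simp add: a_def)
    have aX: "a < -X"
    proof -
      have "(x + X) / (2 * h) + 1 \<le> real N" unfolding N_def by linarith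
      then have "x + X + 2 * h \<le> real N * (2 * h)" using h by (simp add: field_simps)
      then show ?thesis using h by (simp add: a_def)
    qed
    let ?I = "indicator {a..<a + 2 * h} :: real \<Rightarrow> real"
      and ?S = "\<Sum>j<N. w (a + h + 2 * h * real j)" and ?G = "\<lambda>y. \<Sum>j<N. w (y + 2 * h * real j)"
    have "D x = (\<Sum>i<N. 2 * h * w (x - (2 * real i + 1) * h))"
      unfolding D_def
    proof (rule suminf_finite)
      show "2 * h * w (x - (2 * real i + 1) * h) = 0" if "i \<notin> {..<N}" for i
      proof -
        have "nat \<lceil>(x + X) / (2 * h)\<rceil> \<le> i" using that unfolding N_def lessThan_iff not_less by linarith
        from zero[OF this] show ?thesis by simp
      qed
    qed simp
    also have "\<dots> = (\<Sum>j<N. 2 * h * w (x - (2 * real (N - Suc j) + 1) * h))"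
      by (rule sum.nat_diff_reindex[symmetric])
    also have "\<dots> = (\<Sum>j<N. 2 * h * w (a + h + 2 * h * real j))"
    proof (intro sum.cong refl)
      fix j assume "j \<in> {..<N}"
      then have "Suc j \<le> N" by simp
      then have N: "real (N - Suc j) = real N - (real j + 1)" by (simp add: of_nat_diff)
      have "x - (2 * real (N - Suc j) + 1) * h = a + h + 2 * h * real j"
        unfolding N a_def by (simp add: algebra_simps)
      then show "2 * h * w (x - (2 * real (N - Suc j) + 1) * h) = 2 * h * w (a + h + 2 * h * real j)"
        by (simp only:)
    qed
    \<comment> \<open>The factor \<open>2 * h\<close> is the length of a cell. Spreading the sum
      over the cell makes both primitives integrals over the same interval.\<close>
    also have "\<dots> = (LINT y|lborel. ?S * ?I y)"
    proof -
      have "(LINT y|lborel. S * ?I y) = 2 * h * S" for S :: real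
        using h by simp
      then show ?thesis by (simp only: sum_distrib_left)
    qed
    finally have Dx: "D x = (LINT y|lborel. ?S * ?I y)" .
    have "(LINT y|lborel. w y * indicator {..<x} y) = (LINT y|lborel. w y * indicator {a..<a + real N * (2 * h)} y)"
      unfolding aN using w0 aX by (intro Bochner_Integration.integral_cong) (auto simp: indicator_def)
    also have "\<dots> = (LINT y|lborel. ?G y * ?I y)"
      using integral_grid(2)[OF w_int, of "2 * h" a N] h by simp
    finally have Wx: "(LINT y|lborel. w y * indicator {..<x} y) = (LINT y|lborel. ?G y * ?I y)" .
    have i1: "integrable lborel (\<lambda>y. K * ?I y)" for K :: real
      by (rule integrable_bounded_support[of _ "\<bar>K\<bar>" a "a + 2 * h"]) (auto simp: indicator_def)
    have i2: "integrable lborel (\<lambda>y. ?G y * ?I y)"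
      using integral_grid(1)[OF w_int, of "2 * h"] h by simp
    have "\<bar>D x - (LINT y|lborel. w y * indicator {..<x} y)\<bar>
      = \<bar>LINT y|lborel. ?S * ?I y
          - ?G y * ?I y\<bar>"
      unfolding Dx Wx by (subst Bochner_Integration.integral_diff[OF i1 i2]) simp
    also have "\<dots> \<le> (LINT y|lborel. \<bar>?S * ?I y
          - ?G y * ?I y\<bar>)"
      by (rule integral_abs_bound)
    also have "\<dots> \<le> (LINT y|lborel. (2 * B) * ?I y)"
    proof (intro integral_mono i1 integrable_abs Bochner_Integration.integrable_diff i2)
      fix y
      show "\<bar>?S * ?I y
          - ?G y * ?I y\<bar> \<le> (2 * B) * ?I y"
      proof (cases "y \<in> {a..<a + 2 * h}")
        case True
        then have ay: "\<bar>(a + h) - y\<bar> \<le> 2 * h" using h by auto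
        have "\<bar>?S - ?G y\<bar>
           \<le> (\<Sum>j<N. \<bar>w (a + h + 2 * h * real j) - w (y + 2 * h * real j)\<bar>)"
          unfolding sum_subtractf[symmetric] by (rule sum_abs)
        also have "\<dots> \<le> (\<Sum>j<N. \<bar>v (a + h + 2 * h * real j) - v (y + 2 * h * real j)\<bar>
            + \<bar>v' (a + h + 2 * h * real j) - v' (y + 2 * h * real j)\<bar>)"
          unfolding w_def by (intro sum_mono) linarith
        also have "\<dots> \<le> B + B" unfolding sum.distrib
          by (intro add_mono bounded_variation_pairs bv ay)
        finally show ?thesis using True by simp
      qed simp
    qed
    also have "\<dots> = 4 * h * B" using h by simp
    finally show ?thesis using M[of x] unfolding w_def[symmetric] by linarith
  qed
  ultimately show thesis using that unfolding w_def by blast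
qed

section \<open>Cell averages and interpolation\<close>

lemma total_variation_oscillation:
  assumes "total_variation_on S v \<le> ennreal B" "0 \<le> B" "x \<in> S" "y \<in> S"
  shows "\<bar>v x - v y\<bar> \<le> B"
proof -
  define p where "p i = (if i = 0 then min x y else max x y)" for i :: nat
  have "mono p" by (rule monoI) (auto simp: p_def)
  moreover have "p i \<in> S" for i using assms(3,4) by (auto simp: p_def min_def max_def)
  ultimately have "(\<Sum>i<1. \<bar>v (p (Suc i)) - v (p i)\<bar>) \<le> B" by (rule total_variation_sum[OF assms(1,2)])
  then show ?thesis by (auto simp: p_def min_def max_def split: if_splits)
qed

text \<open>Inside the cell \<open>u\<close> stays within \<open>\<delta>\<close> of its average, so
  the primitive grows at rate at most \<open>\<delta>\<close>; over the whole cell the deviations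
  from the average cancel. The oscillation is controlled only on the open cell, whose end points
  form a null set.\<close>

lemma cell_average:
  fixes u v :: "real \<Rightarrow> real"
  assumes ab: "a < b" and u_meas [measurable]: "u \<in> borel_measurable borel" and ubd: "\<And>x. \<bar>u x\<bar> \<le> C"
    and osc: "\<And>x y. x \<in> {a<..<b} \<Longrightarrow> y \<in> {a<..<b} \<Longrightarrow> \<bar>u x - u y\<bar> \<le> \<delta>"
    and v: "\<And>x. x \<in> {a..<b} \<Longrightarrow> v x = 1 / (b - a) * (LINT y:{a..b}|lborel. u y)"
  shows "(LINT y|lborel. (u y - v y) * indicator {a..<b} y) = 0"
    "c \<in> {a..b} \<Longrightarrow> \<bar>LINT y|lborel. (u y - v y) * indicator {a..<c} y\<bar> \<le> \<delta> * (c - a)"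
proof -
  define m where "m = 1 / (b - a) * (LINT y:{a..b}|lborel. u y)"
  have int: "integrable lborel (\<lambda>y. u y * indicator {a..<c} y)" for c
    by (rule integrable_bounded_support[of _ C a c])
       (use ubd order_trans[OF abs_ge_zero ubd[of 0]] in \<open>auto simp: indicator_def\<close>)
  have intK: "integrable lborel (\<lambda>y. K * indicator {a..<c} y)" for K c :: real
    by (rule integrable_bounded_support[of _ "\<bar>K\<bar>" a c]) (auto simp: indicator_def)
  have "(LINT y:{a..b}|lborel. u y) = (LINT y|lborel. u y * indicator {a..<b} y)"
    unfolding set_lebesgue_integral_def
  proof (rule integral_cong_AE)
    show "AE y in lborel. indicator {a..b} y *\<^sub>R u y = u y * indicator {a..<b} y"
      using AE_lborel_singleton[of b] by eventually_elim (use ab in \<open>auto simp: indicator_def\<close>)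
  qed measurable
  then have m: "m * (b - a) = (LINT y|lborel. u y * indicator {a..<b} y)"
    using ab by (simp add: m_def)
  have eq: "(LINT y|lborel. (u y - v y) * indicator {a..<c} y) = (LINT y|lborel. u y * indicator {a..<c} y) - m * (c - a)"
    if "c \<in> {a..b}" for c
  proof -
    have "(LINT y|lborel. (u y - v y) * indicator {a..<c} y)
      = (LINT y|lborel. u y * indicator {a..<c} y - m * indicator {a..<c} y)"
      using that v by (intro Bochner_Integration.integral_cong refl) (auto simp: indicator_def m_def)
    also have "\<dots> = (LINT y|lborel. u y * indicator {a..<c} y) - m * (c - a)"
      using int intK[of m] that by (subst Bochner_Integration.integral_diff) auto
    finally show ?thesis .
  qed
  show "(LINT y|lborel. (u y - v y) * indicator {a..<b} y) = 0"
    using eq[of b] m ab by simp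
  \<comment> \<open>\<open>m\<close> is the average of values each of which is within
    \<open>\<delta>\<close> of \<open>u x\<close>.\<close>
  have um: "\<bar>u x - m\<bar> \<le> \<delta>" if x: "x \<in> {a<..<b}" for x
  proof -
    have "(b - a) * (u x - m) = (LINT y|lborel. u x * indicator {a..<b} y - u y * indicator {a..<b} y)"
      using int intK[of "u x"] m ab by (subst Bochner_Integration.integral_diff) (auto simp: algebra_simps)
    also have "\<bar>\<dots>\<bar> \<le> (LINT y|lborel. \<bar>u x * indicator {a..<b} y - u y * indicator {a..<b} y\<bar>)"
      by (rule integral_abs_bound)
    also have "\<dots> \<le> (LINT y|lborel. \<delta> * indicator {a..<b} y)"
    proof (rule integral_mono_AE)
      show "AE y in lborel. \<bar>u x * indicator {a..<b} y - u y * indicator {a..<b} y\<bar> \<le> \<delta> * indicator {a..<b} y"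
        using AE_lborel_singleton[of a] by eventually_elim (use osc[OF x] in \<open>auto simp: indicator_def\<close>)
    qed (intro integrable_abs Bochner_Integration.integrable_diff int intK)+
    also have "\<dots> = (b - a) * \<delta>" using ab by simp
    finally have "(b - a) * \<bar>u x - m\<bar> \<le> (b - a) * \<delta>" using ab by (simp add: abs_mult)
    then show ?thesis using ab by simp
  qed
  show "\<bar>LINT y|lborel. (u y - v y) * indicator {a..<c} y\<bar> \<le> \<delta> * (c - a)" if c: "c \<in> {a..b}" for c
  proof -
    have "(LINT y|lborel. (u y - v y) * indicator {a..<c} y) = (LINT y|lborel. u y * indicator {a..<c} y - m * indicator {a..<c} y)"
      unfolding eq[OF c] using int intK[of m] c by (subst Bochner_Integration.integral_diff) auto
    also have "\<bar>\<dots>\<bar> \<le> (LINT y|lborel. \<bar>u y * indicator {a..<c} y - m * indicator {a..<c} y\<bar>)"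
      by (rule integral_abs_bound)
    also have "\<dots> \<le> (LINT y|lborel. \<delta> * indicator {a..<c} y)"
    proof (rule integral_mono_AE)
      show "AE y in lborel. \<bar>u y * indicator {a..<c} y - m * indicator {a..<c} y\<bar> \<le> \<delta> * indicator {a..<c} y"
        using AE_lborel_singleton[of a] by eventually_elim (use um c in \<open>auto simp: indicator_def\<close>)
    qed (intro integrable_abs Bochner_Integration.integrable_diff int intK)+
    also have "\<dots> = \<delta> * (c - a)" using c by simp
    finally show ?thesis .
  qed
qed

text \<open>The primitive vanishes at every node \<open>z i\<close>, and between nodes it grows at
  rate at most \<open>\<delta>\<close> over a length of at most \<open>\<delta>\<close>.\<close>

lemma cell_average_primitive:
  assumes v: "cell_average_datum X uL uR \<delta> u v" and \<delta>: "0 < \<delta>"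
    and u_meas [measurable]: "u \<in> borel_measurable borel" and ubd: "\<And>x. \<bar>u x\<bar> \<le> C"
    and v_meas [measurable]: "v \<in> borel_measurable borel" and vbd: "\<And>x. \<bar>v x\<bar> \<le> C"
    and far: "\<And>x. x < -X \<Longrightarrow> u x = uL" "\<And>x. X \<le> x \<Longrightarrow> u x = uR"
  shows "\<bar>LINT y|lborel. (u y - v y) * indicator {..<x} y\<bar> \<le> \<delta>\<^sup>2"
proof -
  have vfar: "\<And>x. x < -X \<Longrightarrow> v x = uL" "\<And>x. X \<le> x \<Longrightarrow> v x = uR"
    using v unfolding cell_average_datum_def by blast+
  obtain M z where z: "z 0 = -X" "z M = X" and
    all: "\<forall>i<M. z i < z (Suc i) \<and> z (Suc i) - z i \<le> \<delta> \<and>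
           total_variation_on {z i<..<z (Suc i)} u \<le> ennreal \<delta> \<and>
           (\<forall>x\<in>{z i..<z (Suc i)}. v x = 1 / (z (Suc i) - z i) * (LINT y:{z i..z (Suc i)}|lborel. u y))"
    using v unfolding cell_average_datum_def by (elim conjE exE)
  have cells: "\<And>i. i < M \<Longrightarrow> z i < z (Suc i)" "\<And>i. i < M \<Longrightarrow> z (Suc i) - z i \<le> \<delta>"
      "\<And>i. i < M \<Longrightarrow> total_variation_on {z i<..<z (Suc i)} u \<le> ennreal \<delta>"
      "\<And>i x. i < M \<Longrightarrow> x \<in> {z i..<z (Suc i)} \<Longrightarrow> v x = 1 / (z (Suc i) - z i) * (LINT y:{z i..z (Suc i)}|lborel. u y)"
    using all by blast+
  define w where "w y = u y - v y" for y
  have [measurable]: "w \<in> borel_measurable borel" unfolding w_def[abs_def] by measurable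
  have w0: "w y = 0" if "y < -X \<or> X \<le> y" for y using that far vfar by (auto simp: w_def)
  have wbd: "\<bar>w y\<bar> \<le> 2 * C" for y using ubd[of y] vbd[of y] by (simp add: w_def)
  have wint: "integrable lborel w"
    by (rule integrable_bounded_support[of _ "2 * C" "-X" X]) (use wbd w0 in auto)
  have ind: "integrable lborel (\<lambda>y. w y * indicator S y)" if "S \<in> sets borel" for S
    using integrable_real_mult_indicator[OF _ wint, of S] that by simp
  have osc: "\<bar>u x - u y\<bar> \<le> \<delta>" if "i < M" "x \<in> {z i<..<z (Suc i)}" "y \<in> {z i<..<z (Suc i)}" for i x y
    using total_variation_oscillation[OF cells(3)[OF that(1)] _ that(2,3)] \<delta> by simp
  have cell0: "(LINT y|lborel. w y * indicator {z i..<z (Suc i)} y) = 0" if "i < M" for i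
    unfolding w_def using cell_average(1)[OF cells(1)[OF that] u_meas ubd osc[OF that] cells(4)[OF that]] by simp
  have cell1: "\<bar>LINT y|lborel. w y * indicator {z i..<c} y\<bar> \<le> \<delta> * (c - z i)" if "i < M" "c \<in> {z i..z (Suc i)}" for i c
    unfolding w_def
    using cell_average(2)[OF cells(1)[OF that(1)] u_meas ubd osc[OF that(1)] cells(4)[OF that(1)] that(2)] by simp
  have split: "(LINT y|lborel. w y * indicator {..<c} y) = (LINT y|lborel. w y * indicator {..<b} y) + (LINT y|lborel. w y * indicator {b..<c} y)"
    if "b \<le> c" for b c
  proof -
    have "(LINT y|lborel. w y * indicator {..<c} y) = (LINT y|lborel. w y * indicator {..<b} y + w y * indicator {b..<c} y)"
      using that by (intro Bochner_Integration.integral_cong refl) (simp add: indicator_def)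
    then show ?thesis by (simp only: Bochner_Integration.integral_add[OF ind ind] borel_measurable_indicator lessThan_borel atLeastLessThan_borel)
  qed
  have left: "(LINT y|lborel. w y * indicator {..<c} y) = 0" if "c \<le> -X" for c
  proof -
    have eq: "w y * indicator {..<c} y = 0" for y using w0[of y] that by (cases "y < c") auto
    show ?thesis unfolding eq by simp
  qed
  have node: "(LINT y|lborel. w y * indicator {..<z i} y) = 0" if "i \<le> M" for i
    using that
  proof (induction i)
    case 0 then show ?case using left z by simp
  next
    case (Suc i) then show ?case using split[of "z i" "z (Suc i)"] cell0[of i] cells(1)[of i] by simp
  qed
  have find: "n \<le> M \<Longrightarrow> x < z n \<Longrightarrow> x < z 0 \<or> (\<exists>i<n. z i \<le> x \<and> x < z (Suc i))" for n
  proof (induction n)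
    case (Suc n) then show ?case by (cases "x < z n") (auto intro: less_SucI)
  qed simp
  consider "x < -X" | i where "i < M" "z i \<le> x" "x < z (Suc i)" | "X \<le> x"
    using find[of M] z by fastforce
  then have "\<bar>LINT y|lborel. w y * indicator {..<x} y\<bar> \<le> \<delta>\<^sup>2"
  proof cases
    case 1 then show ?thesis using left[of x] by simp
  next
    case (2 i)
    have "\<bar>LINT y|lborel. w y * indicator {..<x} y\<bar> \<le> \<delta> * (x - z i)"
      using split[OF 2(2)] node[of i] cell1[of i x] 2 by simp
    also have "\<dots> \<le> \<delta> * \<delta>" using cells(2)[OF 2(1)] 2 \<delta> by (intro mult_left_mono) auto
    finally show ?thesis by (simp add: power2_eq_square)
  next
    case 3
    have eq: "w y * indicator {X..<x} y = 0" for y using w0[of y] by (cases "X \<le> y") auto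
    show ?thesis unfolding split[OF 3] eq using node[of M] z by simp
  qed
  then show ?thesis unfolding w_def .
qed

text \<open>A positive value at \<open>v\<close> would force a positive slope before
  \<open>v\<close> and a negative one after it, whereas the slope is nondecreasing.\<close>

lemma nonpos_of_second_derivative_nonneg:
  fixes h :: "real \<Rightarrow> real"
  assumes cont: "continuous_on {a..b} h" and ends: "h a = 0" "h b = 0"
    and h': "\<And>x. a < x \<Longrightarrow> x < b \<Longrightarrow> (h has_real_derivative h' x) (at x)"
    and h'': "\<And>x. a < x \<Longrightarrow> x < b \<Longrightarrow> (h' has_real_derivative h'' x) (at x)"
    and pos: "\<And>x. a < x \<Longrightarrow> x < b \<Longrightarrow> 0 \<le> h'' x" and v: "a < v" "v < b"
  shows "h v \<le> 0"
proof -
  obtain p where p: "a < p" "p < v" "h v - h a = (v - a) * h' p"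
  proof -
    have "\<exists>l z. a < z \<and> z < v \<and> DERIV h z :> l \<and> h v - h a = (v - a) * l"
    proof (rule MVT)
      show "h differentiable (at x)" if "a < x" "x < v" for x
        using h'[of x] that v unfolding real_differentiable_def by auto
    qed (use v cont in \<open>auto intro: continuous_on_subset\<close>)
    then show thesis using that h' v DERIV_unique by (metis less_trans)
  qed
  obtain q where q: "v < q" "q < b" "h b - h v = (b - v) * h' q"
  proof -
    have "\<exists>l z. v < z \<and> z < b \<and> DERIV h z :> l \<and> h b - h v = (b - v) * l"
    proof (rule MVT)
      show "h differentiable (at x)" if "v < x" "x < b" for x
        using h'[of x] that v unfolding real_differentiable_def by auto
    qed (use v cont in \<open>auto intro: continuous_on_subset\<close>)
    then show thesis using that h' v DERIV_unique by (metis less_trans)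
  qed
  have "h' p \<le> h' q"
  proof (rule DERIV_nonneg_imp_nondecreasing[of p q h'])
    show "p \<le> q" using p q by simp
    show "\<exists>y. (h' has_real_derivative y) (at x) \<and> 0 \<le> y" if "p \<le> x" "x \<le> q" for x
      using h''[of x] pos[of x] that p q by auto
  qed
  show ?thesis
  proof (rule ccontr)
    assume "\<not> h v \<le> 0"
    then have "0 < (v - a) * h' p" "(b - v) * h' q < 0" using p q ends by auto
    then have "0 < h' p" "h' q < 0" using v by (auto simp: zero_less_mult_iff mult_less_0_iff)
    then show False using \<open>h' p \<le> h' q\<close> by linarith
  qed
qed

text \<open>The parabola \<open>F / 2 * ((x - a) * (b - x))\<close> is a barrier: subtracted from
  the signed error, it leaves a convex function that vanishes at both ends. The maximum of the
  parabola, at the midpoint, gives the factor \<open>1/8\<close>.\<close>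

lemma linear_interpolation_error:
  assumes f': "\<And>v. v \<in> {lo..hi} \<Longrightarrow> (f has_real_derivative f' v) (at v within {lo..hi})"
    and f'': "\<And>v. v \<in> {lo..hi} \<Longrightarrow> (f' has_real_derivative f'' v) (at v within {lo..hi})"
    and F: "\<And>v. v \<in> {lo..hi} \<Longrightarrow> \<bar>f'' v\<bar> \<le> F"
    and ab: "lo \<le> a" "a < b" "b \<le> hi" and v: "v \<in> {a..b}"
  shows "\<bar>f v - (f a + (f b - f a) / (b - a) * (v - a))\<bar> \<le> F * (b - a)\<^sup>2 / 8"
proof -
  have F0: "0 \<le> F" using F[of a] ab by auto
  define m where "m = (f b - f a) / (b - a)"
  have main: "\<sigma> * (f v - (f a + m * (v - a))) \<le> F / 2 * ((v - a) * (b - v))" if \<sigma>: "\<bar>\<sigma>\<bar> = 1" and v: "a < v" "v < b" for \<sigma>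
  proof -
    define h where "h x = \<sigma> * (f x - (f a + m * (x - a))) - F / 2 * ((x - a) * (b - x))" for x
    define h' where "h' x = \<sigma> * (f' x - m) - F / 2 * (b - x - (x - a))" for x
    have "h v \<le> 0"
    proof (rule nonpos_of_second_derivative_nonneg[OF _ _ _ _ _ _ v])
      have "continuous_on {lo..hi} f" by (rule DERIV_continuous_on) (rule f')
      then have "continuous_on {a..b} f" by (rule continuous_on_subset) (use ab in auto)
      then show "continuous_on {a..b} h" unfolding h_def[abs_def] by (intro continuous_intros)
      show "h a = 0" "h b = 0" using ab by (simp_all add: h_def m_def)
      fix x assume x: "a < x" "x < b"
      then have at: "at x within {lo..hi} = at x" using ab by (intro at_within_Icc_at) auto
      have d1: "(f has_real_derivative f' x) (at x)" using f'[of x] x ab unfolding at by auto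
      have d2: "(f' has_real_derivative f'' x) (at x)" using f''[of x] x ab unfolding at by auto
      show "(h has_real_derivative h' x) (at x)"
        unfolding h_def[abs_def] h'_def by (auto intro!: derivative_eq_intros d1)
      show "(h' has_real_derivative (\<sigma> * f'' x + F)) (at x)"
        unfolding h'_def[abs_def] by (auto intro!: derivative_eq_intros d2)
      show "0 \<le> \<sigma> * f'' x + F"
      proof -
        have "\<bar>\<sigma> * f'' x\<bar> \<le> F" using F[of x] x ab \<sigma> by (simp add: abs_mult)
        then show ?thesis by linarith
      qed
    qed
    then show ?thesis unfolding h_def by simp
  qed
  have amgm: "F / 2 * ((v - a) * (b - v)) \<le> F * (b - a)\<^sup>2 / 8"
  proof -
    have "4 * ((v - a) * (b - v)) \<le> (b - a)\<^sup>2"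
      using zero_le_power2[of "(v - a) - (b - v)"] by (simp add: power2_eq_square algebra_simps)
    moreover have "F / 2 * P \<le> F * Q / 8" if "4 * P \<le> Q" for P Q
      using mult_left_mono[OF that F0] by simp
    ultimately show ?thesis by blast
  qed
  consider "v = a" | "v = b" | "a < v" "v < b" using v by fastforce
  then have "\<bar>f v - (f a + m * (v - a))\<bar> \<le> F * (b - a)\<^sup>2 / 8"
  proof cases
    case 3
    have comb: "\<bar>x\<bar> \<le> R" if "1 * x \<le> P" "- 1 * x \<le> P" "P \<le> R" for x P R :: real
      using that by linarith
    show ?thesis by (rule comb[OF main[of 1] main[of "- 1"] amgm]) (use 3 in auto)
  qed (use ab F0 in \<open>auto simp: m_def\<close>)
  then show ?thesis unfolding m_def .
qed

section \<open>Breakpoints and the interpolated flux\<close>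

lemma breakpoints_mono:
  assumes "breakpoints lo hi \<delta> K w"
  shows "j \<le> K \<Longrightarrow> i \<le> j \<Longrightarrow> w i \<le> w j"
proof (induction j)
  case (Suc j)
  then have "w j < w (Suc j)" using assms unfolding breakpoints_def by simp
  with Suc show ?case by (cases "i = Suc j") fastforce+
qed simp

lemma breakpoint_cell:
  assumes "breakpoints lo hi \<delta> K w" "lo < hi" "v \<in> {lo..hi}"
  obtains k where "k < K" "v \<in> {w k..w (Suc k)}" "lo \<le> w k" "w (Suc k) \<le> hi" "w k < w (Suc k)" "w (Suc k) - w k \<le> \<delta>"
proof -
  have w: "w 0 = lo" "w K = hi" "\<And>k. k < K \<Longrightarrow> w k < w (Suc k)" "\<And>k. k < K \<Longrightarrow> w (Suc k) - w k \<le> \<delta>"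
    using assms(1) unfolding breakpoints_def by auto
  note inc = breakpoints_mono[OF assms(1)]
  have find: "n \<le> K \<Longrightarrow> v \<le> w n \<Longrightarrow> v \<le> w 0 \<or> (\<exists>i<n. w i \<le> v \<and> v \<le> w (Suc i))" for n
  proof (induction n)
    case (Suc n) then show ?case by (cases "v \<le> w n") (auto intro: less_SucI)
  qed simp
  have K: "0 < K" using w assms(2) by (cases K) auto
  have "\<exists>k<K. w k \<le> v \<and> v \<le> w (Suc k)"
    using find[of K] w(1,2) w(3)[OF K] assms(3) K by (metis atLeastAtMost_iff order.order_iff_strict order_antisym order_refl order_trans)
  then obtain k where k: "k < K" "w k \<le> v" "v \<le> w (Suc k)" by blast
  show thesis
    by (rule that[of k]) (use k w inc[of k 0] inc[of K "Suc k"] in auto)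
qed

text \<open>On each cell the slope is a difference quotient of \<open>f\<close>, hence at most
  \<open>L\<close> in modulus, and the cells are glued one after another. Both fluxes thus admit the
  same \<open>lam\<close> in the scheme.\<close>

lemma interpolant_Lipschitz:
  assumes bp: "breakpoints lo hi \<delta> K w" and li: "linear_interpolant f K w g"
    and f: "L-lipschitz_on {lo..hi} f"
  shows "L-lipschitz_on {lo..hi} g"
proof -
  have w: "w 0 = lo" "w K = hi" "\<And>k. k < K \<Longrightarrow> w k < w (Suc k)"
    using bp unfolding breakpoints_def by auto
  note inc = breakpoints_mono[OF bp]
  have L: "0 \<le> L" using f by (rule lipschitz_on_nonneg)
  have "n \<le> K \<Longrightarrow> L-lipschitz_on {w 0..w n} g" for n
  proof (induction n)
    case 0 show ?case using L by (intro lipschitz_onI) auto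
  next
    case (Suc n)
    define m where "m = (f (w (Suc n)) - f (w n)) / (w (Suc n) - w n)"
    have wn: "w n < w (Suc n)" using w(3)[of n] Suc by simp
    have g: "g v = f (w n) + m * (v - w n)" if "v \<in> {w n..w (Suc n)}" for v
      using li Suc(2) that unfolding linear_interpolant_def m_def by auto
    have mL: "\<bar>m\<bar> \<le> L"
    proof -
      have "\<bar>f (w (Suc n)) - f (w n)\<bar> \<le> L * \<bar>w (Suc n) - w n\<bar>"
        using lipschitz_onD[OF f, of "w (Suc n)" "w n"] inc[of n 0] inc[of K "Suc n"] inc[of "Suc n" 0] inc[of K n] Suc(2) w
        by (simp add: dist_real_def)
      then show ?thesis unfolding m_def using wn by (simp add: field_simps)
    qed
    have "L-lipschitz_on {w n..w (Suc n)} g"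
    proof (rule lipschitz_onI[OF _ L])
      fix x y assume "x \<in> {w n..w (Suc n)}" "y \<in> {w n..w (Suc n)}"
      then have "g x - g y = m * (x - y)" by (simp add: g algebra_simps)
      then show "dist (g x) (g y) \<le> L * dist x y"
        using mult_right_mono[OF mL, of "\<bar>x - y\<bar>"] by (simp add: dist_real_def abs_mult)
    qed
    moreover have "L-lipschitz_on {w 0..w n} g" using Suc by simp
    ultimately show ?case using lipschitz_on_concat[of L "w 0" "w n" g "w (Suc n)" g] by simp
  qed
  from this[of K] show ?thesis using w by simp
qed

section \<open>The error estimate\<close>

text \<open>Projection onto an interval. It extends the flux from the state interval to the line
  with the same Lipschitz constant, and a solution from \<open>{0..T}\<close> to all times.\<close>

definition clamp_to :: "real \<Rightarrow> real \<Rightarrow> real \<Rightarrow> real" where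
  "clamp_to a b x = max a (min b x)"

lemma clamp_to_mem: "a \<le> b \<Longrightarrow> clamp_to a b x \<in> {a..b}"
  by (auto simp: clamp_to_def)

lemma clamp_to_id: "x \<in> {a..b} \<Longrightarrow> clamp_to a b x = x"
  by (auto simp: clamp_to_def)

lemma clamp_Lipschitz:
  assumes "L-lipschitz_on {a..b} f" "a \<le> b"
  shows "L-lipschitz_on UNIV (\<lambda>x. f (clamp_to a b x))"
proof (rule lipschitz_onI)
  fix x y :: real
  have "dist (f (clamp_to a b x)) (f (clamp_to a b y)) \<le> L * dist (clamp_to a b x) (clamp_to a b y)"
    by (rule lipschitz_onD[OF assms(1)]) (use clamp_to_mem[OF assms(2)] in auto)
  also have "\<dots> \<le> L * dist x y"
    using lipschitz_on_nonneg[OF assms(1)]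
    by (intro mult_left_mono) (auto simp: dist_real_def clamp_to_def)
  finally show "dist (f (clamp_to a b x)) (f (clamp_to a b y)) \<le> L * dist x y" .
qed (rule lipschitz_on_nonneg[OF assms(1)])

text \<open>For test functions that vanish at time 0 the initial term disappears, and on the strip
  between 0 and \<open>T\<close> clamping changes neither the times nor the states.\<close>

lemma kruzkov_entropy_evolution:
  assumes K: "kruzkov_entropy_solution lo hi T f u0 u" and T: "0 < T" and lohi: "lo < hi"
    and f: "L-lipschitz_on {lo..hi} f"
  shows "entropy_evolution lo hi T L (\<lambda>x. f (clamp_to lo hi x)) (\<lambda>x t. u x (clamp_to 0 T t))"
proof
  have meas: "(\<lambda>(x, t). u x t) \<in> borel_measurable (restrict_space borel (UNIV \<times> {0..T}))"
    and range: "\<And>x t. t \<in> {0..T} \<Longrightarrow> u x t \<in> {lo..hi}"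
    and weak: "\<And>c \<phi>. c \<in> {lo..hi} \<Longrightarrow> test_function T \<phi> \<Longrightarrow>
        0 \<le> (LINT (x, t):UNIV \<times> {0<..<T}|lborel.
               \<bar>u x t - c\<bar> * deriv (\<lambda>s. \<phi> x s) t +
               sgn (u x t - c) * (f (u x t) - f c) * deriv (\<lambda>y. \<phi> y t) x)
           + (LINT x|lborel. \<bar>u0 x - c\<bar> * \<phi> x 0)"
    and cont: "\<And>R t. t \<in> {0..T} \<Longrightarrow>
        ((\<lambda>s. LINT x:{-R..R}|lborel. \<bar>u x s - u x t\<bar>) \<longlongrightarrow> 0) (at t within {0..T})"
    using K unfolding kruzkov_entropy_solution_def by blast+
  show "0 < T" by (rule T)
  show "L-lipschitz_on UNIV (\<lambda>x. f (clamp_to lo hi x))" using clamp_Lipschitz[OF f] lohi by simp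
  have "(\<lambda>(x::real, t). (x, clamp_to 0 T t)) \<in> borel \<rightarrow>\<^sub>M restrict_space borel (UNIV \<times> {0..T})"
  proof (rule measurable_restrict_space2)
    show "(\<lambda>(x::real, t). (x, clamp_to 0 T t)) \<in> borel \<rightarrow>\<^sub>M borel"
    proof (rule borel_measurable_continuous_onI)
      have "continuous_on UNIV (\<lambda>z :: real \<times> real. (fst z, max 0 (min T (snd z))))"
        by (intro continuous_intros)
      then show "continuous_on UNIV (\<lambda>(x::real, t). (x, clamp_to 0 T t))"
        by (simp add: case_prod_beta clamp_to_def)
    qed
  qed (use T clamp_to_mem[of 0 T] in auto)
  from measurable_compose[OF this meas]
  show "(\<lambda>(x, t). u x (clamp_to 0 T t)) \<in> borel_measurable borel"
    by (simp add: case_prod_beta)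
  show "u x (clamp_to 0 T t) \<in> {lo..hi}" for x t
    by (intro range clamp_to_mem) (use T in simp)
  show "((\<lambda>s. LINT x:{-R..R}|lborel. \<bar>u x (clamp_to 0 T s) - u x (clamp_to 0 T t)\<bar>) \<longlongrightarrow> 0) (at t within {0..T})"
    if t: "t \<in> {0..T}" for R t
  proof (rule Lim_transform_eventually[OF cont[OF t, of R]])
    show "\<forall>\<^sub>F s in at t within {0..T}. (LINT x:{-R..R}|lborel. \<bar>u x s - u x t\<bar>)
        = (LINT x:{-R..R}|lborel. \<bar>u x (clamp_to 0 T s) - u x (clamp_to 0 T t)\<bar>)"
      using t by (auto simp: eventually_at_filter clamp_to_id)
  qed
  fix c :: real and \<phi> :: "real \<Rightarrow> real \<Rightarrow> real"
  assume c: "c \<in> {lo..hi}" and \<phi>: "test_function T \<phi>" and z: "\<And>x. \<phi> x 0 = 0"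
  have "0 \<le> (LINT (x, t):UNIV \<times> {0<..<T}|lborel. \<bar>u x t - c\<bar> * deriv (\<lambda>s. \<phi> x s) t +
               sgn (u x t - c) * (f (u x t) - f c) * deriv (\<lambda>y. \<phi> y t) x)"
    using weak[OF c \<phi>] by (simp add: z)
  also have "\<dots> = (LINT (x, t):UNIV \<times> {0<..<T}|lborel. \<bar>u x (clamp_to 0 T t) - c\<bar> * deriv (\<lambda>s. \<phi> x s) t +
               kflux (\<lambda>x. f (clamp_to lo hi x)) (u x (clamp_to 0 T t)) c * deriv (\<lambda>y. \<phi> y t) x)"
    unfolding set_lebesgue_integral_def
  proof (intro Bochner_Integration.integral_cong refl)
    fix z :: "real \<times> real"
    obtain x t where xt: "z = (x, t)" by (cases z)
    show "indicator (UNIV \<times> {0<..<T}) z *\<^sub>R (case z of (x, t) \<Rightarrow> \<bar>u x t - c\<bar> * deriv (\<lambda>s. \<phi> x s) t +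
               sgn (u x t - c) * (f (u x t) - f c) * deriv (\<lambda>y. \<phi> y t) x)
      = indicator (UNIV \<times> {0<..<T}) z *\<^sub>R (case z of (x, t) \<Rightarrow> \<bar>u x (clamp_to 0 T t) - c\<bar> * deriv (\<lambda>s. \<phi> x s) t +
               kflux (\<lambda>x. f (clamp_to lo hi x)) (u x (clamp_to 0 T t)) c * deriv (\<lambda>y. \<phi> y t) x)"
    proof (cases "t \<in> {0<..<T}")
      case True
      then have t: "t \<in> {0..T}" by auto
      show ?thesis unfolding xt kflux_def using clamp_to_id[OF t] clamp_to_id[OF range[OF t, of x]] clamp_to_id[OF c] by simp
    qed (simp add: xt)
  qed
  finally show "0 \<le> (LINT (x, t):UNIV \<times> {0<..<T}|lborel. \<bar>u x (clamp_to 0 T t) - c\<bar> * deriv (\<lambda>s. \<phi> x s) t +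
               kflux (\<lambda>x. f (clamp_to lo hi x)) (u x (clamp_to 0 T t)) c * deriv (\<lambda>y. \<phi> y t) x)" .
qed

section \<open>Passage to the whole line and choice of parameters\<close>

lemma piecewise_constant_measurable:
  assumes "piecewise_constant v"
  shows "v \<in> borel_measurable borel"
proof -
  obtain J where J: "finite J" "\<And>x y. x \<le> y \<Longrightarrow> {x..y} \<inter> J = {} \<Longrightarrow> v x = v y"
    using assms unfolding piecewise_constant_def by blast
  have "continuous_on (- J) v"
    unfolding continuous_on_eq_continuous_at[OF open_Compl[OF finite_imp_closed[OF J(1)]]]
  proof
    fix x assume "x \<in> - J"
    moreover have "open (- J)" using J(1) by (intro open_Compl finite_imp_closed)
    ultimately obtain d where d: "0 < d" "ball x d \<subseteq> - J" using open_contains_ball by blast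
    have const: "v y = v x" if "y \<in> ball x d" for y
    proof -
      have "{min x y..max x y} \<subseteq> ball x d" using that by (auto simp: dist_real_def)
      then have "{min x y..max x y} \<inter> J = {}" using d(2) by blast
      then have "v (min x y) = v (max x y)" by (intro J(2)) auto
      then show ?thesis by (auto simp: min_def max_def split: if_splits)
    qed
    have "\<forall>\<^sub>F y in nhds x. v y = v x"
      unfolding eventually_nhds_metric
      by (intro exI[of _ d] conjI d(1) allI impI const) (simp add: dist_commute)
    then show "isCont v x" using isCont_cong[of v "\<lambda>_. v x" x] by simp
  qed
  then show ?thesis
    by (rule borel_measurable_continuous_countable_exceptions[OF countable_finite[OF J(1)]])
qed

text \<open>\<open>lxf_converges\<close> is local in space; a bound that does not depend on the
  window extends to the line by monotone convergence.\<close>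

lemma nn_integral_le_windows:
  fixes f :: "real \<Rightarrow> ennreal"
  assumes [measurable]: "f \<in> borel_measurable borel"
    and le: "\<And>R. (\<integral>\<^sup>+x. f x * indicator {-R..R} x \<partial>lborel) \<le> c"
  shows "(\<integral>\<^sup>+x. f x \<partial>lborel) \<le> c"
proof -
  have "(\<integral>\<^sup>+x. f x \<partial>lborel) = (\<integral>\<^sup>+x. (SUP n::nat. f x * indicator {-real n..real n} x) \<partial>lborel)"
  proof (intro nn_integral_cong antisym)
    fix x :: real
    obtain n :: nat where "\<bar>x\<bar> \<le> real n" using real_arch_simple by blast
    then have "f x = f x * indicator {-real n..real n} x" by (auto simp: indicator_def)
    also have "\<dots> \<le> (SUP n::nat. f x * indicator {-real n..real n} x)" by (rule SUP_upper) simp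
    finally show "f x \<le> (SUP n::nat. f x * indicator {-real n..real n} x)" .
    show "(SUP n::nat. f x * indicator {-real n..real n} x) \<le> f x"
      by (rule SUP_least) (simp add: indicator_def)
  qed
  also have "\<dots> = (SUP n::nat. \<integral>\<^sup>+x. f x * indicator {-real n..real n} x \<partial>lborel)"
  proof (rule nn_integral_monotone_convergence_SUP)
    show "incseq (\<lambda>n x. f x * indicator {-real n..real n} x)"
      by (auto simp: incseq_def le_fun_def indicator_def)
  qed measurable
  also have "\<dots> \<le> c" by (intro SUP_least le)
  finally show ?thesis .
qed

text \<open>The minimum over \<open>\<eta>\<close> is attained at \<open>sqrt a / sqrt c\<close>.
  For \<open>a = 0\<close> this is not a positive number, and \<open>\<eta>\<close> is sent to 0
  instead.\<close>

lemma ennreal_le_optimise: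
  fixes y c0 :: ennreal and a c :: real
  assumes "\<And>\<eta>. 0 < \<eta> \<Longrightarrow> y \<le> c0 + ennreal (a / \<eta> + c * \<eta>)" and a: "0 \<le> a" and c: "0 < c"
  shows "y \<le> c0 + ennreal (2 * sqrt (a * c))"
proof (cases "a = 0")
  case True
  have "y \<le> c0"
  proof (rule ennreal_le_epsilon)
    fix e :: real assume "0 < e"
    then show "y \<le> c0 + ennreal e" using assms(1)[of "e / c"] c True by simp
  qed
  then show ?thesis using True by simp
next
  case False
  then have a: "0 < a" using a by simp
  have s: "0 < sqrt a" "0 < sqrt c" using a c by auto
  have "a / (sqrt a / sqrt c) = sqrt a * sqrt c"
    using s a by (simp add: field_simps)
  moreover have "c * (sqrt a / sqrt c) = sqrt a * sqrt c"
    using s c real_sqrt_mult_self[of c] by (simp add: field_simps)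
  ultimately have "a / (sqrt a / sqrt c) + c * (sqrt a / sqrt c) = 2 * sqrt (a * c)"
    by (simp add: real_sqrt_mult)
  then show ?thesis using assms(1)[of "sqrt a / sqrt c"] s by simp
qed

text \<open>The triangle inequality through the two scheme solutions. The mesh tends to 0 first, at
  fixed window and fixed \<open>\<eta>\<close>; then the window grows, and only at the end is
  \<open>\<eta>\<close> optimised.\<close>

lemma flux_comparison:
  assumes u: "entropy_evolution lo hi T L f u" and u': "entropy_evolution lo hi T L g u'"
    and fg: "\<And>a. a \<in> {lo..hi} \<Longrightarrow> \<bar>f a - g a\<bar> \<le> \<epsilon>"
    and v_meas [measurable]: "v \<in> borel_measurable borel" "v' \<in> borel_measurable borel"
    and v: "\<And>x. v x \<in> {lo..hi}" and v': "\<And>x. v' x \<in> {lo..hi}"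
    and bv: "bounded_variation B v" "bounded_variation B v'"
    and far: "\<And>x. x < -X \<Longrightarrow> v x = uL" "\<And>x. X \<le> x \<Longrightarrow> v x = uR"
      "\<And>x. x < -X \<Longrightarrow> v' x = uL" "\<And>x. X \<le> x \<Longrightarrow> v' x = uR" and X: "0 < X"
    and M: "\<And>x. \<bar>LINT y|lborel. (v y - v' y) * indicator {..<x} y\<bar> \<le> M"
    and s: "L \<le> s" "0 < s" and t: "t \<in> {0..T}"
  shows "(\<integral>\<^sup>+x. ennreal \<bar>u x t - u' x t\<bar> \<partial>lborel)
    \<le> (\<integral>\<^sup>+x. ennreal \<bar>u x 0 - v x\<bar> \<partial>lborel) + (\<integral>\<^sup>+x. ennreal \<bar>u' x 0 - v' x\<bar> \<partial>lborel)
      + ennreal (2 * sqrt ((M + t * \<epsilon>) * B * (X + s * t)))"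
proof -
  let ?I = "\<integral>\<^sup>+x. ennreal \<bar>u x 0 - v x\<bar> \<partial>lborel"
    and ?J = "\<lambda>R. indicator {-R..R} :: real \<Rightarrow> ennreal" and ?I' = "\<integral>\<^sup>+x. ennreal \<bar>u' x 0 - v' x\<bar> \<partial>lborel"
  interpret U: entropy_evolution lo hi T L f u by (rule u)
  interpret U': entropy_evolution lo hi T L g u' by (rule u')
  \<comment> \<open>\<open>s\<close> is the speed of numerical propagation, since
    \<open>n * (lam * h) = t\<close> gives \<open>n * h = s * t\<close>.\<close>
  define lam where "lam = 1 / s"
  have lam: "0 < lam" "lam * L \<le> 1" using s by (simp_all add: lam_def field_simps)
  have cfl: "cfl lam L f" "cfl lam L g"
    using lam U.g_Lip U'.g_Lip by (auto intro: cfl.intro)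
  interpret F: cfl lam L f by (rule cfl)
  interpret G: cfl lam L g by (rule cfl)
  have B: "0 \<le> B" using bounded_variation_grid[OF bv(1), of 1 0 0] by simp
  have eps: "0 \<le> \<epsilon>" using fg[OF v[of 0]] by linarith
  have M0: "0 \<le> M" using M[of 0] by linarith
  have T0: "0 \<le> t" using t by simp
  have mod: "L1_modulus B v" "L1_modulus B v'"
    by (rule L1_modulusI[OF v_meas(1) bounded_variation_grid[OF bv(1)] far(1,2)], assumption+)
       (rule L1_modulusI[OF v_meas(2) bounded_variation_grid[OF bv(2)] far(3,4)], assumption+)
  define c0 where "c0 = ?I + ?I'"
  \<comment> \<open>\<open>a\<close> is the limiting bound on the primitive times the variation of
    the difference; \<open>c\<close> is a quarter of the length \<open>2 * (X + s * t)\<close> of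
    its support.\<close>
  define a where "a = (M + t * \<epsilon>) * (2 * B)"
  define c where "c = (X + s * t) / 2"
  have a0: "0 \<le> a" unfolding a_def using M0 T0 eps B by simp
  have c0: "0 < c" unfolding c_def using X s T0 by (simp add: add_pos_nonneg)
  have window: "(\<integral>\<^sup>+x. ennreal \<bar>u x t - u' x t\<bar> * ?J R x \<partial>lborel) \<le> c0 + ennreal (a / \<eta> + c * \<eta>)"
    if \<eta>: "0 < \<eta>" for R \<eta>
  proof (rule ennreal_le_epsilon)
    fix e :: real assume "0 < e"
    then have e3: "0 < e / 3" by simp
    obtain h1 where h1: "0 < h1" "\<And>h n. 0 < h \<Longrightarrow> h < h1 \<Longrightarrow> real n * (lam * h) = t \<Longrightarrow>
      (\<integral>\<^sup>+x. ennreal \<bar>u x t - lxf lam h f v n x\<bar> * ?J R x \<partial>lborel)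
        \<le> ?I + ennreal (e / 3)"
      using U.lxf_converges[OF cfl(1) v_meas(1) v mod(1) B t e3, of R] by blast
    obtain h2 where h2: "0 < h2" "\<And>h n. 0 < h \<Longrightarrow> h < h2 \<Longrightarrow> real n * (lam * h) = t \<Longrightarrow>
      (\<integral>\<^sup>+x. ennreal \<bar>u' x t - lxf lam h g v' n x\<bar> * ?J R x \<partial>lborel)
        \<le> ?I' + ennreal (e / 3)"
      using U'.lxf_converges[OF cfl(2) v_meas(2) v' mod(2) B t e3, of R] by blast
    \<comment> \<open>\<open>h * Q\<close> collects the mesh errors: \<open>4 * h * B\<close> in the
      initial primitive and \<open>6 * h\<close> in the length of the support.\<close>
    define Q where "Q = 4 * B * (2 * B) / \<eta> + 6 * \<eta> / 4"
    have Q: "0 < Q" unfolding Q_def using B \<eta> by (intro add_nonneg_pos) auto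
    define h3 where "h3 = Min {h1, h2, e / 3 / Q}"
    have h3: "0 < h3" unfolding h3_def using h1(1) h2(1) e3 Q by simp
    \<comment> \<open>The scheme has to reach \<open>t\<close> exactly, so \<open>h\<close> is taken
      among the fractions of \<open>s * t\<close>; at \<open>t = 0\<close> no step is made.\<close>
    obtain h n where h: "0 < h" "h < h3" and n: "real n * (lam * h) = t"
    proof (cases "t = 0")
      case True
      show thesis by (rule that[of "h3 / 2" 0]) (use h3 True in auto)
    next
      case False
      then have tp: "0 < t" using T0 by simp
      obtain m :: nat where m: "s * t / h3 < real m" using reals_Archimedean2 by blast
      have "0 < s * t / h3" using s tp h3 by simp
      then have m0: "0 < real m" using m by linarith
      show thesis
      proof (rule that[of "s * t / real m" m])
        show "0 < s * t / real m" using s tp m0 by simp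
        show "s * t / real m < h3" using m m0 h3 by (simp add: field_simps)
        show "real m * (lam * (s * t / real m)) = t" using m0 s by (simp add: lam_def)
      qed
    qed
    have hh: "h < h1" "h < h2" "h < e / 3 / Q"
      using h(2) unfolding h3_def by simp_all
    obtain D where D: "\<And>x. D (x + h) - D (x - h) = 2 * h * (v x - v' x)" "\<And>x. \<bar>D x\<bar> \<le> M + 4 * h * B"
    proof (rule initial_primitive[OF v_meas bv _ _ M h(1)])
      show "\<bar>v x - v' x\<bar> \<le> hi - lo" for x using v[of x] v'[of x] by auto
      show "v x = v' x" if "x \<notin> {-X..X}" for x using that far by (cases "x < -X") auto
    qed blast
    define W where "W = lxf lam h f v n"
    define W' where "W' = lxf lam h g v' n"
    have [measurable]: "W \<in> borel_measurable borel" "W' \<in> borel_measurable borel"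
      unfolding W_def W'_def by (intro F.lxf_measurable G.lxf_measurable v_meas)+
    have nh: "real n * h = s * t" using n s by (simp add: lam_def field_simps)
    have diff: "(\<integral>\<^sup>+x. ennreal \<bar>W x - W' x\<bar> \<partial>lborel) \<le> ennreal (a / \<eta> + c * \<eta> + e / 3)"
    proof -
      have "(\<integral>\<^sup>+x. ennreal \<bar>W x - W' x\<bar> \<partial>lborel)
         \<le> ennreal ((M + 4 * h * B + real n * (lam * h) * \<epsilon>) * (2 * B) / \<eta> + (2 * (X + real n * h) + 6 * h) * \<eta> / 4)"
        unfolding W_def W'_def
        by (rule lxf_difference[OF cfl h(1) fg v v' v_meas D far less_imp_le[OF X]
            bounded_variation_grid[OF bv(1)] bounded_variation_grid[OF bv(2)] \<eta>])
      also have "(M + 4 * h * B + real n * (lam * h) * \<epsilon>) * (2 * B) / \<eta> + (2 * (X + real n * h) + 6 * h) * \<eta> / 4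
          = a / \<eta> + c * \<eta> + h * Q"
        unfolding n nh a_def c_def Q_def using \<eta> by (simp add: field_simps)
      also have "ennreal \<dots> \<le> ennreal (a / \<eta> + c * \<eta> + e / 3)"
        using hh(3) Q by (intro ennreal_leI add_left_mono) (simp add: pos_less_divide_eq less_imp_le)
      finally show ?thesis .
    qed
    have "(\<integral>\<^sup>+x. ennreal \<bar>u x t - u' x t\<bar> * ?J R x \<partial>lborel)
      \<le> (\<integral>\<^sup>+x. ennreal \<bar>u x t - W x\<bar> * ?J R x + ennreal \<bar>u' x t - W' x\<bar> * ?J R x + ennreal \<bar>W x - W' x\<bar> \<partial>lborel)"
    proof (rule nn_integral_mono)
      fix x
      have "ennreal \<bar>u x t - u' x t\<bar> \<le> ennreal (\<bar>u x t - W x\<bar> + \<bar>u' x t - W' x\<bar> + \<bar>W x - W' x\<bar>)"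
        by (intro ennreal_leI) linarith
      then show "ennreal \<bar>u x t - u' x t\<bar> * ?J R x
        \<le> ennreal \<bar>u x t - W x\<bar> * ?J R x + ennreal \<bar>u' x t - W' x\<bar> * ?J R x + ennreal \<bar>W x - W' x\<bar>"
        by (cases "x \<in> {-R..R}") simp_all
    qed
    also have "\<dots> = (\<integral>\<^sup>+x. ennreal \<bar>u x t - W x\<bar> * ?J R x \<partial>lborel)
        + (\<integral>\<^sup>+x. ennreal \<bar>u' x t - W' x\<bar> * ?J R x \<partial>lborel) + (\<integral>\<^sup>+x. ennreal \<bar>W x - W' x\<bar> \<partial>lborel)"
      by (simp add: nn_integral_add)
    also have "\<dots> \<le> (?I + ennreal (e / 3))
        + (?I' + ennreal (e / 3)) + ennreal (a / \<eta> + c * \<eta> + e / 3)"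
      unfolding W_def W'_def
      by (intro add_mono h1(2) h2(2) h(1) hh n diff[unfolded W_def W'_def])
    also have "\<dots> = c0 + (ennreal (e / 3) + ennreal (e / 3) + ennreal (a / \<eta> + c * \<eta> + e / 3))"
      unfolding c0_def by (simp only: ac_simps)
    also have "ennreal (e / 3) + ennreal (e / 3) + ennreal (a / \<eta> + c * \<eta> + e / 3) = ennreal (a / \<eta> + c * \<eta>) + ennreal e"
    proof -
      have "0 \<le> a / \<eta> + c * \<eta>" using a0 c0 \<eta> by simp
      then show ?thesis using e3 by (simp add: ennreal_plus[symmetric] del: ennreal_plus)
    qed
    finally show "(\<integral>\<^sup>+x. ennreal \<bar>u x t - u' x t\<bar> * ?J R x \<partial>lborel) \<le> c0 + ennreal (a / \<eta> + c * \<eta>) + ennreal e"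
      by (simp add: add.assoc)
  qed
  have "(\<integral>\<^sup>+x. ennreal \<bar>u x t - u' x t\<bar> \<partial>lborel) \<le> c0 + ennreal (a / \<eta> + c * \<eta>)" if "0 < \<eta>" for \<eta>
    by (rule nn_integral_le_windows[OF _ window[OF that]]) measurable
  from ennreal_le_optimise[OF this a0 c0]
  have "(\<integral>\<^sup>+x. ennreal \<bar>u x t - u' x t\<bar> \<partial>lborel) \<le> c0 + ennreal (2 * sqrt (a * c))" .
  moreover have "a * c = (M + t * \<epsilon>) * B * (X + s * t)" unfolding a_def c_def by (simp add: field_simps)
  ultimately show ?thesis unfolding c0_def by simp
qed

text \<open>For positive \<open>L\<close> the speed \<open>s = 2 * L\<close> gives the bound
  directly. For \<open>L = 0\<close> the speed must still be positive, and it is sent to 0.\<close>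

lemma ennreal_le_speed_limit:
  fixes y c0 :: ennreal and A X T L :: real
  assumes le: "\<And>s. L \<le> s \<Longrightarrow> 0 < s \<Longrightarrow> y \<le> c0 + ennreal (2 * sqrt (A * (X + s * T)))"
    and nn: "0 \<le> A" "0 \<le> X" "0 \<le> T" "0 \<le> L"
  shows "y \<le> c0 + ennreal (2 * sqrt (A * (X + 2 * T * L)))"
proof (cases "L = 0")
  case False
  then show ?thesis using le[of "2 * L"] nn by (simp add: mult.commute mult.left_commute)
next
  case True
  show ?thesis
  proof (rule ennreal_le_epsilon)
    fix e :: real assume e: "0 < e"
    \<comment> \<open>Chosen to make \<open>sqrt (s * (A * T))\<close> at most \<open>e / 2\<close>;
      subadditivity of the square root then separates this part.\<close>
    define s where "s = (e / 2)\<^sup>2 / (A * T + 1)"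
    have AT: "0 \<le> A * T" using nn by simp
    have s: "0 < s" unfolding s_def using e AT by (intro divide_pos_pos) auto
    have "s * (A * T) \<le> s * (A * T + 1)" using s by simp
    also have "\<dots> = (e / 2)\<^sup>2" unfolding s_def using AT by simp
    finally have "s * (A * T) \<le> (e / 2)\<^sup>2" .
    then have sAT: "sqrt (s * (A * T)) \<le> e / 2" by (intro real_le_lsqrt) (use e in auto)
    have "sqrt (A * (X + s * T)) = sqrt (A * X + s * (A * T))" by (simp add: algebra_simps)
    also have "\<dots> \<le> sqrt (A * X) + sqrt (s * (A * T))"
      using nn AT s by (intro sqrt_add_le_add_sqrt) auto
    finally have "2 * sqrt (A * (X + s * T)) \<le> 2 * sqrt (A * X) + e" using sAT by linarith
    then have "ennreal (2 * sqrt (A * (X + s * T))) \<le> ennreal (2 * sqrt (A * X) + e)" by (rule ennreal_leI)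
    also have "\<dots> = ennreal (2 * sqrt (A * X)) + ennreal e"
      using nn e by (intro ennreal_plus) auto
    finally have "ennreal (2 * sqrt (A * (X + s * T))) \<le> ennreal (2 * sqrt (A * X)) + ennreal e" .
    then show "y \<le> c0 + ennreal (2 * sqrt (A * (X + 2 * T * L))) + ennreal e"
      using le[of s] s True by (simp add: add.assoc) (metis add_left_mono order_trans)
  qed
qed

theorem theorem4p3:
  fixes ulo uhi T Lf X uL uR :: real
    and f f' f'' u0 :: "real \<Rightarrow> real"
    and u :: "real \<Rightarrow> real \<Rightarrow> real"
    and K :: "real \<Rightarrow> nat" and w :: "real \<Rightarrow> nat \<Rightarrow> real"
    and fd u0d :: "real \<Rightarrow> real \<Rightarrow> real"
    and ud :: "real \<Rightarrow> real \<Rightarrow> real \<Rightarrow> real"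
  assumes "ulo < uhi" and "0 < T"
    and "\<And>v. v \<in> {ulo..uhi} \<Longrightarrow> (f has_real_derivative f' v) (at v within {ulo..uhi})"
    and "\<And>v. v \<in> {ulo..uhi} \<Longrightarrow> (f' has_real_derivative f'' v) (at v within {ulo..uhi})"
    and "continuous_on {ulo..uhi} f''"
    and "Lf-lipschitz_on {ulo..uhi} f"
    and "u0 \<in> borel_measurable borel"
    and "\<And>x. u0 x \<in> {ulo..uhi}"
    and "total_variation_on UNIV u0 < \<infinity>"
    and "0 < X"
    and "\<And>x. x \<le> -X \<Longrightarrow> u0 x = uL"
    and "\<And>x. x \<ge> X \<Longrightarrow> u0 x = uR"
    and "kruzkov_entropy_solution ulo uhi T f u0 u"
    and "\<And>\<delta>. \<delta> > 0 \<Longrightarrow> breakpoints ulo uhi \<delta> (K \<delta>) (w \<delta>)"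
    and "\<And>\<delta>. \<delta> > 0 \<Longrightarrow> linear_interpolant f (K \<delta>) (w \<delta>) (fd \<delta>)"
    and "\<And>\<delta>. \<delta> > 0 \<Longrightarrow> front_tracking_datum ulo uhi X uL uR u0 (u0d \<delta>)"
    and "\<exists>C. \<exists>\<delta>\<^sub>0>0. \<forall>\<delta>. 0 < \<delta> \<and> \<delta> < \<delta>\<^sub>0 \<longrightarrow> L1_norm (\<lambda>x. u0d \<delta> x - u0 x) \<le> ennreal (C * \<delta>)"
    and "\<And>\<delta>. \<delta> > 0 \<Longrightarrow> kruzkov_entropy_solution ulo uhi T (fd \<delta>) (u0d \<delta>) (ud \<delta>)"
    and "\<And>\<delta> t. \<delta> > 0 \<Longrightarrow> t \<in> {0..T} \<Longrightarrow>
           \<exists>g. piecewise_constant g \<and> (AE x in lborel. ud \<delta> x t = g x)"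
  shows "let TV = enn2real (total_variation_on UNIV u0);
             Y = X + 2 * T * Lf;
             C1 = 1 + 1/8 * T * (SUP v\<in>{ulo..uhi}. \<bar>f'' v\<bar>)
         in \<forall>\<delta>>0.
              (\<forall>t\<in>{0..T}. L1_norm (\<lambda>x. u x t - ud \<delta> x t)
                 \<le> ennreal (2 * sqrt (Y * TV * C1) * \<delta> + \<delta> * TV) + L1_norm (\<lambda>x. u0 x - u0d \<delta> x)) \<and>
              (cell_average_datum X uL uR \<delta> u0 (u0d \<delta>) \<longrightarrow>
                (\<forall>t\<in>{0..T}. L1_norm (\<lambda>x. u x t - ud \<delta> x t)
                   \<le> ennreal (2 * sqrt (Y * TV * C1) * \<delta>)))"
proof -
  define TV where "TV = enn2real (total_variation_on UNIV u0)"
  define Y where "Y = X + 2 * T * Lf"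
  define F where "F = (SUP v\<in>{ulo..uhi}. \<bar>f'' v\<bar>)"
  define C1 where "C1 = 1 + 1/8 * T * F"
  have Lf: "0 \<le> Lf" using assms(6) by (rule lipschitz_on_nonneg)
  have TVu0: "total_variation_on UNIV u0 = ennreal TV" and TV: "0 \<le> TV"
    using assms(9) unfolding TV_def by simp_all
  have F: "\<bar>f'' v\<bar> \<le> F" if "v \<in> {ulo..uhi}" for v
  proof -
    have "compact ((\<lambda>v. \<bar>f'' v\<bar>) ` {ulo..uhi})"
      by (intro compact_continuous_image continuous_intros assms(5)) auto
    then have "bdd_above ((\<lambda>v. \<bar>f'' v\<bar>) ` {ulo..uhi})" by (intro bounded_imp_bdd_above compact_imp_bounded)
    then show ?thesis unfolding F_def using that by (intro cSUP_upper)
  qed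
  have F0: "0 \<le> F" using F[of ulo] assms(1) by auto
  have C1: "0 \<le> C1" unfolding C1_def using F0 assms(2) by simp
  have bv: "bounded_variation TV v" if "total_variation_on UNIV v \<le> total_variation_on UNIV u0" for v
    unfolding bounded_variation_def using total_variation_sum[of UNIV v TV] that TV unfolding TVu0 by auto
  have far0: "u0 x = uL" if "x < -X" for x using assms(11)[of x] that by simp
  \<comment> \<open>\<open>v'\<close> is the starting datum of the scheme with the interpolated
    flux; the other scheme starts from \<open>u0\<close>. The cost of \<open>v'\<close> appears in
    two places, as an L1 distance to \<open>u0d \<delta>\<close> and as the bound \<open>M\<close>
    on the primitive of \<open>u0 - v'\<close>.\<close>
  have key: "L1_norm (\<lambda>x. u x t - ud \<delta> x t) \<le> L1_norm (\<lambda>x. u0d \<delta> x - v' x) + ennreal (2 * sqrt (Y * TV * C1) * \<delta>)"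
    if \<delta>: "0 < \<delta>" and t: "t \<in> {0..T}" and [measurable]: "v' \<in> borel_measurable borel"
      and v': "\<And>x. v' x \<in> {ulo..uhi}" "bounded_variation TV v'"
        "\<And>x. x < -X \<Longrightarrow> v' x = uL" "\<And>x. X \<le> x \<Longrightarrow> v' x = uR"
      and M: "\<And>x. \<bar>LINT y|lborel. (u0 y - v' y) * indicator {..<x} y\<bar> \<le> M" "M \<le> \<delta>\<^sup>2" for \<delta> t v' M
  proof -
    let ?f = "\<lambda>x. f (clamp_to ulo uhi x)" and ?g = "\<lambda>x. fd \<delta> (clamp_to ulo uhi x)"
    have fd_Lip: "Lf-lipschitz_on {ulo..uhi} (fd \<delta>)"
      by (rule interpolant_Lipschitz[OF assms(14)[OF \<delta>] assms(15)[OF \<delta>] assms(6)])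
    have E: "entropy_evolution ulo uhi T Lf ?f (\<lambda>x t. u x (clamp_to 0 T t))"
      "entropy_evolution ulo uhi T Lf ?g (\<lambda>x t. ud \<delta> x (clamp_to 0 T t))"
      by (rule kruzkov_entropy_evolution[OF assms(13,2,1,6)],
          rule kruzkov_entropy_evolution[OF assms(18)[OF \<delta>] assms(2,1) fd_Lip])
    have fg: "\<bar>?f a - ?g a\<bar> \<le> \<delta>\<^sup>2 * F / 8" if a: "a \<in> {ulo..uhi}" for a
    proof -
      obtain k where k: "k < K \<delta>" "a \<in> {w \<delta> k..w \<delta> (Suc k)}" "ulo \<le> w \<delta> k" "w \<delta> (Suc k) \<le> uhi"
          "w \<delta> k < w \<delta> (Suc k)" "w \<delta> (Suc k) - w \<delta> k \<le> \<delta>"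
        using breakpoint_cell[OF assms(14)[OF \<delta>] assms(1) a] by blast
      have "\<bar>f a - (f (w \<delta> k) + (f (w \<delta> (Suc k)) - f (w \<delta> k)) / (w \<delta> (Suc k) - w \<delta> k) * (a - w \<delta> k))\<bar>
          \<le> F * (w \<delta> (Suc k) - w \<delta> k)\<^sup>2 / 8"
        by (rule linear_interpolation_error[OF assms(3,4) F k(3,5,4,2)])
      also have "(f (w \<delta> k) + (f (w \<delta> (Suc k)) - f (w \<delta> k)) / (w \<delta> (Suc k) - w \<delta> k) * (a - w \<delta> k)) = fd \<delta> a"
        using assms(15)[OF \<delta>] k unfolding linear_interpolant_def by auto
      finally have "\<bar>f a - fd \<delta> a\<bar> \<le> F * (w \<delta> (Suc k) - w \<delta> k)\<^sup>2 / 8" .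
      also have "\<dots> \<le> F * \<delta>\<^sup>2 / 8"
        using k(5,6) F0 by (intro divide_right_mono mult_left_mono power_mono) auto
      finally show ?thesis by (simp add: clamp_to_id[OF a] mult.commute)
    qed
    have zero: "0 \<in> {0..T}" using assms(2) by simp
    have M0: "0 \<le> M" using M(1)[of 0] by linarith
    have init: "AE x in lborel. u x 0 = u0 x" "AE x in lborel. ud \<delta> x 0 = u0d \<delta> x"
      using assms(13) assms(18)[OF \<delta>] unfolding kruzkov_entropy_solution_def by blast+
    have i1: "(\<integral>\<^sup>+x. ennreal \<bar>u x 0 - u0 x\<bar> \<partial>lborel) = 0"
    proof -
      have "(\<integral>\<^sup>+x. ennreal \<bar>u x 0 - u0 x\<bar> \<partial>lborel) = (\<integral>\<^sup>+x. 0 \<partial>(lborel :: real measure))"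
        by (rule nn_integral_cong_AE) (use init(1) in eventually_elim, simp)
      then show ?thesis by simp
    qed
    have i2: "(\<integral>\<^sup>+x. ennreal \<bar>ud \<delta> x 0 - v' x\<bar> \<partial>lborel) = L1_norm (\<lambda>x. u0d \<delta> x - v' x)"
      unfolding L1_norm_def by (rule nn_integral_cong_AE) (use init(2) in eventually_elim, simp)
    \<comment> \<open>A bound for the primitive times the variation, uniform in time:
      \<open>M \<le> \<delta>\<^sup>2\<close> accounts for the \<open>1\<close> in \<open>C1\<close>
      and the flux error \<open>T * \<delta>\<^sup>2 * F / 8\<close> for the rest.\<close>
    define A where "A = \<delta>\<^sup>2 * C1 * TV"
    have A: "0 \<le> A" unfolding A_def using C1 TV by simp
    have bound: "L1_norm (\<lambda>x. u x t - ud \<delta> x t) \<le> L1_norm (\<lambda>x. u0d \<delta> x - v' x) + ennreal (2 * sqrt (A * (X + s * T)))"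
      if s: "Lf \<le> s" "0 < s" for s
    proof -
      have "(\<integral>\<^sup>+x. ennreal \<bar>u x (clamp_to 0 T t) - ud \<delta> x (clamp_to 0 T t)\<bar> \<partial>lborel)
        \<le> (\<integral>\<^sup>+x. ennreal \<bar>u x (clamp_to 0 T 0) - u0 x\<bar> \<partial>lborel) + (\<integral>\<^sup>+x. ennreal \<bar>ud \<delta> x (clamp_to 0 T 0) - v' x\<bar> \<partial>lborel)
          + ennreal (2 * sqrt ((M + t * (\<delta>\<^sup>2 * F / 8)) * TV * (X + s * t)))"
        by (rule flux_comparison[OF E fg assms(7) _ assms(8) v'(1) bv v'(2) far0 assms(12) v'(3,4) assms(10) M(1) s t]) auto
      then have "L1_norm (\<lambda>x. u x t - ud \<delta> x t) \<le> L1_norm (\<lambda>x. u0d \<delta> x - v' x)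
          + ennreal (2 * sqrt ((M + t * (\<delta>\<^sup>2 * F / 8)) * TV * (X + s * t)))"
        unfolding clamp_to_id[OF t] clamp_to_id[OF zero] i1 i2 by (simp add: L1_norm_def)
      also have "(M + t * (\<delta>\<^sup>2 * F / 8)) * TV * (X + s * t) \<le> A * (X + s * T)"
      proof (rule mult_mono)
        have "t * (\<delta>\<^sup>2 * F / 8) \<le> T * (\<delta>\<^sup>2 * F / 8)" using t F0 by (intro mult_right_mono) auto
        then have "M + t * (\<delta>\<^sup>2 * F / 8) \<le> \<delta>\<^sup>2 * C1" using M(2) unfolding C1_def by (simp add: algebra_simps)
        then show "(M + t * (\<delta>\<^sup>2 * F / 8)) * TV \<le> A" unfolding A_def using TV by (rule mult_right_mono)
      qed (use s t assms(10) A in auto)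
      finally show ?thesis by (simp add: ennreal_leI add_left_mono)
    qed
    have "L1_norm (\<lambda>x. u x t - ud \<delta> x t) \<le> L1_norm (\<lambda>x. u0d \<delta> x - v' x) + ennreal (2 * sqrt (A * (X + 2 * T * Lf)))"
      by (rule ennreal_le_speed_limit[OF bound A]) (use assms(2,10) Lf in auto)
    also have "sqrt (A * (X + 2 * T * Lf)) = sqrt (Y * TV * C1) * \<delta>"
    proof -
      have "A * (X + 2 * T * Lf) = (Y * TV * C1) * \<delta>\<^sup>2" unfolding A_def Y_def by (simp only: ac_simps)
      then show ?thesis using \<delta> by (simp only: real_sqrt_mult real_sqrt_abs abs_of_pos)
    qed
    finally show ?thesis by (simp add: mult.assoc)
  qed
  \<comment> \<open>Here \<open>v' = u0\<close>: both schemes have the same datum, so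
    \<open>M = 0\<close> and the L1 distance of the data remains.\<close>
  have gen: "L1_norm (\<lambda>x. u x t - ud \<delta> x t) \<le> ennreal (2 * sqrt (Y * TV * C1) * \<delta> + \<delta> * TV) + L1_norm (\<lambda>x. u0 x - u0d \<delta> x)"
    if \<delta>: "0 < \<delta>" and t: "t \<in> {0..T}" for \<delta> t
  proof -
    have "L1_norm (\<lambda>x. u x t - ud \<delta> x t) \<le> L1_norm (\<lambda>x. u0d \<delta> x - u0 x) + ennreal (2 * sqrt (Y * TV * C1) * \<delta>)"
      by (rule key[OF \<delta> t assms(7,8) bv far0 assms(12), where M=0]) auto
    also have "\<dots> \<le> L1_norm (\<lambda>x. u0d \<delta> x - u0 x) + ennreal (2 * sqrt (Y * TV * C1) * \<delta> + \<delta> * TV)"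
      using \<delta> TV by (intro add_left_mono ennreal_leI) simp
    also have "L1_norm (\<lambda>x. u0d \<delta> x - u0 x) = L1_norm (\<lambda>x. u0 x - u0d \<delta> x)"
      by (simp add: L1_norm_def abs_minus_commute)
    finally show ?thesis by (simp add: add.commute)
  qed
  \<comment> \<open>Here \<open>v' = u0d \<delta>\<close>: the L1 distance is zero, and the cell
    averages provide \<open>M = \<delta>\<^sup>2\<close>.\<close>
  have cell: "L1_norm (\<lambda>x. u x t - ud \<delta> x t) \<le> ennreal (2 * sqrt (Y * TV * C1) * \<delta>)"
    if \<delta>: "0 < \<delta>" and t: "t \<in> {0..T}" and c: "cell_average_datum X uL uR \<delta> u0 (u0d \<delta>)" for \<delta> t
  proof -
    have d: "piecewise_constant (u0d \<delta>)" "\<And>x. u0d \<delta> x \<in> {ulo..uhi}"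
        "total_variation_on UNIV (u0d \<delta>) \<le> total_variation_on UNIV u0"
        "\<And>x. x < - X \<Longrightarrow> u0d \<delta> x = uL" "\<And>x. X \<le> x \<Longrightarrow> u0d \<delta> x = uR"
      using assms(16)[OF \<delta>] unfolding front_tracking_datum_def by auto
    have m: "u0d \<delta> \<in> borel_measurable borel" by (rule piecewise_constant_measurable[OF d(1)])
    have bd: "\<bar>x\<bar> \<le> max \<bar>ulo\<bar> \<bar>uhi\<bar>" if "x \<in> {ulo..uhi}" for x using that by auto
    have "\<bar>LINT y|lborel. (u0 y - u0d \<delta> y) * indicator {..<x} y\<bar> \<le> \<delta>\<^sup>2" for x
      by (rule cell_average_primitive[OF c \<delta> assms(7) bd[OF assms(8)] m bd[OF d(2)] far0 assms(12)])
    from key[OF \<delta> t m d(2) bv[OF d(3)] d(4,5) this order_refl]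
    show ?thesis by (simp add: L1_norm_def)
  qed
  show ?thesis unfolding Let_def TV_def[symmetric] Y_def[symmetric] F_def[symmetric] C1_def[symmetric]
    using gen cell by blast
qed

end
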